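(* Fix $\theta>0$. For each $n\ge 1$ let $\mathbf{x}(t)=(x_1(t),\dots,x_n(t))$ be the $\beta$-nonintersecting Poisson random walk (with $\beta=2\theta$) started from some initial data $\mathbf{x}(0)\in\mathbb{W}^n_\theta$, and let $\mu^n_t=\frac1n\sum_{i=1}^n\delta_{x_i(t)/(\theta n)}$ be its empirical measure process. Assume that there exists $\mu_0\in M_1(\mathbb{R})$ such that $\mu^n_0$ converges to $\mu_0$ in the Lévy metric as $n\to\infty$ almost surely (respectively, in probability). Then for every fixed $T>0$, $\{\mu^n_t\}_{0\le t\le T}$ converges as $n\to\infty$ in $D([0,T],M_1(\mathbb{R}))$ almost surely (respectively, in probability). The limit is the unique measure-valued process $\{\mu_t\}_{0\le t\le T}$ (with the given $\mu_0$ at time $0$) such that each $\mu_t$ has a density satisfying $0\le \mathrm{d}\mu_t(x)/\mathrm{d}x\le 1$ and whose Stieltjes transform $m_t(z)=\int\frac{\mathrm{d}\mu_t(x)}{x-z}$ satisfies $$m_t(z)=m_0(z)-\int_0^t e^{-m_s(z)}\,\partial_z m_s(z)\,\mathrm{d}s\qquad\text{for all } z\in\mathbb{C}\setminus\mathbb{R},\ 0\le t\le T.$$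
   Context: For $\theta>0$ and $n\ge1$, let $\mathbb{W}^n_\theta=\{(\lambda_1+(n-1)\theta,\lambda_2+(n-2)\theta,\dots,\lambda_n):\lambda_i\in\mathbb{Z}_{\ge0},\ \lambda_1\ge\lambda_2\ge\dots\ge\lambda_n\ge0\}$. The $\beta$-nonintersecting Poisson random walk is the continuous-time Markov jump process on $\mathbb{W}^n_\theta$ with generator $$\mathcal{L}^n_\theta f(\mathbf{x})=\theta n\sum_{i=1}^n\Big(\prod_{j\ne i}\frac{x_i-x_j+\theta}{x_i-x_j}\Big)\big(f(\mathbf{x}+\mathbf{e}_i)-f(\mathbf{x})\big),$$ where $\mathbf{e}_i$ is the $i$-th standard basis vector. $M_1(\mathbb{R})$ is the space of probability measures on $\mathbb{R}$ with the weak topology, metrized by the Lévy metric $\mathrm{dist}(\mu,\nu)=\inf\{\varepsilon:\mu(-\infty,x-\varepsilon)-\varepsilon\le\nu(-\infty,x)\le\mu(-\infty,x+\varepsilon)+\varepsilon\ \forall x\}$. $D([0,T],M_1(\mathbb{R}))$ is the space of càdlàg maps $[0,T]\to M_1(\mathbb{R})$ with the Skorokhod metric; almost sure convergence means convergence in this metric almost surely. *)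

theory Defs
  imports "HOL-Probability.Probability"
begin

text \<open>States are functions nat => real, coordinates indexed 0..n-1 (paper's x_1..x_n),
  and equal to 0 outside 0..n-1.\<close>

definition Wset :: "nat \<Rightarrow> real \<Rightarrow> (nat \<Rightarrow> real) set" where
  "Wset n \<theta> = {x. \<exists>l::nat \<Rightarrow> nat.
      (\<forall>i j. i \<le> j \<longrightarrow> j < n \<longrightarrow> l j \<le> l i) \<and>
      (\<forall>i<n. x i = real (l i) + real (n - 1 - i) * \<theta>) \<and>
      (\<forall>i. n \<le> i \<longrightarrow> x i = 0)}"

definition unit_vec :: "nat \<Rightarrow> nat \<Rightarrow> real" where
  "unit_vec i = (\<lambda>j. if j = i then 1 else 0)"

definition gen :: "nat \<Rightarrow> real \<Rightarrow> ((nat \<Rightarrow> real) \<Rightarrow> real) \<Rightarrow> (nat \<Rightarrow> real) \<Rightarrow> real" where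
  "gen n \<theta> f x = \<theta> * real n * (\<Sum>i<n.
      (\<Prod>j\<in>{j. j < n \<and> j \<noteq> i}. (x i - x j + \<theta>) / (x i - x j)) *
      (f (\<lambda>j. x j + unit_vec i j) - f x))"

text \<open>Transition semigroup exp(t L) (the rates are bounded, so the series converges).\<close>
definition trans_sg :: "nat \<Rightarrow> real \<Rightarrow> real \<Rightarrow> ((nat \<Rightarrow> real) \<Rightarrow> real) \<Rightarrow> (nat \<Rightarrow> real) \<Rightarrow> real" where
  "trans_sg n \<theta> t f x = (\<Sum>k. t ^ k / fact k * ((gen n \<theta> ^^ k) f) x)"

definition nat_filt :: "'a measure \<Rightarrow> (real \<Rightarrow> 'a \<Rightarrow> 'b) \<Rightarrow> real \<Rightarrow> 'a set set" where
  "nat_filt M X s = sigma_sets (space M) {X r -` B \<inter> space M | r B. 0 \<le> r \<and> r \<le> s}"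

definition is_NIPRW :: "'a measure \<Rightarrow> nat \<Rightarrow> real \<Rightarrow> (real \<Rightarrow> 'a \<Rightarrow> (nat \<Rightarrow> real)) \<Rightarrow> bool" where
  "is_NIPRW M n \<theta> X \<longleftrightarrow>
     (\<forall>t\<ge>0. X t \<in> measurable M (count_space UNIV)) \<and>
     (\<forall>t\<ge>0. \<forall>\<omega>\<in>space M. X t \<omega> \<in> Wset n \<theta>) \<and>
     (\<forall>\<omega>\<in>space M. \<forall>t\<ge>0. \<exists>\<delta>>0. \<forall>s. t \<le> s \<and> s \<le> t + \<delta> \<longrightarrow> X s \<omega> = X t \<omega>) \<and>
     (\<forall>s\<ge>0. \<forall>t\<ge>0. \<forall>A\<in>nat_filt M X s. \<forall>y.
        measure M (A \<inter> {\<omega>\<in>space M. X (s + t) \<omega> = y}) =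
        (\<integral>\<omega>. indicator A \<omega> * trans_sg n \<theta> t (\<lambda>z. if z = y then 1 else 0) (X s \<omega>) \<partial>M))"

definition M1 :: "real measure set" where
  "M1 = {\<mu>. sets \<mu> = sets borel \<and> prob_space \<mu>}"

definition emp :: "nat \<Rightarrow> real \<Rightarrow> (nat \<Rightarrow> real) \<Rightarrow> real measure" where
  "emp n \<theta> x = measure_of UNIV (sets borel)
      (\<lambda>A. ennreal (real (card {i. i < n \<and> x i / (\<theta> * real n) \<in> A}) / real n))"

definition levy :: "real measure \<Rightarrow> real measure \<Rightarrow> real" where
  "levy \<mu> \<nu> = Inf {\<epsilon>. \<epsilon> > 0 \<and> (\<forall>x.
      measure \<mu> {..<x - \<epsilon>} - \<epsilon> \<le> measure \<nu> {..<x} \<and>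
      measure \<nu> {..<x} \<le> measure \<mu> {..<x + \<epsilon>} + \<epsilon>)}"

definition time_change :: "real \<Rightarrow> (real \<Rightarrow> real) \<Rightarrow> bool" where
  "time_change T r \<longleftrightarrow> continuous_on {0..T} r \<and> strict_mono_on {0..T} r \<and> r ` {0..T} = {0..T}"

definition skorokhod :: "real \<Rightarrow> ('e \<Rightarrow> 'e \<Rightarrow> real) \<Rightarrow> (real \<Rightarrow> 'e) \<Rightarrow> (real \<Rightarrow> 'e) \<Rightarrow> real" where
  "skorokhod T d f g = Inf {\<epsilon>. \<epsilon> > 0 \<and> (\<exists>r. time_change T r \<and>
      (\<forall>t\<in>{0..T}. \<bar>r t - t\<bar> \<le> \<epsilon> \<and> d (f t) (g (r t)) \<le> \<epsilon>))}"

definition stieltjes :: "real measure \<Rightarrow> complex \<Rightarrow> complex" where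
  "stieltjes \<mu> z = (\<integral>x. 1 / (complex_of_real x - z) \<partial>\<mu>)"

definition density_le_one :: "real measure \<Rightarrow> bool" where
  "density_le_one \<mu> \<longleftrightarrow> (\<exists>f::real \<Rightarrow> real. f \<in> borel_measurable borel \<and>
      (\<forall>x. 0 \<le> f x \<and> f x \<le> 1) \<and> \<mu> = density lborel (\<lambda>x. ennreal (f x)))"

definition limit_process :: "real \<Rightarrow> real measure \<Rightarrow> (real \<Rightarrow> real measure) \<Rightarrow> bool" where
  "limit_process T \<mu>0 \<mu> \<longleftrightarrow> \<mu> 0 = \<mu>0 \<and>
     (\<forall>t\<in>{0..T}. \<mu> t \<in> M1 \<and> density_le_one (\<mu> t)) \<and>
     (\<forall>z. Im z \<noteq> 0 \<longrightarrow> (\<forall>t\<in>{0..T}.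
        (\<lambda>s. exp (- stieltjes (\<mu> s) z) * deriv (stieltjes (\<mu> s)) z) integrable_on {0..t} \<and>
        stieltjes (\<mu> t) z = stieltjes (\<mu> 0) z -
          integral {0..t} (\<lambda>s. exp (- stieltjes (\<mu> s) z) * deriv (stieltjes (\<mu> s)) z)))"

text \<open>Outer probability (to avoid measurability side conditions).\<close>
definition outer_prob :: "'a measure \<Rightarrow> 'a set \<Rightarrow> real" where
  "outer_prob M A = Inf {measure M B | B. B \<in> sets M \<and> A \<subseteq> B}"

definition conv_in_prob :: "'a measure \<Rightarrow> (nat \<Rightarrow> 'a \<Rightarrow> real) \<Rightarrow> bool" where
  "conv_in_prob M D \<longleftrightarrow> (\<forall>\<epsilon>>0. (\<lambda>n. outer_prob M {\<omega>\<in>space M. D n \<omega> > \<epsilon>}) \<longlonglongrightarrow> 0)"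

definition conv_as :: "'a measure \<Rightarrow> (nat \<Rightarrow> 'a \<Rightarrow> real) \<Rightarrow> bool" where
  "conv_as M D \<longleftrightarrow> (AE \<omega> in M. (\<lambda>n. D n \<omega>) \<longlonglongrightarrow> 0)"

end

theory Submission
  imports Defs "HOL-Complex_Analysis.Complex_Analysis"
begin

text \<open>Write \<open>m\<^sub>t\<close> for the Stieltjes transform at time \<open>t\<close>. The limiting equation is
  \<open>\<partial>\<^sub>t m + exp (- m) \<partial>\<^sub>z m = 0\<close>, whose characteristics are the straight lines
  \<open>z + t exp (- m\<^sub>0 z)\<close>, along which \<open>m\<close> is constant. When \<open>Im z\<close> is large compared to the time
  horizon, these lines stay in the upper half plane, and they cover a half plane there; by analytic
  continuation and Stieltjes inversion they determine the measures. This gives uniqueness, and it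
  reduces convergence at a fixed time to the statement that the empirical transform is almost
  constant along the line \<open>z + t exp (- m\<^sub>0\<^sup>n z)\<close> started from its own random initial value.

  The latter is a second moment bound. Partial fractions show that the generator maps the empirical
  transform to a difference quotient of \<open>\<Prod>\<^sub>j (1 + 1 / (n (z - y\<^sub>j)))\<close>, that is, to
  \<open>- exp (- m) \<partial>\<^sub>z m + O(1/n)\<close>, and its squared jumps contribute \<open>O(1/n\<^sup>2)\<close> per unit time. A Gronwall
  argument over short time steps, for which only the one-step transition probabilities are needed,
  bounds the second moment by \<open>O(1/n\<^sup>2)\<close>; this is summable, so that Borel-Cantelli covers the almost
  sure case. Convergence is uniform in time because the paths are monotone and the limit is
  continuous. The limit itself is obtained by compactness for each \<open>t\<close> separately; it solves the
  equation because it is constant along the characteristics.\<close>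

section \<open>The Stieltjes transform of a probability measure\<close>

text \<open>The walk is accessible only through its transition probabilities to single states, so a
  martingale decomposition is replaced by a step inequality for second moments. Its second-order
  error may depend on n arbitrarily badly, since the time step tends to 0 with n fixed. The initial
  configurations converge without any rate. A comparison with the characteristic of the limit
  \<open>\<mu>0\<close> would carry this error into the second moment and destroy summability. Along
  the characteristic started from the walk's own initial transform the deviation is 0 at time 0, and
  the convergence of the initial data enters only afterwards, deterministically. Above height 1 one
  has |m| <= 1, hence |exp (- m)| <= 3, and a line moves by at most 3 T up to time T; this is the
  origin of the half plane Im z > 3 T + 2. The bound 1 on the density comes from the spacing:
  neighbouring particles are at least \<theta> apart, so their rescaled positions are at least 1 / n
  apart and carry mass 1 / n each.\<close>

lemma M1_iff: "\<mu> \<in> M1 \<longleftrightarrow> real_distribution \<mu>"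
  by (auto simp: M1_def real_distribution_def real_distribution_axioms_def)

text \<open>With the explicit resolvent remainder below, this takes the place of differentiation
  under the integral sign.\<close>

lemma has_field_derivative_quadratic:
  fixes f :: "'a::real_normed_field \<Rightarrow> 'a"
  assumes "d > 0" and "\<And>y. norm (y - x) < d \<Longrightarrow> norm (f y - f x - D * (y - x)) \<le> K * norm (y - x) ^ 2"
  shows "(f has_field_derivative D) (at x)"
  unfolding has_field_derivative_def has_derivative_at_within[of _ _ x UNIV]
proof (intro conjI bounded_linear_mult_right)
  have "((\<lambda>y. K * norm (y - x)) \<longlongrightarrow> K * norm (x - x)) (at x)"
    by (intro tendsto_intros)
  then have lim: "((\<lambda>y. K * norm (y - x)) \<longlongrightarrow> 0) (at x)" by simp
  have ev: "\<forall>\<^sub>F y in at x. norm ((f y - f x - D * (y - x)) /\<^sub>R norm (y - x)) \<le> K * norm (y - x)"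
    unfolding eventually_at
  proof (intro exI[of _ d] conjI ballI impI \<open>d > 0\<close>)
    fix y assume "y \<noteq> x \<and> dist y x < d"
    then have "norm (y - x) > 0" and "norm (y - x) < d" by (auto simp: dist_norm)
    with assms(2)[of y] have "norm (f y - f x - D * (y - x)) / norm (y - x) \<le> K * norm (y - x)"
      by (simp only: pos_divide_le_eq) (simp add: power2_eq_square mult.assoc)
    then show "norm ((f y - f x - D * (y - x)) /\<^sub>R norm (y - x)) \<le> K * norm (y - x)"
      by (simp add: divide_inverse mult.commute)
  qed
  have "((\<lambda>y. (f y - f x - D * (y - x)) /\<^sub>R norm (y - x)) \<longlongrightarrow> 0) (at x)"
    by (rule Lim_null_comparison[OF ev lim])
  then show "((\<lambda>y. (f y - f x - D * (y - x)) /\<^sub>R norm (y - x)) \<longlongrightarrow> 0) (at x)" .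
qed

lemma Im_le_norm_of_real_diff: "\<bar>Im z\<bar> \<le> norm (complex_of_real x - z)"
  using abs_Im_le_cmod[of "complex_of_real x - z"] by simp

lemma norm_resolvent_le:
  assumes "Im z \<noteq> 0"
  shows "norm (1 / (complex_of_real x - z)) \<le> 1 / \<bar>Im z\<bar>"
  using Im_le_norm_of_real_diff[of z x] assms
  by (simp add: norm_divide frac_le)

lemma norm_resolvent_power_le:
  assumes "Im z \<noteq> 0"
  shows "norm (1 / (complex_of_real x - z) ^ k) \<le> 1 / \<bar>Im z\<bar> ^ k"
  using power_mono[OF norm_resolvent_le[OF assms, of x], of k] by (simp add: norm_divide norm_power power_divide)

lemma of_real_diff_nonzero: "Im z \<noteq> 0 \<Longrightarrow> complex_of_real x - z \<noteq> 0"
  by (auto simp: complex_eq_iff)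

text \<open>The derivative of \<open>stieltjes\<close> in z as an explicit integral, so that bounds
  and weak limits apply to it directly; \<open>deriv_stieltjes\<close> returns to the
  \<open>deriv\<close> of \<open>limit_process\<close>.\<close>

definition stieltjes' :: "real measure \<Rightarrow> complex \<Rightarrow> complex" where
  "stieltjes' \<mu> z = (\<integral>x. 1 / (complex_of_real x - z)\<^sup>2 \<partial>\<mu>)"

context real_distribution
begin

lemma integrable_resolvent_power:
  "Im z \<noteq> 0 \<Longrightarrow> integrable M (\<lambda>x. 1 / (complex_of_real x - z) ^ k)"
  by (rule integrable_const_bound[where B = "1 / \<bar>Im z\<bar> ^ k"])
     (use norm_resolvent_power_le in auto)

lemma integrable_resolvent:
  "Im z \<noteq> 0 \<Longrightarrow> integrable M (\<lambda>x. 1 / (complex_of_real x - z))"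
  using integrable_resolvent_power[of z 1] by simp

lemma norm_expectation_le:
  fixes f :: "real \<Rightarrow> 'b :: {banach, second_countable_topology}"
  assumes "integrable M f" "\<And>x. norm (f x) \<le> B"
  shows "norm (integral\<^sup>L M f) \<le> B"
proof -
  have "norm (integral\<^sup>L M f) \<le> (\<integral>x. norm (f x) \<partial>M)" by (rule integral_norm_bound)
  also have "\<dots> \<le> (\<integral>x. B \<partial>M)"
    using assms by (intro integral_mono) auto
  also have "(\<integral>x. B \<partial>M) = B" using prob_space by simp
  finally show ?thesis .
qed

lemma norm_stieltjes_le: "Im z \<noteq> 0 \<Longrightarrow> norm (stieltjes M z) \<le> 1 / \<bar>Im z\<bar>"
  unfolding stieltjes_def by (intro norm_expectation_le integrable_resolvent norm_resolvent_le)

lemma norm_stieltjes'_le: "Im z \<noteq> 0 \<Longrightarrow> norm (stieltjes' M z) \<le> 1 / (Im z)\<^sup>2"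
  unfolding stieltjes'_def
  using norm_expectation_le[OF integrable_resolvent_power norm_resolvent_power_le, of z 2] by simp

text \<open>The remainder of the resolvent is exact: with a = x - z and b = x - w it is (a - b)^2 /
  (b a^2). Hence the bound holds at any distance, even across the real axis.\<close>

lemma stieltjes_taylor:
  assumes "Im z \<noteq> 0" "Im w \<noteq> 0"
  shows "norm (stieltjes M w - stieltjes M z - stieltjes' M z * (w - z)) \<le> norm (w - z)^2 / (\<bar>Im w\<bar> * \<bar>Im z\<bar>\<^sup>2)"
proof -
  have eq: "1 / (complex_of_real x - w) - 1 / (complex_of_real x - z) - 1 / (complex_of_real x - z)\<^sup>2 * (w - z)
       = (w - z)^2 * (1 / (complex_of_real x - w) * (1 / (complex_of_real x - z)^2))" for x
  proof -
    have "1 / b - 1 / a - 1 / a\<^sup>2 * (a - b) = (a - b)^2 * (1 / b * (1 / a\<^sup>2))"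
      if "a \<noteq> 0" "b \<noteq> 0" for a b :: complex
      using that by (simp add: divide_simps power2_eq_square) (simp add: algebra_simps)
    from this[OF of_real_diff_nonzero[OF assms(1), of x] of_real_diff_nonzero[OF assms(2), of x]]
    show ?thesis by simp
  qed
  have "stieltjes M w - stieltjes M z - stieltjes' M z * (w - z) =
      (\<integral>x. 1 / (complex_of_real x - w) - 1 / (complex_of_real x - z) - 1 / (complex_of_real x - z)\<^sup>2 * (w - z) \<partial>M)"
    unfolding stieltjes_def stieltjes'_def
    using integrable_resolvent[OF assms(1)] integrable_resolvent[OF assms(2)] integrable_resolvent_power[OF assms(1), of 2]
    by (simp only: Bochner_Integration.integral_diff Bochner_Integration.integrable_diff
        integral_mult_left_zero integrable_mult_left)
  also have "norm \<dots> \<le> norm (w - z)^2 / (\<bar>Im w\<bar> * \<bar>Im z\<bar>\<^sup>2)"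
  proof (rule norm_expectation_le)
    show "integrable M (\<lambda>x. 1 / (complex_of_real x - w) - 1 / (complex_of_real x - z) - 1 / (complex_of_real x - z)\<^sup>2 * (w - z))"
      using integrable_resolvent[OF assms(1)] integrable_resolvent[OF assms(2)] integrable_resolvent_power[OF assms(1), of 2]
      by (intro Bochner_Integration.integrable_diff integrable_mult_left)
    fix x
    have "norm (1 / (complex_of_real x - w) * (1 / (complex_of_real x - z)^2)) \<le> 1 / \<bar>Im w\<bar> * (1 / \<bar>Im z\<bar>^2)"
      unfolding norm_mult using norm_resolvent_le[OF assms(2), of x] norm_resolvent_power_le[OF assms(1), of x 2]
      by (intro mult_mono) auto
    from mult_left_mono[OF this, of "norm (w - z)^2"]
    show "norm (1 / (complex_of_real x - w) - 1 / (complex_of_real x - z) - 1 / (complex_of_real x - z)\<^sup>2 * (w - z))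
       \<le> norm (w - z)^2 / (\<bar>Im w\<bar> * \<bar>Im z\<bar>\<^sup>2)"
      unfolding eq norm_mult norm_power by simp
  qed
  finally show ?thesis .
qed

lemma stieltjes_lipschitz:
  assumes "Im z \<noteq> 0" "Im w \<noteq> 0"
  shows "norm (stieltjes M w - stieltjes M z) \<le> norm (w - z) / (\<bar>Im w\<bar> * \<bar>Im z\<bar>)"
proof -
  have eq: "1 / (complex_of_real x - w) - 1 / (complex_of_real x - z)
       = (w - z) * (1 / (complex_of_real x - w) * (1 / (complex_of_real x - z)))" for x
    using of_real_diff_nonzero[OF assms(1), of x] of_real_diff_nonzero[OF assms(2), of x]
    by (simp add: divide_simps)
  have "stieltjes M w - stieltjes M z = (\<integral>x. 1 / (complex_of_real x - w) - 1 / (complex_of_real x - z) \<partial>M)"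
    unfolding stieltjes_def using integrable_resolvent[OF assms(1)] integrable_resolvent[OF assms(2)] by simp
  also have "norm \<dots> \<le> norm (w - z) / (\<bar>Im w\<bar> * \<bar>Im z\<bar>)"
  proof (rule norm_expectation_le)
    show "integrable M (\<lambda>x. 1 / (complex_of_real x - w) - 1 / (complex_of_real x - z))"
      using integrable_resolvent[OF assms(1)] integrable_resolvent[OF assms(2)] by simp
    fix x
    have "norm (1 / (complex_of_real x - w) * (1 / (complex_of_real x - z))) \<le> 1 / \<bar>Im w\<bar> * (1 / \<bar>Im z\<bar>)"
      unfolding norm_mult using norm_resolvent_le[OF assms(2), of x] norm_resolvent_le[OF assms(1), of x]
      by (intro mult_mono) auto
    from mult_left_mono[OF this, of "norm (w - z)"]
    show "norm (1 / (complex_of_real x - w) - 1 / (complex_of_real x - z)) \<le> norm (w - z) / (\<bar>Im w\<bar> * \<bar>Im z\<bar>)"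
      unfolding eq norm_mult by simp
  qed
  finally show ?thesis .
qed

lemma DERIV_stieltjes:
  assumes "Im z \<noteq> 0"
  shows "(stieltjes M has_field_derivative stieltjes' M z) (at z)"
proof (rule has_field_derivative_quadratic)
  \<comment> \<open>Within this radius \<open>Im w\<close> keeps at least half the size of
    \<open>Im z\<close>, which makes the constant uniform in w.\<close>
  show "0 < \<bar>Im z\<bar> / 2" using assms by simp
  fix w assume w: "norm (w - z) < \<bar>Im z\<bar> / 2"
  have "\<bar>Im w - Im z\<bar> < \<bar>Im z\<bar> / 2" using abs_Im_le_cmod[of "w - z"] w by simp
  then have *: "\<bar>Im w\<bar> \<ge> \<bar>Im z\<bar> / 2" and w0: "Im w \<noteq> 0" by linarith+
  have "norm (stieltjes M w - stieltjes M z - stieltjes' M z * (w - z)) \<le> norm (w - z)^2 / (\<bar>Im w\<bar> * \<bar>Im z\<bar>\<^sup>2)"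
    by (rule stieltjes_taylor[OF assms w0])
  also have "\<dots> \<le> norm (w - z)^2 / (\<bar>Im z\<bar> / 2 * \<bar>Im z\<bar>\<^sup>2)"
    using * assms by (intro divide_left_mono mult_right_mono) auto
  finally show "norm (stieltjes M w - stieltjes M z - stieltjes' M z * (w - z))
      \<le> (1 / (\<bar>Im z\<bar> / 2 * \<bar>Im z\<bar>\<^sup>2)) * norm (w - z)^2" by (simp add: mult.commute)
qed

lemma deriv_stieltjes: "Im z \<noteq> 0 \<Longrightarrow> deriv (stieltjes M) z = stieltjes' M z"
  by (intro DERIV_imp_deriv DERIV_stieltjes)

lemma holomorphic_stieltjes: "stieltjes M holomorphic_on {z. Im z > 0}"
proof (rule holomorphic_onI)
  fix z assume "z \<in> {z. Im z > 0}"
  then have "(stieltjes M has_field_derivative stieltjes' M z) (at z)"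
    by (intro DERIV_stieltjes) simp
  then show "stieltjes M field_differentiable at z within {z. Im z > 0}"
    unfolding field_differentiable_def using has_field_derivative_at_within by blast
qed

lemma stieltjes_cnj: "stieltjes M (cnj z) = cnj (stieltjes M z)"
  unfolding stieltjes_def by (subst Bochner_Integration.integral_cnj[symmetric]) simp

lemma stieltjes'_cnj: "stieltjes' M (cnj z) = cnj (stieltjes' M z)"
  unfolding stieltjes'_def by (subst Bochner_Integration.integral_cnj[symmetric]) simp

lemma norm_stieltjes_le_of_Im:
  assumes "0 < a" "a \<le> Im z" shows "norm (stieltjes M z) \<le> 1 / a"
  using norm_stieltjes_le[of z] frac_le[of 1 1 a "Im z"] assms by auto

lemma norm_stieltjes'_le_of_Im:
  assumes "0 < a" "a \<le> Im z" shows "norm (stieltjes' M z) \<le> 1 / a\<^sup>2"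
proof -
  have "1 / (Im z)\<^sup>2 \<le> 1 / a\<^sup>2" using assms by (intro divide_left_mono power_mono) auto
  with norm_stieltjes'_le[of z] assms show ?thesis by auto
qed

end

lemma (in real_distribution) stieltjes'_lipschitz:
  assumes "Im z \<noteq> 0" "Im w \<noteq> 0"
  shows "norm (stieltjes' M w - stieltjes' M z)
     \<le> norm (w - z) / (\<bar>Im w\<bar> * \<bar>Im z\<bar>) * (1 / \<bar>Im w\<bar> + 1 / \<bar>Im z\<bar>)"
proof -
  note int = integrable_resolvent_power[OF assms(1), of 2] integrable_resolvent_power[OF assms(2), of 2]
  have "stieltjes' M w - stieltjes' M z = (\<integral>x. 1 / (complex_of_real x - w)\<^sup>2 - 1 / (complex_of_real x - z)\<^sup>2 \<partial>M)"
    unfolding stieltjes'_def by (rule Bochner_Integration.integral_diff[symmetric, OF int(2,1)])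
  also have "norm \<dots> \<le> norm (w - z) / (\<bar>Im w\<bar> * \<bar>Im z\<bar>) * (1 / \<bar>Im w\<bar> + 1 / \<bar>Im z\<bar>)"
  proof (rule norm_expectation_le)
    show "integrable M (\<lambda>x. 1 / (complex_of_real x - w)\<^sup>2 - 1 / (complex_of_real x - z)\<^sup>2)"
      by (rule Bochner_Integration.integrable_diff[OF int(2,1)])
    fix x
    let ?p = "1 / (complex_of_real x - w)" and ?q = "1 / (complex_of_real x - z)"
    have pq: "norm ?p \<le> 1 / \<bar>Im w\<bar>" "norm ?q \<le> 1 / \<bar>Im z\<bar>"
      using norm_resolvent_le assms by auto
    have pq_eq: "?p - ?q = (w - z) * (?p * ?q)"
      using of_real_diff_nonzero[OF assms(1), of x] of_real_diff_nonzero[OF assms(2), of x]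
      by (simp add: divide_simps)
    have "norm (?p - ?q) \<le> norm (w - z) * (1 / \<bar>Im w\<bar> * (1 / \<bar>Im z\<bar>))"
      unfolding pq_eq norm_mult by (intro mult_left_mono mult_mono pq) auto
    moreover have "norm (?p + ?q) \<le> 1 / \<bar>Im w\<bar> + 1 / \<bar>Im z\<bar>"
      using pq by (intro norm_triangle_le add_mono)
    moreover have "1 / (complex_of_real x - w)\<^sup>2 - 1 / (complex_of_real x - z)\<^sup>2 = (?p - ?q) * (?p + ?q)"
      by (simp add: algebra_simps power2_eq_square)
    ultimately have "norm (1 / (complex_of_real x - w)\<^sup>2 - 1 / (complex_of_real x - z)\<^sup>2)
       \<le> norm (w - z) * (1 / \<bar>Im w\<bar> * (1 / \<bar>Im z\<bar>)) * (1 / \<bar>Im w\<bar> + 1 / \<bar>Im z\<bar>)"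
      by (simp only: norm_mult) (intro mult_mono, auto)
    then show "norm (1 / (complex_of_real x - w)\<^sup>2 - 1 / (complex_of_real x - z)\<^sup>2)
       \<le> norm (w - z) / (\<bar>Im w\<bar> * \<bar>Im z\<bar>) * (1 / \<bar>Im w\<bar> + 1 / \<bar>Im z\<bar>)" by simp
  qed
  finally show ?thesis .
qed

section \<open>Exponential bounds and Cauchy estimates on half planes\<close>

lemma norm_exp_diff_le:
  fixes a b :: complex
  assumes "norm a \<le> r" "norm b \<le> r"
  shows "norm (exp a - exp b) \<le> exp r * norm (a - b)"
proof (rule field_differentiable_bound[where S = "cball 0 r" and f' = exp])
  show "norm (exp z) \<le> exp r" if "z \<in> cball 0 r" for z :: complex
    by (rule order_trans[OF norm_exp]) (use that in simp)
qed (use assms in \<open>auto intro!: derivative_eq_intros\<close>)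

lemma exp_2_le: "exp (2::real) \<le> 9"
proof -
  have "exp (2::real) = exp 1 * exp 1" by (simp flip: exp_add)
  also have "\<dots> \<le> 3 * 3" using exp_le by (intro mult_mono) auto
  finally show ?thesis by simp
qed

text \<open>Above height 1 a transform has norm at most 1 and its speed at most e <= 3; above height
  1/2 the bounds are 2 and e^2 <= 9. These two pairs are the source of most numerical constants that
  follow.\<close>

lemma norm_exp_uminus_le_3: "norm a \<le> 1 \<Longrightarrow> norm (exp (- a :: complex)) \<le> 3"
  by (rule order_trans[OF norm_exp], rule order_trans[OF _ exp_le]) simp

lemma norm_exp_uminus_diff_le_3:
  "norm a \<le> 1 \<Longrightarrow> norm b \<le> 1 \<Longrightarrow> norm (exp (- a :: complex) - exp (- b)) \<le> 3 * norm (a - b)"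
  by (rule order_trans[OF norm_exp_diff_le[of _ 1]])
     (use mult_right_mono[OF exp_le, of "norm (a - b)"] in \<open>simp_all add: norm_minus_commute\<close>)

lemma norm_exp_uminus_le_9: "norm a \<le> 2 \<Longrightarrow> norm (exp (- a :: complex)) \<le> 9"
  by (rule order_trans[OF norm_exp], rule order_trans[OF _ exp_2_le]) simp

lemma norm_exp_uminus_diff_le_9:
  "norm a \<le> 2 \<Longrightarrow> norm b \<le> 2 \<Longrightarrow> norm (exp (- a :: complex) - exp (- b)) \<le> 9 * norm (a - b)"
  by (rule order_trans[OF norm_exp_diff_le[of _ 2]])
     (use mult_right_mono[OF exp_2_le, of "norm (a - b)"] in \<open>simp_all add: norm_minus_commute\<close>)

lemma open_upper_half_plane: "open {z. Im z > 0}"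
  by (simp add: open_halfspace_Im_gt)

lemma convex_upper_half_plane: "convex {z. Im z > a}"
  by (simp add: convex_halfspace_Im_gt)

text \<open>Discs of radius 1/2 centred above height 1 stay above height 1/2. Giving up this half
  unit of height turns a bound on a function, in particular on a small difference of functions, into
  one on its derivatives.\<close>

lemma norm_deriv_le_half_plane:
  assumes hol: "f holomorphic_on {z. Im z > 0}"
    and bd: "\<And>z. Im z \<ge> 1/2 \<Longrightarrow> norm (f z) \<le> B" and z: "Im z \<ge> 1"
  shows "norm ((deriv ^^ k) f z) \<le> fact k * B * 2 ^ k"
proof -
  have im: "Im w \<ge> 1/2" if "norm (z - w) \<le> 1/2" for w
    using abs_Im_le_cmod[of "z - w"] that z unfolding minus_complex.sel by linarith
  then have sub: "cball z (1/2) \<subseteq> {z. Im z > 0}" by (force simp: dist_norm)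
  have "norm ((deriv ^^ k) f z) \<le> fact k * B / (1/2) ^ k"
    by (rule Cauchy_inequality)
       (use bd im holomorphic_on_subset[OF hol sub] in
        \<open>auto intro: holomorphic_on_imp_continuous_on elim!: holomorphic_on_subset\<close>)
  then show ?thesis by (simp add: power_divide)
qed

lemma norm_diff_le_half_plane:
  assumes hol: "f holomorphic_on {z. Im z > 0}"
    and bd: "\<And>z. Im z \<ge> 1/2 \<Longrightarrow> norm (f z) \<le> B" and z: "Im z \<ge> 1" and w: "Im w \<ge> 1"
  shows "norm (f z - f w) \<le> 2 * B * norm (z - w)"
proof (rule field_differentiable_bound[where S = "{z. Im z \<ge> 1}" and f' = "deriv f"])
  fix u assume u: "u \<in> {z. Im z \<ge> 1}"
  then show "(f has_field_derivative deriv f u) (at u within {z. Im z \<ge> 1})"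
    by (intro holomorphic_derivI[OF hol open_upper_half_plane, THEN has_field_derivative_at_within]) auto
  show "norm (deriv f u) \<le> 2 * B"
    using norm_deriv_le_half_plane[OF hol bd, of u 1] u by simp
qed (use z w in \<open>auto simp: convex_halfspace_Im_ge\<close>)

lemma norm_taylor_le_half_plane:
  assumes hol: "f holomorphic_on {z. Im z > 0}"
    and bd: "\<And>z. Im z \<ge> 1/2 \<Longrightarrow> norm (f z) \<le> B" and z: "Im z \<ge> 1" and w: "Im w \<ge> 1"
  shows "norm (f w - f z - deriv f z * (w - z)) \<le> 8 * B * norm (w - z) ^ 2"
proof -
  have "norm ((deriv ^^ 0) f w - (\<Sum>i\<le>Suc 0. (deriv ^^ i) f z * (w - z)^i / fact i)) \<le> 8 * B * norm (w - z)^Suc (Suc 0) / fact (Suc 0)"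
  proof (rule complex_Taylor[where f = "\<lambda>i. (deriv ^^ i) f" and S = "{z. Im z \<ge> 1}"])
    fix i u assume u: "u \<in> {z. Im z \<ge> 1}"
    have "((deriv ^^ i) f has_field_derivative deriv ((deriv ^^ i) f) u) (at u)"
      by (rule holomorphic_derivI[OF holomorphic_higher_deriv[OF hol open_upper_half_plane] open_upper_half_plane])
         (use u in auto)
    then show "((deriv ^^ i) f has_field_derivative (deriv ^^ Suc i) f u) (at u within {z. Im z \<ge> 1})"
      by (simp add: has_field_derivative_at_within)
  next
    fix u assume u: "u \<in> {z. Im z \<ge> 1}"
    \<comment> \<open>8 = 2! * 2^2 from the Cauchy estimate of order 2.\<close>
    show "norm ((deriv ^^ Suc (Suc 0)) f u) \<le> 8 * B"
      using norm_deriv_le_half_plane[OF hol bd, of u 2] u by (simp add: numeral_2_eq_2)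
  qed (use z w in \<open>auto simp: convex_halfspace_Im_ge\<close>)
  then show ?thesis by (simp add: algebra_simps numeral_2_eq_2)
qed

section \<open>The Levy metric, tightness and Stieltjes inversion\<close>

text \<open>The condition under the infimum of \<open>levy\<close> for one fixed \<epsilon>. It is
  symmetric, monotone, and additive under composition, so the estimates can be chained without
  touching infima.\<close>

definition levy_le :: "real \<Rightarrow> real measure \<Rightarrow> real measure \<Rightarrow> bool" where
  "levy_le \<epsilon> \<mu> \<nu> \<longleftrightarrow> (\<forall>x. measure \<mu> {..<x - \<epsilon>} - \<epsilon> \<le> measure \<nu> {..<x} \<and>
      measure \<nu> {..<x} \<le> measure \<mu> {..<x + \<epsilon>} + \<epsilon>)"

lemma levy_altdef: "levy \<mu> \<nu> = Inf {\<epsilon>. \<epsilon> > 0 \<and> levy_le \<epsilon> \<mu> \<nu>}"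
  by (simp add: levy_def levy_le_def)

lemma levy_le_upper: "levy_le \<epsilon> \<mu> \<nu> \<Longrightarrow> measure \<nu> {..<x} \<le> measure \<mu> {..<x + \<epsilon>} + \<epsilon>"
  by (simp add: levy_le_def)

lemma levy_le_lower: "levy_le \<epsilon> \<mu> \<nu> \<Longrightarrow> measure \<mu> {..<x} \<le> measure \<nu> {..<x + \<epsilon>} + \<epsilon>"
  unfolding levy_le_def by (drule spec[of _ "x + \<epsilon>"]) simp

lemma levy_leI:
  assumes "\<And>x. measure \<nu> {..<x} \<le> measure \<mu> {..<x + \<epsilon>} + \<epsilon>"
    and "\<And>x. measure \<mu> {..<x} \<le> measure \<nu> {..<x + \<epsilon>} + \<epsilon>"
  shows "levy_le \<epsilon> \<mu> \<nu>"
  unfolding levy_le_def using assms(1) assms(2)[of "x - \<epsilon>" for x] by (simp add: diff_le_eq)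

lemma levy_le_sym: "levy_le \<epsilon> \<mu> \<nu> \<longleftrightarrow> levy_le \<epsilon> \<nu> \<mu>"
  by (meson levy_leI levy_le_lower levy_le_upper)

lemma levy_le_trans:
  assumes "levy_le a \<mu> \<nu>" "levy_le b \<nu> \<rho>"
  shows "levy_le (a + b) \<mu> \<rho>"
proof (rule levy_leI)
  fix x
  show "measure \<rho> {..<x} \<le> measure \<mu> {..<x + (a + b)} + (a + b)"
    using levy_le_upper[OF assms(2), of x] levy_le_upper[OF assms(1), of "x + b"] by (simp add: algebra_simps)
  show "measure \<mu> {..<x} \<le> measure \<rho> {..<x + (a + b)} + (a + b)"
    using levy_le_lower[OF assms(1), of x] levy_le_lower[OF assms(2), of "x + a"] by (simp add: algebra_simps)
qed

lemma (in real_distribution) measure_lessThan_mono: "x \<le> y \<Longrightarrow> measure M {..<x} \<le> measure M {..<y}"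
  by (rule finite_measure_mono) auto

lemma levy_le_mono:
  assumes "levy_le a \<mu> \<nu>" "a \<le> b" "real_distribution \<mu>" "real_distribution \<nu>"
  shows "levy_le b \<mu> \<nu>"
proof (rule levy_leI)
  interpret \<mu>: real_distribution \<mu> by fact
  interpret \<nu>: real_distribution \<nu> by fact
  fix x
  show "measure \<nu> {..<x} \<le> measure \<mu> {..<x + b} + b"
    using levy_le_upper[OF assms(1), of x] \<mu>.measure_lessThan_mono[of "x + a" "x + b"] \<open>a \<le> b\<close> by linarith
  show "measure \<mu> {..<x} \<le> measure \<nu> {..<x + b} + b"
    using levy_le_lower[OF assms(1), of x] \<nu>.measure_lessThan_mono[of "x + a" "x + b"] \<open>a \<le> b\<close> by linarith
qed

text \<open>Makes the set under the infimum in \<open>levy\<close> nonempty; the infimum of an empty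
  set of reals would carry no information.\<close>

lemma levy_le_1:
  assumes "real_distribution \<mu>" "real_distribution \<nu>"
  shows "levy_le 1 \<mu> \<nu>"
proof -
  interpret \<mu>: real_distribution \<mu> by fact
  interpret \<nu>: real_distribution \<nu> by fact
  show ?thesis
    by (rule levy_leI) (simp_all add: add_increasing)
qed

lemma levy_le_imp: "\<epsilon> > 0 \<Longrightarrow> levy_le \<epsilon> \<mu> \<nu> \<Longrightarrow> levy \<mu> \<nu> \<le> \<epsilon>"
  unfolding levy_altdef by (intro cInf_lower bdd_belowI[of _ 0]) auto

lemma
  assumes "real_distribution \<mu>" "real_distribution \<nu>"
  shows levy_nonneg: "levy \<mu> \<nu> \<ge> 0"
    and levy_less_imp: "levy \<mu> \<nu> < \<epsilon> \<Longrightarrow> levy_le \<epsilon> \<mu> \<nu>"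
    and levy_le_one: "levy \<mu> \<nu> \<le> 1"
proof -
  have ne: "{\<epsilon>. \<epsilon> > 0 \<and> levy_le \<epsilon> \<mu> \<nu>} \<noteq> {}"
    using levy_le_1[OF assms] by (auto intro!: exI[of _ 1])
  then show "levy \<mu> \<nu> \<ge> 0" unfolding levy_altdef by (intro cInf_greatest) auto
  show "levy_le \<epsilon> \<mu> \<nu>" if "levy \<mu> \<nu> < \<epsilon>"
    using cInf_lessD[OF ne that[unfolded levy_altdef]] levy_le_mono[OF _ _ assms] by force
  show "levy \<mu> \<nu> \<le> 1" using levy_le_1[OF assms] by (intro levy_le_imp) auto
qed

lemma levy_tendsto_imp_weak_conv:
  assumes "\<And>n. real_distribution (\<mu> n)" "real_distribution \<nu>" "(\<lambda>n. levy (\<mu> n) \<nu>) \<longlonglongrightarrow> 0"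
  shows "weak_conv_m \<mu> \<nu>"
  unfolding weak_conv_m_def weak_conv_def
proof (intro allI impI)
  interpret \<mu>: real_distribution "\<mu> n" for n by fact
  interpret \<nu>: real_distribution \<nu> by fact
  fix x assume "isCont (cdf \<nu>) x"
  show "(\<lambda>n. cdf (\<mu> n) x) \<longlonglongrightarrow> cdf \<nu> x"
  proof (rule LIMSEQ_I)
    fix e :: real assume "e > 0"
    obtain d where d: "d > 0" "\<And>y. \<bar>y - x\<bar> < d \<Longrightarrow> \<bar>cdf \<nu> y - cdf \<nu> x\<bar> < e / 2"
      using \<open>isCont (cdf \<nu>) x\<close> \<open>e > 0\<close> unfolding continuous_at_eps_delta dist_real_def
      by (meson half_gt_zero)
    \<comment> \<open>The argument is shifted twice, once to pass between closed and open half lines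
      and once by the Levy condition; 2 d / 3 < d leaves room for both.\<close>
    define \<epsilon> where "\<epsilon> = min (d / 3) (e / 2)"
    have \<epsilon>: "\<epsilon> > 0" "\<epsilon> \<le> d / 3" "\<epsilon> \<le> e / 2" using d(1) \<open>e > 0\<close> by (auto simp: \<epsilon>_def)
    have "eventually (\<lambda>n. levy (\<mu> n) \<nu> < \<epsilon>) sequentially"
      using order_tendstoD(2)[OF assms(3) \<epsilon>(1)] .
    then have "eventually (\<lambda>n. norm (cdf (\<mu> n) x - cdf \<nu> x) < e) sequentially"
    proof eventually_elim
      case (elim n)
      then have L: "levy_le \<epsilon> (\<mu> n) \<nu>" by (rule levy_less_imp[OF assms(1,2)])
      have "cdf (\<mu> n) x \<le> measure (\<mu> n) {..<x + \<epsilon>}"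
        unfolding cdf_def using \<epsilon> by (intro \<mu>.finite_measure_mono) auto
      also have "\<dots> \<le> measure \<nu> {..<x + \<epsilon> + \<epsilon>} + \<epsilon>" by (rule levy_le_lower[OF L])
      also have "measure \<nu> {..<x + \<epsilon> + \<epsilon>} \<le> cdf \<nu> (x + \<epsilon> + \<epsilon>)"
        unfolding cdf_def by (intro \<nu>.finite_measure_mono) auto
      also have "\<dots> < cdf \<nu> x + e / 2" using d(2)[of "x + \<epsilon> + \<epsilon>"] d(1) \<epsilon> by linarith
      finally have 1: "cdf (\<mu> n) x < cdf \<nu> x + e" using \<epsilon> by linarith
      have "cdf \<nu> x - e / 2 < cdf \<nu> (x - \<epsilon> - \<epsilon>)" using d(2)[of "x - \<epsilon> - \<epsilon>"] d(1) \<epsilon> by linarith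
      also have "\<dots> \<le> measure \<nu> {..<x - \<epsilon>}"
        unfolding cdf_def using \<epsilon> by (intro \<nu>.finite_measure_mono) auto
      also have "\<dots> \<le> measure (\<mu> n) {..<x} + \<epsilon>"
        using levy_le_upper[OF L, of "x - \<epsilon>"] by simp
      also have "measure (\<mu> n) {..<x} \<le> cdf (\<mu> n) x"
        unfolding cdf_def by (intro \<mu>.finite_measure_mono) auto
      finally show ?case using 1 \<epsilon> by auto
    qed
    then show "\<exists>no. \<forall>n\<ge>no. norm (cdf (\<mu> n) x - cdf \<nu> x) < e"
      by (simp add: eventually_sequentially)
  qed
qed

text \<open>Without atoms the distribution functions converge at every point, so a regular grid can
  be used. Closeness at finitely many grid points of mesh e / 2 suffices: monotonicity interpolates
  between them, and below \<open>a\<close> and above \<open>p N\<close> the limit has mass less than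
  e / 2.\<close>

lemma weak_conv_imp_levy_tendsto:
  assumes "\<And>n. real_distribution (\<mu> n)" "real_distribution \<nu>" "weak_conv_m \<mu> \<nu>"
    and atomless: "\<And>x. measure \<nu> {x} = 0"
  shows "(\<lambda>n. levy (\<mu> n) \<nu>) \<longlonglongrightarrow> 0"
proof (rule LIMSEQ_I)
  interpret \<mu>: real_distribution "\<mu> n" for n by fact
  interpret \<nu>: real_distribution \<nu> by fact
  have conv: "(\<lambda>n. cdf (\<mu> n) x) \<longlonglongrightarrow> cdf \<nu> x" for x
    using assms(3) atomless unfolding weak_conv_m_def weak_conv_def \<nu>.isCont_cdf by blast
  have lc: "measure \<nu> {..<x} \<le> cdf \<nu> y" if "x \<le> y" for x y
    unfolding cdf_def using that by (intro \<nu>.finite_measure_mono) auto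
  have cl: "cdf \<nu> x \<le> measure \<nu> {..<y}" if "x < y" for x y
    unfolding cdf_def using that by (intro \<nu>.finite_measure_mono) auto
  have lc': "measure (\<mu> n) {..<x} \<le> cdf (\<mu> n) y" if "x \<le> y" for x y n
    unfolding cdf_def using that by (intro \<mu>.finite_measure_mono) auto
  have cl': "cdf (\<mu> n) x \<le> measure (\<mu> n) {..<y}" if "x < y" for x y n
    unfolding cdf_def using that by (intro \<mu>.finite_measure_mono) auto
  fix r :: real assume "r > 0"
  define e where "e = r / 2"
  have "e > 0" using \<open>r > 0\<close> by (simp add: e_def)
  obtain a where a: "cdf \<nu> a < e / 2"
    using order_tendstoD(2)[OF \<nu>.cdf_lim_at_bot, of "e / 2"] \<open>e > 0\<close>
    by (auto simp: eventually_at_bot_linorder)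
  obtain b0 where b0: "\<And>b. b \<ge> b0 \<Longrightarrow> cdf \<nu> b > 1 - e / 2"
    using order_tendstoD(1)[OF \<nu>.cdf_lim_at_top_prob, of "1 - e / 2"] \<open>e > 0\<close>
    by (auto simp: eventually_at_top_linorder)
  obtain N :: nat where N: "real N \<ge> (b0 - a) / (e / 2)" using real_arch_simple by blast
  define p where "p i = a + real i * (e / 2)" for i :: nat
  have pN: "cdf \<nu> (p N) > 1 - e / 2"
    using N \<open>e > 0\<close> by (intro b0) (simp add: p_def field_simps)
  \<comment> \<open>Rounding (y - a) / (e / 2) up gives the first grid point not below y.\<close>
  have grid: "\<exists>i\<le>N. y \<le> p i \<and> p i \<le> y + e / 2" if "a \<le> y" "y \<le> p N" for y
  proof (intro exI[of _ "nat \<lceil>(y - a) / (e / 2)\<rceil>"] conjI)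
    let ?i = "nat \<lceil>(y - a) / (e / 2)\<rceil>"
    have nn: "(y - a) / (e / 2) \<ge> 0" using that \<open>e > 0\<close> by simp
    then have i: "real ?i = of_int \<lceil>(y - a) / (e / 2)\<rceil>" by simp
    have 1: "(y - a) / (e / 2) \<le> real ?i" "real ?i < (y - a) / (e / 2) + 1"
      unfolding i by (linarith, linarith)
    show "y \<le> p ?i" "p ?i \<le> y + e / 2" using 1 \<open>e > 0\<close> by (auto simp: p_def field_simps)
    have "(y - a) / (e / 2) \<le> real N" using that \<open>e > 0\<close> by (simp add: p_def field_simps)
    then show "?i \<le> N" by (simp add: nat_le_iff ceiling_le_iff)
  qed
  have "eventually (\<lambda>n. \<forall>i\<in>{..N}. \<bar>cdf (\<mu> n) (p i) - cdf \<nu> (p i)\<bar> < e / 2) sequentially"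
    unfolding eventually_ball_finite_distrib[OF finite_atMost]
    using tendstoD[OF conv, of "e / 2"] \<open>e > 0\<close> unfolding dist_real_def by simp
  then have "eventually (\<lambda>n. norm (levy (\<mu> n) \<nu> - 0) < r) sequentially"
  proof eventually_elim
    case (elim n)
    then have el: "\<bar>cdf (\<mu> n) (p i) - cdf \<nu> (p i)\<bar> < e / 2" if "i \<le> N" for i using that by auto
    have p0: "p 0 = a" by (simp add: p_def)
    have "levy_le e (\<mu> n) \<nu>"
    proof (rule levy_leI)
      fix x
      consider "x < a" | "a \<le> x" "x \<le> p N" | "x > p N" by linarith
      then show "measure \<nu> {..<x} \<le> measure (\<mu> n) {..<x + e} + e"
      proof cases
        case 1
        then have "measure \<nu> {..<x} \<le> cdf \<nu> a" by (intro lc) auto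
        then show ?thesis using a \<open>e > 0\<close> measure_nonneg[of "\<mu> n" "{..<x + e}"] by linarith
      next
        case 2
        then obtain i where i: "i \<le> N" "x \<le> p i" "p i \<le> x + e / 2" using grid by blast
        show ?thesis using lc[OF i(2)] cl'[of "p i" "x + e" n] el[OF i(1)] i \<open>e > 0\<close> by linarith
      next
        case 3
        then have "cdf (\<mu> n) (p N) \<le> measure (\<mu> n) {..<x + e}" using \<open>e > 0\<close> by (intro cl') auto
        then show ?thesis using el[OF order_refl] pN \<nu>.prob_le_1[of "{..<x}"] by linarith
      qed
      consider "x < a" | "a \<le> x" "x \<le> p N" | "x > p N" by linarith
      then show "measure (\<mu> n) {..<x} \<le> measure \<nu> {..<x + e} + e"
      proof cases
        case 1
        then have "measure (\<mu> n) {..<x} \<le> cdf (\<mu> n) a" by (intro lc') auto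
        then show ?thesis using a el[of 0, unfolded p0] measure_nonneg[of \<nu> "{..<x + e}"] by linarith
      next
        case 2
        then obtain i where i: "i \<le> N" "x \<le> p i" "p i \<le> x + e / 2" using grid by blast
        show ?thesis using lc'[OF i(2), of n] cl[of "p i" "x + e"] el[OF i(1)] i \<open>e > 0\<close> by linarith
      next
        case 3
        then have "cdf \<nu> (p N) \<le> measure \<nu> {..<x + e}" using \<open>e > 0\<close> by (intro cl) auto
        then show ?thesis using pN \<mu>.prob_le_1[of n "{..<x}"] \<open>e > 0\<close> by linarith
      qed
    qed
    then have "levy (\<mu> n) \<nu> \<le> e" using \<open>e > 0\<close> by (intro levy_le_imp)
    then show ?case using levy_nonneg[OF assms(1,2), of n] \<open>r > 0\<close> by (simp add: e_def)
  qed
  then show "\<exists>no. \<forall>n\<ge>no. norm (levy (\<mu> n) \<nu> - 0) < r"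
    by (simp add: eventually_sequentially)
qed

section \<open>Tail bounds and tightness from values of the Stieltjes transform\<close>

lemma Im_resolvent:
  "Im (1 / (complex_of_real x - w)) = Im w / ((x - Re w)\<^sup>2 + (Im w)\<^sup>2)"
  by (simp add: Im_divide power2_eq_square algebra_simps)

context real_distribution
begin

lemma Im_stieltjes:
  assumes "Im w \<noteq> 0"
  shows "Im (stieltjes M w) = (\<integral>x. Im w / ((x - Re w)\<^sup>2 + (Im w)\<^sup>2) \<partial>M)"
  unfolding stieltjes_def using integral_Im[OF integrable_resolvent[OF assms]] by (simp add: Im_resolvent)

text \<open>With d = x - Re w, the quantity 1 - Im w * Im m(w) is the mean of d^2 / (d^2 + (Im
  w)^2), and this ratio is at least 1/2 once |d| >= Im w.\<close>

lemma measure_tail_le_stieltjes: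
  assumes "Im w > 0"
  shows "measure M {x. Im w \<le> \<bar>x - Re w\<bar>} \<le> 2 * (1 - Im w * Im (stieltjes M w))"
proof -
  let ?g = "\<lambda>x. Im w / ((x - Re w)\<^sup>2 + (Im w)\<^sup>2)"
  have int: "integrable M ?g"
    using integrable_Im[OF integrable_resolvent, of w] assms by (simp add: Im_resolvent)
  have meas: "{x. Im w \<le> \<bar>x - Re w\<bar>} \<in> sets borel" by measurable
  have "measure M {x. Im w \<le> \<bar>x - Re w\<bar>} = (\<integral>x. indicator {x. Im w \<le> \<bar>x - Re w\<bar>} x \<partial>M)"
    using meas by simp
  also have "\<dots> \<le> (\<integral>x. 2 * (1 - Im w * ?g x) \<partial>M)"
  proof (rule integral_mono)
    show "integrable M (indicator {x. Im w \<le> \<bar>x - Re w\<bar>} :: real \<Rightarrow> real)"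
      using meas by (intro integrable_real_indicator) (auto simp: emeasure_eq_measure)
    show "integrable M (\<lambda>x. 2 * (1 - Im w * ?g x))"
      by (intro integrable_mult_right Bochner_Integration.integrable_diff int) simp
    fix x
    define d where "d = x - Re w"
    have pos: "d\<^sup>2 + (Im w)\<^sup>2 > 0" using assms by (simp add: sum_power2_gt_zero_iff)
    have eq: "2 * (1 - Im w * ?g x) = 2 * d\<^sup>2 / (d\<^sup>2 + (Im w)\<^sup>2)"
    proof -
      have "2 * (1 - e * (e / D)) = 2 * (D - e\<^sup>2) / D" if "D > 0" for D e :: real
        using that by (simp add: field_simps power2_eq_square)
      from this[OF pos, of "Im w"] show ?thesis by (simp add: d_def)
    qed
    show "indicator {x. Im w \<le> \<bar>x - Re w\<bar>} x \<le> 2 * (1 - Im w * ?g x)"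
    proof (cases "Im w \<le> \<bar>d\<bar>")
      case True
      then have "(Im w)\<^sup>2 \<le> d\<^sup>2" using assms power_mono[of "Im w" "\<bar>d\<bar>" 2] by simp
      then show ?thesis unfolding eq using pos by (simp add: indicator_def d_def[symmetric] True)
    next
      case False
      then show ?thesis unfolding eq using pos by (simp add: indicator_def d_def[symmetric])
    qed
  qed
  also have "\<dots> = 2 * (1 - Im w * Im (stieltjes M w))"
    using int Im_stieltjes[of w] assms prob_space
    by (simp add: Bochner_Integration.integral_diff integral_mult_right_zero del: times_divide_eq_right)
  finally show ?thesis .
qed

text \<open>The total mass 1 is read off at infinity. It makes the right side of
  \<open>measure_tail_le_stieltjes\<close> small, so no mass escapes.\<close>

lemma stieltjes_imaginary_axis_tendsto:
  "(\<lambda>k. real k * Im (stieltjes M (\<i> * of_nat k))) \<longlonglongrightarrow> 1"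
proof -
  have "(\<lambda>k. \<integral>x. real k * (real k / (x\<^sup>2 + (real k)\<^sup>2)) \<partial>M) \<longlonglongrightarrow> (\<integral>x. 1 \<partial>M)"
  proof (rule integral_dominated_convergence[where w = "\<lambda>_. 1"])
    show "AE x in M. (\<lambda>k. real k * (real k / (x\<^sup>2 + (real k)\<^sup>2))) \<longlonglongrightarrow> 1"
    proof (rule AE_I2)
      fix x :: real
      show "(\<lambda>k. real k * (real k / (x\<^sup>2 + (real k)\<^sup>2))) \<longlonglongrightarrow> 1" by real_asymp
    qed
    show "AE x in M. norm (real k * (real k / (x\<^sup>2 + (real k)\<^sup>2))) \<le> 1" for k
    proof (rule AE_I2)
      fix x :: real
      show "norm (real k * (real k / (x\<^sup>2 + (real k)\<^sup>2))) \<le> 1"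
        by (cases "k = 0")
           (auto simp: divide_simps power2_eq_square add_nonneg_eq_0_iff not_sum_squares_lt_zero)
    qed
  qed auto
  moreover have "(\<integral>x. real k * (real k / (x\<^sup>2 + (real k)\<^sup>2)) \<partial>M) = real k * Im (stieltjes M (\<i> * of_nat k))" if "k \<ge> 1" for k
    using Im_stieltjes[of "\<i> * of_nat k"] that
    by (subst integral_mult_right_zero) simp
  ultimately show ?thesis
    using prob_space by (auto elim!: Lim_transform_eventually intro!: eventually_sequentiallyI[of 1])
qed

end

text \<open>For each \<epsilon>, convergence at one point w controls the tails of all but finitely
  many measures; each of the others is tight by itself.\<close>

lemma tight_of_stieltjes:
  assumes rd: "\<And>n. real_distribution (\<mu> n)"
    and conv: "\<And>\<epsilon>. \<epsilon> > 0 \<Longrightarrow> \<exists>w l. Im w > 0 \<and> (\<lambda>n. stieltjes (\<mu> n) w) \<longlonglongrightarrow> l \<and> 2 * (1 - Im w * Im l) < \<epsilon>"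
  shows "tight \<mu>"
  unfolding tight_def
proof (intro conjI allI impI rd)
  interpret \<mu>: real_distribution "\<mu> n" for n by fact
  fix \<epsilon> :: real assume "\<epsilon> > 0"
  then obtain w l where w: "Im w > 0" "(\<lambda>n. stieltjes (\<mu> n) w) \<longlonglongrightarrow> l" "2 * (1 - Im w * Im l) < \<epsilon>"
    using conv by blast
  have "(\<lambda>n. 2 * (1 - Im w * Im (stieltjes (\<mu> n) w))) \<longlonglongrightarrow> 2 * (1 - Im w * Im l)"
    by (intro tendsto_intros w)
  from order_tendstoD(2)[OF this w(3)] obtain N
    where N: "\<And>n. n \<ge> N \<Longrightarrow> 2 * (1 - Im w * Im (stieltjes (\<mu> n) w)) < \<epsilon>"
    by (auto simp: eventually_sequentially)
  have "\<exists>k::nat. measure (\<mu> n) {- real k<..real k} > 1 - \<epsilon>" for n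
  proof -
    have "(\<lambda>k. measure (\<mu> n) {- real k<..real k}) \<longlonglongrightarrow> measure (\<mu> n) (\<Union>k. {- real k<..real k})"
      by (rule \<mu>.finite_Lim_measure_incseq) (auto simp: incseq_def)
    also have "measure (\<mu> n) (\<Union>k. {- real k<..real k}) = 1"
      unfolding UN_Ioc_eq_UNIV using \<mu>.prob_space[of n] by simp
    finally have "eventually (\<lambda>k. measure (\<mu> n) {- real k<..real k} > 1 - \<epsilon>) sequentially"
      using \<open>\<epsilon> > 0\<close> by (intro order_tendstoD) auto
    then show ?thesis by (auto simp: eventually_sequentially)
  qed
  then obtain k :: "nat \<Rightarrow> nat" where k: "\<And>n. measure (\<mu> n) {- real (k n)<..real (k n)} > 1 - \<epsilon>" by metis
  define R where "R = 1 + \<bar>Re w\<bar> + Im w + (\<Sum>n<N. real (k n))"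
  have "R > 0" using w(1) by (simp add: R_def add_pos_nonneg sum_nonneg)
  have "measure (\<mu> n) {-R<..R} > 1 - \<epsilon>" for n
  proof (cases "n < N")
    case True
    then have "real (k n) \<le> (\<Sum>n<N. real (k n))" by (intro member_le_sum) auto
    then have "{- real (k n)<..real (k n)} \<subseteq> {-R<..R}" using w(1) by (auto simp: R_def)
    then have "measure (\<mu> n) {- real (k n)<..real (k n)} \<le> measure (\<mu> n) {-R<..R}"
      by (intro \<mu>.finite_measure_mono) auto
    with k[of n] show ?thesis by simp
  next
    case False
    have meas: "{x. Im w \<le> \<bar>x - Re w\<bar>} \<in> sets borel" by measurable
    have "0 \<le> (\<Sum>n<N. real (k n))" by (simp add: sum_nonneg)
    then have "UNIV - {x. Im w \<le> \<bar>x - Re w\<bar>} \<subseteq> {-R<..R}" unfolding R_def by (auto; linarith)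
    then have "measure (\<mu> n) (UNIV - {x. Im w \<le> \<bar>x - Re w\<bar>}) \<le> measure (\<mu> n) {-R<..R}"
      using meas by (intro \<mu>.finite_measure_mono) auto
    moreover have "measure (\<mu> n) (UNIV - {x. Im w \<le> \<bar>x - Re w\<bar>}) = 1 - measure (\<mu> n) {x. Im w \<le> \<bar>x - Re w\<bar>}"
      using \<mu>.prob_compl[of "{x. Im w \<le> \<bar>x - Re w\<bar>}" n] meas by simp
    ultimately show ?thesis
      using \<mu>.measure_tail_le_stieltjes[OF w(1), of n] N[of n] False by linarith
  qed
  then show "\<exists>a b. a < b \<and> (\<forall>n. 1 - \<epsilon> < measure (\<mu> n) {a<..b})"
    using \<open>R > 0\<close> by (intro exI[of _ "-R"] exI[of _ R]) auto
qed

text \<open>The transforms are known at points shifted away from the imaginary axis, as the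
  characteristics dictate. Since the limit value at i k has norm at most 1 / k, a shift bounded by R
  changes Im w * Im l by at most R / k, which disappears for large k.\<close>

lemma tight_of_stieltjes_along_lines:
  assumes rd: "\<And>n. real_distribution (\<mu> n)" and "real_distribution \<nu>"
    and conv: "\<And>k::nat. k \<ge> K \<Longrightarrow> (\<lambda>n. stieltjes (\<mu> n) (\<i> * of_nat k + s k)) \<longlonglongrightarrow> stieltjes \<nu> (\<i> * of_nat k)"
    and s: "\<And>k. k \<ge> K \<Longrightarrow> norm (s k) \<le> R"
  shows "tight \<mu>"
proof (rule tight_of_stieltjes[OF rd])
  interpret \<nu>: real_distribution \<nu> by fact
  fix \<epsilon> :: real assume "\<epsilon> > 0"
  let ?l = "\<lambda>k::nat. stieltjes \<nu> (\<i> * of_nat k)"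
  have "(\<lambda>k. 2 * (1 - (real k * Im (?l k) - R * (1 / real k)))) \<longlonglongrightarrow> 2 * (1 - (1 - R * 0))"
    by (intro tendsto_intros \<nu>.stieltjes_imaginary_axis_tendsto lim_1_over_n)
  then have "eventually (\<lambda>k. 2 * (1 - (real k * Im (?l k) - R * (1 / real k))) < \<epsilon>) sequentially"
    by (rule order_tendstoD) (use \<open>\<epsilon> > 0\<close> in simp)
  moreover obtain K' :: nat where K': "real K' > R + 1" using reals_Archimedean2 by blast
  moreover have "eventually (\<lambda>k. k \<ge> max 1 (max K K')) sequentially" by (rule eventually_ge_at_top)
  ultimately have "eventually (\<lambda>k. 2 * (1 - (real k * Im (?l k) - R * (1 / real k))) < \<epsilon> \<and> k \<ge> max 1 (max K K')) sequentially"
    by (simp add: eventually_conj_iff)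
  then obtain k where k: "2 * (1 - (real k * Im (?l k) - R * (1 / real k))) < \<epsilon>" "k \<ge> 1" "k \<ge> K" "k \<ge> K'"
    by (auto simp: eventually_sequentially)
  define w where "w = \<i> * of_nat k + s k"
  have s': "\<bar>Im (s k)\<bar> \<le> R" using s[OF k(3)] abs_Im_le_cmod[of "s k"] by linarith
  have "real k > R + 1" using K' k(4) by linarith
  then have "Im w > 0" using s' by (simp add: w_def)
  moreover have "2 * (1 - Im w * Im (?l k)) < \<epsilon>"
  proof -
    have "\<bar>Im (?l k)\<bar> \<le> 1 / real k"
      using \<nu>.norm_stieltjes_le[of "\<i> * of_nat k"] k(2) abs_Im_le_cmod[of "?l k"] by simp
    then have "\<bar>Im (s k) * Im (?l k)\<bar> \<le> R * (1 / real k)"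
      unfolding abs_mult using s' by (intro mult_mono) auto
    then have "real k * Im (?l k) - R * (1 / real k) \<le> Im w * Im (?l k)"
      by (simp add: w_def algebra_simps)
    then have "2 * (1 - Im w * Im (?l k)) \<le> 2 * (1 - (real k * Im (?l k) - R * (1 / real k)))"
      by simp
    with k(1) show ?thesis by (rule le_less_trans[rotated])
  qed
  ultimately show "\<exists>w l. Im w > 0 \<and> (\<lambda>n. stieltjes (\<mu> n) w) \<longlonglongrightarrow> l \<and> 2 * (1 - Im w * Im l) < \<epsilon>"
    using conv[OF k(3)] unfolding w_def by blast
qed

section \<open>Stieltjes inversion and uniqueness\<close>

context real_distribution
begin

text \<open>Stieltjes inversion without Fubini: the derivative in \<open>b\<close> is the imaginary part of the
  Stieltjes transform at height \<open>\<eta>\<close>, and the limit \<open>\<eta> \<rightarrow> 0\<close> recovers the distribution function.\<close>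
definition arctan_transform :: "real \<Rightarrow> real \<Rightarrow> real" where
  "arctan_transform \<eta> b = (\<integral>x. arctan ((b - x) / \<eta>) \<partial>M)"

lemma abs_arctan_le: "\<bar>arctan x\<bar> * 2 \<le> pi"
  using arctan_bounded[of x] by linarith

lemma integrable_arctan: "integrable M (\<lambda>x. arctan ((b - x) / \<eta>))"
  by (rule integrable_const_bound[where B = "pi / 2"]) (auto simp: abs_arctan_le)

text \<open>Dominated convergence for difference quotients: the kernel is Lipschitz in b with
  constant 1 / \<eta> uniformly in x, and its derivative is the imaginary part of the resolvent at b
  + i \<eta>.\<close>

lemma DERIV_arctan_transform:
  assumes "\<eta> > 0"
  shows "(arctan_transform \<eta> has_real_derivative Im (stieltjes M (Complex b \<eta>))) (at b)"
  unfolding has_field_derivative_iff tendsto_at_iff_sequentially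
proof (intro allI impI)
  fix h :: "nat \<Rightarrow> real" assume "\<forall>i. h i \<in> UNIV - {b}" and h: "h \<longlonglongrightarrow> b"
  then have ne: "h i \<noteq> b" for i by auto
  let ?q = "\<lambda>i x. (arctan ((h i - x) / \<eta>) - arctan ((b - x) / \<eta>)) / (h i - b)"
  have D: "((\<lambda>y. arctan ((y - x) / \<eta>)) has_real_derivative \<eta> / ((y - x)\<^sup>2 + \<eta>\<^sup>2)) (at y)" for x y
  proof -
    have "((\<lambda>y. (y - x) / \<eta>) has_real_derivative 1 / \<eta>) (at y)"
      using assms by (auto intro!: derivative_eq_intros)
    from DERIV_chain2[OF DERIV_arctan this]
    have "((\<lambda>y. arctan ((y - x) / \<eta>)) has_real_derivative inverse (1 + ((y - x) / \<eta>)\<^sup>2) * (1 / \<eta>)) (at y)" .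
    moreover have "inverse (1 + ((y - x) / \<eta>)\<^sup>2) * (1 / \<eta>) = \<eta> / ((y - x)\<^sup>2 + \<eta>\<^sup>2)"
      using assms by (simp add: field_simps power2_eq_square add_nonneg_eq_0_iff)
    ultimately show ?thesis by simp
  qed
  have bd: "\<bar>arctan ((y - x) / \<eta>) - arctan ((b - x) / \<eta>)\<bar> \<le> 1 / \<eta> * \<bar>y - b\<bar>" for x y
  proof -
    have "norm (arctan ((y - x) / \<eta>) - arctan ((b - x) / \<eta>)) \<le> 1 / \<eta> * norm (y - b)"
    proof (rule field_differentiable_bound[of UNIV])
      show "((\<lambda>y. arctan ((y - x) / \<eta>)) has_field_derivative \<eta> / ((y - x)\<^sup>2 + \<eta>\<^sup>2)) (at y within UNIV)" for y
        using D by simp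
      show "norm (\<eta> / ((y - x)\<^sup>2 + \<eta>\<^sup>2)) \<le> 1 / \<eta>" for y
      proof -
        have "\<eta> / ((y - x)\<^sup>2 + \<eta>\<^sup>2) \<le> \<eta> / \<eta>\<^sup>2"
          using assms by (intro divide_left_mono) (auto intro!: mult_pos_pos add_nonneg_pos)
        then show ?thesis using assms by (simp add: power2_eq_square)
      qed
    qed auto
    then show ?thesis by simp
  qed
  have "(\<lambda>i. \<integral>x. ?q i x \<partial>M) \<longlonglongrightarrow> (\<integral>x. \<eta> / ((b - x)\<^sup>2 + \<eta>\<^sup>2) \<partial>M)"
  proof (rule integral_dominated_convergence[where w = "\<lambda>_. 1 / \<eta>"])
    show "AE x in M. (\<lambda>i. ?q i x) \<longlonglongrightarrow> \<eta> / ((b - x)\<^sup>2 + \<eta>\<^sup>2)"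
    proof (rule AE_I2)
      fix x
      have "((\<lambda>y. (arctan ((y - x) / \<eta>) - arctan ((b - x) / \<eta>)) / (y - b)) \<longlongrightarrow> \<eta> / ((b - x)\<^sup>2 + \<eta>\<^sup>2)) (at b)"
        using D[of x b] unfolding has_field_derivative_iff .
      then show "(\<lambda>i. ?q i x) \<longlonglongrightarrow> \<eta> / ((b - x)\<^sup>2 + \<eta>\<^sup>2)"
        unfolding tendsto_at_iff_sequentially o_def using ne h by auto
    qed
    show "AE x in M. norm (?q i x) \<le> 1 / \<eta>" for i
    proof (rule AE_I2)
      fix x
      have "\<bar>arctan ((h i - x) / \<eta>) - arctan ((b - x) / \<eta>)\<bar> / \<bar>h i - b\<bar> \<le> 1 / \<eta>"
        using ne[of i] bd[of "h i" x] by (subst pos_divide_le_eq) auto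
      then show "norm (?q i x) \<le> 1 / \<eta>" by simp
    qed
  qed auto
  also have "(\<integral>x. \<eta> / ((b - x)\<^sup>2 + \<eta>\<^sup>2) \<partial>M) = Im (stieltjes M (Complex b \<eta>))"
    using Im_stieltjes[of "Complex b \<eta>"] assms by (simp add: power2_commute)
  also have "(\<lambda>i. \<integral>x. ?q i x \<partial>M) = ((\<lambda>y. (arctan_transform \<eta> y - arctan_transform \<eta> b) / (y - b)) \<circ> h)"
    unfolding arctan_transform_def o_def
    by (simp add: integrable_arctan Bochner_Integration.integral_diff)
  finally show "((\<lambda>y. (arctan_transform \<eta> y - arctan_transform \<eta> b) / (y - b)) \<circ> h)
      \<longlonglongrightarrow> Im (stieltjes M (Complex b \<eta>))" .
qed

lemma arctan_transform_at_bot: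
  assumes "\<eta> > 0"
  shows "(\<lambda>k. arctan_transform \<eta> (- real k)) \<longlonglongrightarrow> - (pi / 2)"
proof -
  have "(\<lambda>k. \<integral>x. arctan ((- real k - x) / \<eta>) \<partial>M) \<longlonglongrightarrow> (\<integral>x. - (pi / 2) \<partial>M)"
  proof (rule integral_dominated_convergence[where w = "\<lambda>_. pi / 2"])
    show "AE x in M. (\<lambda>k. arctan ((- real k - x) / \<eta>)) \<longlonglongrightarrow> - (pi / 2)"
    proof (rule AE_I2)
      fix x
      have "filterlim (\<lambda>k. (- real k - x) / \<eta>) at_bot sequentially"
        using assms by real_asymp
      then show "(\<lambda>k. arctan ((- real k - x) / \<eta>)) \<longlonglongrightarrow> - (pi / 2)"
        using tendsto_arctan_at_bot filterlim_compose by fastforce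
    qed
  qed (auto simp: abs_arctan_le)
  then show ?thesis using prob_space by (simp add: arctan_transform_def)
qed

text \<open>An atom at b contributes arctan 0 = 0. So the limit sees the mean of the distribution
  function and its left limit.\<close>

lemma arctan_transform_at_0:
  "(\<lambda>k. arctan_transform (1 / real (Suc k)) b) \<longlonglongrightarrow> pi / 2 * (measure M {..<b} + cdf M b - 1)"
proof -
  have "(\<lambda>k. \<integral>x. arctan ((b - x) / (1 / real (Suc k))) \<partial>M) \<longlonglongrightarrow> (\<integral>x. pi / 2 * (indicator {..<b} x + indicator {..b} x - 1) \<partial>M)"
  proof (rule integral_dominated_convergence[where w = "\<lambda>_. pi / 2"])
    show "AE x in M. (\<lambda>k. arctan ((b - x) / (1 / real (Suc k)))) \<longlonglongrightarrow> pi / 2 * (indicator {..<b} x + indicator {..b} x - 1)"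
    proof (rule AE_I2)
      fix x
      consider "x < b" | "x = b" | "x > b" by linarith
      then show "(\<lambda>k. arctan ((b - x) / (1 / real (Suc k)))) \<longlonglongrightarrow> pi / 2 * (indicator {..<b} x + indicator {..b} x - 1)"
      proof cases
        case 1
        then have "filterlim (\<lambda>k. (b - x) / (1 / real (Suc k))) at_top sequentially"
          by real_asymp
        from filterlim_compose[OF tendsto_arctan_at_top this] show ?thesis using 1 by simp
      next
        case 3
        then have "filterlim (\<lambda>k. (b - x) / (1 / real (Suc k))) at_bot sequentially"
          by real_asymp
        from filterlim_compose[OF tendsto_arctan_at_bot this] show ?thesis using 3 by simp
      qed simp
    qed
  qed (auto simp: abs_arctan_le simp del: divide_divide_eq_right)
  also have "(\<integral>x. pi / 2 * (indicator {..<b} x + indicator {..b} x - 1) \<partial>M) = pi / 2 * (measure M {..<b} + cdf M b - 1)"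
  proof -
    have *: "integrable M (indicator {..<b} :: real \<Rightarrow> real)" "integrable M (indicator {..b} :: real \<Rightarrow> real)"
      by (auto intro!: integrable_real_indicator simp: emeasure_eq_measure)
    then show ?thesis using prob_space by (simp add: cdf_def)
  qed
  finally show ?thesis by (simp add: arctan_transform_def)
qed

text \<open>The symmetrized distribution function at b' determines \<open>cdf\<close> at b < b' from
  both sides; right continuity then recovers \<open>cdf\<close> itself.\<close>

lemma cdf_le_half_sum:
  assumes "b < b'"
  shows "2 * cdf M b \<le> measure M {..<b'} + cdf M b'" "measure M {..<b'} + cdf M b' \<le> 2 * cdf M b'"
proof -
  have "cdf M b \<le> measure M {..<b'}" "measure M {..<b'} \<le> cdf M b'"
    unfolding cdf_def using assms by (auto intro!: finite_measure_mono)
  moreover have "cdf M b \<le> cdf M b'" using assms by (intro cdf_nondecreasing) auto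
  ultimately show "2 * cdf M b \<le> measure M {..<b'} + cdf M b'" "measure M {..<b'} + cdf M b' \<le> 2 * cdf M b'"
    by linarith+
qed

end

text \<open>Equal transforms give arctan transforms with equal derivatives, so they differ by a
  constant, which is 0 by their common limit at minus infinity. Letting \<eta> tend to 0 equates the
  symmetrized distribution functions.\<close>

lemma stieltjes_unique:
  assumes "real_distribution \<mu>" "real_distribution \<nu>"
    and eq: "\<And>z. Im z > 0 \<Longrightarrow> stieltjes \<mu> z = stieltjes \<nu> z"
  shows "\<mu> = \<nu>"
proof (rule cdf_unique[OF assms(1,2)], rule ext)
  interpret \<mu>: real_distribution \<mu> by fact
  interpret \<nu>: real_distribution \<nu> by fact
  have A: "\<mu>.arctan_transform \<eta> b = \<nu>.arctan_transform \<eta> b" if "\<eta> > 0" for \<eta> b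
  proof -
    let ?d = "\<lambda>y. \<mu>.arctan_transform \<eta> y - \<nu>.arctan_transform \<eta> y"
    have "(?d has_real_derivative 0) (at y)" for y
      using DERIV_diff[OF \<mu>.DERIV_arctan_transform[OF that, of y] \<nu>.DERIV_arctan_transform[OF that, of y]]
        eq[of "Complex y \<eta>"] that by simp
    then have const: "?d y = ?d b" for y by (intro DERIV_isconst_all) blast
    have eqd: "(\<lambda>k. ?d (- real k)) = (\<lambda>k. ?d b)" by (rule ext) (rule const)
    have "(\<lambda>k. ?d (- real k)) \<longlonglongrightarrow> - (pi / 2) - - (pi / 2)"
      by (intro tendsto_intros \<mu>.arctan_transform_at_bot \<nu>.arctan_transform_at_bot that)
    then have "(\<lambda>k::nat. ?d b) \<longlonglongrightarrow> 0" by (simp only: eqd diff_self)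
    then show ?thesis by (simp add: LIMSEQ_const_iff)
  qed
  have S: "measure \<mu> {..<b} + cdf \<mu> b = measure \<nu> {..<b} + cdf \<nu> b" for b
  proof -
    have "pi / 2 * (measure \<mu> {..<b} + cdf \<mu> b - 1) = pi / 2 * (measure \<nu> {..<b} + cdf \<nu> b - 1)"
      by (rule LIMSEQ_unique[OF \<mu>.arctan_transform_at_0])
         (use \<nu>.arctan_transform_at_0 A in simp)
    then show ?thesis by simp
  qed
  fix b
  have *: "cdf P b \<le> cdf Q b"
    if "real_distribution P" "real_distribution Q" "\<And>b. measure P {..<b} + cdf P b = measure Q {..<b} + cdf Q b"
    for P Q :: "real measure"
  proof -
    interpret P: real_distribution P by fact
    interpret Q: real_distribution Q by fact
    have "(cdf Q \<longlongrightarrow> cdf Q b) (at_right b)"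
      using Q.cdf_is_right_cont[of b] by (simp add: continuous_within)
    moreover have "eventually (\<lambda>b'. cdf P b \<le> cdf Q b') (at_right b)"
      using eventually_at_right_less[of b]
    proof eventually_elim
      case (elim b')
      show ?case
        using P.cdf_le_half_sum(1)[OF elim] Q.cdf_le_half_sum(2)[OF elim] that(3)[of b'] by linarith
    qed
    ultimately show ?thesis by (intro tendsto_lowerbound) auto
  qed
  show "cdf \<mu> b = cdf \<nu> b"
    using *[OF assms(1,2) S] *[OF assms(2,1) S[symmetric]] by simp
qed

lemma stieltjes_unique_accumulation:
  assumes "real_distribution \<mu>" "real_distribution \<nu>"
    and "U \<subseteq> {z. Im z > 0}" "\<xi> islimpt U" "Im \<xi> > 0"
    and eq: "\<And>z. z \<in> U \<Longrightarrow> stieltjes \<mu> z = stieltjes \<nu> z"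
  shows "\<mu> = \<nu>"
proof (rule stieltjes_unique[OF assms(1,2)])
  fix z assume "Im z > 0"
  have "stieltjes \<mu> z - stieltjes \<nu> z = 0"
  proof (rule analytic_continuation[of "\<lambda>z. stieltjes \<mu> z - stieltjes \<nu> z" "{z. Im z > 0}" U \<xi>])
    show "(\<lambda>z. stieltjes \<mu> z - stieltjes \<nu> z) holomorphic_on {z. Im z > 0}"
      using assms(1,2) by (intro holomorphic_intros real_distribution.holomorphic_stieltjes)
    show "connected {z. Im z > 0}" using convex_upper_half_plane convex_connected by blast
  qed (use assms \<open>Im z > 0\<close> open_upper_half_plane in auto)
  then show "stieltjes \<mu> z = stieltjes \<nu> z" by simp
qed

section \<open>Weak convergence tested on resolvents\<close>

lemma weak_conv_imp_resolvent_tendsto: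
  assumes "\<And>n. real_distribution (\<mu> n)" "real_distribution \<nu>" "weak_conv_m \<mu> \<nu>" "Im z \<noteq> 0"
  shows "(\<lambda>n. \<integral>x. 1 / (complex_of_real x - z) ^ k \<partial>\<mu> n) \<longlonglongrightarrow> (\<integral>x. 1 / (complex_of_real x - z) ^ k \<partial>\<nu>)"
  by (rule weak_conv_imp_integral_bdd_continuous_conv[OF assms(1-3), where B = "1 / \<bar>Im z\<bar> ^ k"])
     (use norm_resolvent_power_le[OF assms(4)] of_real_diff_nonzero[OF assms(4)] in \<open>auto intro!: continuous_intros\<close>)

lemma weak_conv_imp_stieltjes_tendsto:
  assumes "\<And>n. real_distribution (\<mu> n)" "real_distribution \<nu>" "weak_conv_m \<mu> \<nu>" "Im z \<noteq> 0"
  shows "(\<lambda>n. stieltjes (\<mu> n) z) \<longlonglongrightarrow> stieltjes \<nu> z"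
  using weak_conv_imp_resolvent_tendsto[OF assms, of 1] by (simp add: stieltjes_def)

lemma weak_conv_imp_stieltjes'_tendsto:
  assumes "\<And>n. real_distribution (\<mu> n)" "real_distribution \<nu>" "weak_conv_m \<mu> \<nu>" "Im z \<noteq> 0"
  shows "(\<lambda>n. stieltjes' (\<mu> n) z) \<longlonglongrightarrow> stieltjes' \<nu> z"
  using weak_conv_imp_resolvent_tendsto[OF assms, of 2] by (simp add: stieltjes'_def)

text \<open>Every subsequential weak limit has the transform of \<nu> on U and hence equals
  \<nu>.\<close>

lemma weak_conv_of_stieltjes:
  assumes rd: "\<And>n. real_distribution (\<mu> n)" and "real_distribution \<nu>" and "tight \<mu>"
    and U: "U \<subseteq> {z. Im z > 0}" "\<xi> islimpt U" "Im \<xi> > 0"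
    and conv: "\<And>z. z \<in> U \<Longrightarrow> (\<lambda>n. stieltjes (\<mu> n) z) \<longlonglongrightarrow> stieltjes \<nu> z"
  shows "weak_conv_m \<mu> \<nu>"
proof (rule tight_subseq_weak_converge[OF rd assms(2,3)])
  fix s :: "nat \<Rightarrow> nat" and \<rho>
  assume s: "strict_mono s" and rho: "real_distribution \<rho>" and w: "weak_conv_m (\<mu> \<circ> s) \<rho>"
  have "\<rho> = \<nu>"
  proof (rule stieltjes_unique_accumulation[OF rho assms(2) U])
    fix z assume z: "z \<in> U"
    then have "Im z \<noteq> 0" using U(1) by auto
    then have "(\<lambda>n. stieltjes (\<mu> (s n)) z) \<longlonglongrightarrow> stieltjes \<rho> z"
      using weak_conv_imp_stieltjes_tendsto[OF _ rho w] rd by simp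
    moreover have "(\<lambda>n. stieltjes (\<mu> (s n)) z) \<longlonglongrightarrow> stieltjes \<nu> z"
      using LIMSEQ_subseq_LIMSEQ[OF conv[OF z] s] by (simp add: o_def)
    ultimately show "stieltjes \<rho> z = stieltjes \<nu> z" by (rule LIMSEQ_unique)
  qed
  with w show "weak_conv_m (\<mu> \<circ> s) \<nu>" by simp
qed

section \<open>Empirical measures and densities bounded by one\<close>

text \<open>Weak convergence is turned into Levy convergence only for limits without atoms.\<close>

lemma density_le_one_atomless:
  assumes "density_le_one \<mu>"
  shows "measure \<mu> {x} = 0"
proof -
  obtain f :: "real \<Rightarrow> real" where f: "f \<in> borel_measurable borel" "\<mu> = density lborel (\<lambda>x. ennreal (f x))"
    using assms unfolding density_le_one_def by blast
  have "emeasure \<mu> {x} = (\<integral>\<^sup>+y. ennreal (f y) * indicator {x} y \<partial>lborel)"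
    unfolding f(2) using f(1) by (subst emeasure_density) auto
  also have "\<dots> = 0"
  proof -
    have "AE y in lborel. y \<noteq> x" by (rule AE_lborel_singleton)
    then have "AE y in lborel. ennreal (f y) * indicator {x} y = 0"
      by eventually_elim auto
    then show ?thesis using f(1) by (subst nn_integral_0_iff_AE) auto
  qed
  finally show ?thesis by (simp add: measure_def)
qed

text \<open>The function x - \<open>cdf \<mu> x\<close> is nondecreasing and right continuous, so it
  generates a measure N with \<mu> + N equal to Lebesgue measure. Both summands are then absolutely
  continuous and their densities add up to 1.\<close>

lemma density_le_one_of_lipschitz_cdf:
  assumes "real_distribution \<mu>" and lip: "\<And>a b. a \<le> b \<Longrightarrow> cdf \<mu> b - cdf \<mu> a \<le> b - a"
  shows "density_le_one \<mu>"
proof -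
  interpret \<mu>: real_distribution \<mu> by fact
  define G where "G x = x - cdf \<mu> x" for x
  define N where "N = interval_measure G"
  have monoG: "\<And>x y. x \<le> y \<Longrightarrow> G x \<le> G y" using lip by (force simp: G_def)
  have contG: "continuous (at_right a) G" for a
    unfolding G_def[abs_def] using \<mu>.cdf_is_right_cont[of a] by (intro continuous_intros) auto
  have N_Ioc: "emeasure N {a<..b} = ennreal (G b - G a)" if "a \<le> b" for a b
    unfolding N_def using monoG contG that by (intro emeasure_interval_measure_Ioc) auto
  have sN [simp]: "sets N = sets borel" by (simp add: N_def)
  define S where "S = measure_of UNIV (sets borel) (\<lambda>A. emeasure \<mu> A + emeasure N A)"
  have sS: "sets S = sets borel"
    unfolding S_def using sets.sets_measure_of_eq[of "borel :: real measure"] by simp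
  have eS: "emeasure S A = emeasure \<mu> A + emeasure N A" if "A \<in> sets borel" for A
    unfolding S_def
  proof (rule emeasure_measure_of_sigma)
    show "sigma_algebra UNIV (sets (borel :: real measure))"
      using sets.sigma_algebra_axioms[of "borel :: real measure"] by simp
    show "positive (sets borel) (\<lambda>A. emeasure \<mu> A + emeasure N A)" by (simp add: positive_def)
    show "countably_additive (sets borel) (\<lambda>A. emeasure \<mu> A + emeasure N A)"
    proof (rule countably_additiveI)
      fix A :: "nat \<Rightarrow> real set"
      assume A: "range A \<subseteq> sets borel" "disjoint_family A"
      have "(\<Sum>i. emeasure \<mu> (A i) + emeasure N (A i)) = (\<Sum>i. emeasure \<mu> (A i)) + (\<Sum>i. emeasure N (A i))"
        by (simp add: suminf_add)
      then show "(\<Sum>i. emeasure \<mu> (A i) + emeasure N (A i)) = emeasure \<mu> (\<Union>i. A i) + emeasure N (\<Union>i. A i)"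
        using A by (simp add: suminf_emeasure)
    qed
  qed (use that in simp)
  have SL: "S = lborel"
  proof (rule measure_eqI_generator_eq[where \<Omega> = UNIV and E = "range (\<lambda>(a, b). {a<..b::real})" and A = "\<lambda>i. {- real i<..real i}"])
    show "Int_stable (range (\<lambda>(a, b). {a<..b::real}))"
      by (auto simp: Int_stable_def image_iff)
    show "sets S = sigma_sets UNIV (range (\<lambda>(a, b). {a<..b::real}))"
      unfolding sS borel_sigma_sets_Ioc by (simp add: sets_measure_of)
    show "sets lborel = sigma_sets UNIV (range (\<lambda>(a, b). {a<..b::real}))"
      unfolding sets_lborel borel_sigma_sets_Ioc by (simp add: sets_measure_of)
    show eq: "emeasure S X = emeasure lborel X" if "X \<in> range (\<lambda>(a, b). {a<..b::real})" for X
    proof -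
      from that obtain a b where X: "X = {a<..b}" by auto
      show ?thesis
      proof (cases "a \<le> b")
        case True
        then have "emeasure S X = ennreal (cdf \<mu> b - cdf \<mu> a) + ennreal (G b - G a)"
          unfolding X by (simp add: eS \<mu>.emeasure_Ioc N_Ioc)
        also have "\<dots> = ennreal (b - a)"
          using monoG[OF True] \<mu>.cdf_nondecreasing[OF True] by (subst ennreal_plus[symmetric]) (auto simp: G_def)
        finally show ?thesis using True by (simp add: X)
      next
        case False
        then show ?thesis by (simp add: X)
      qed
    qed
    show "emeasure S {- real i<..real i} \<noteq> \<infinity>" for i
      by (subst eq) auto
  qed (auto simp: UN_Ioc_eq_UNIV)
  have sum: "emeasure lborel A = emeasure \<mu> A + emeasure N A" if "A \<in> sets borel" for A
    using eS[OF that] by (simp add: SL)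
  have ac: "absolutely_continuous lborel \<mu>" "absolutely_continuous lborel N"
    unfolding absolutely_continuous_def using sum by (auto simp: null_sets_def)
  obtain f where f: "f \<in> borel_measurable lborel" "density lborel f = \<mu>"
    using sigma_finite_measure.Radon_Nikodym[OF sigma_finite_lborel ac(1)] by auto
  obtain g where g: "g \<in> borel_measurable lborel" "density lborel g = N"
    using sigma_finite_measure.Radon_Nikodym[OF sigma_finite_lborel ac(2)] by auto
  have [measurable]: "f \<in> borel_measurable borel" "g \<in> borel_measurable borel"
    using f(1) g(1) by auto
  have "density lborel (\<lambda>x. f x + g x) = density lborel (\<lambda>x. 1)"
  proof (rule measure_eqI)
    fix A assume "A \<in> sets (density lborel (\<lambda>x. f x + g x))"
    then have A [measurable]: "A \<in> sets borel" by simp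
    have "emeasure (density lborel (\<lambda>x. f x + g x)) A = emeasure (density lborel f) A + emeasure (density lborel g) A"
      by (simp add: emeasure_density distrib_right nn_integral_add)
    also have "\<dots> = emeasure lborel A" using sum[OF A] by (simp add: f g)
    finally show "emeasure (density lborel (\<lambda>x. f x + g x)) A = emeasure (density lborel (\<lambda>x. 1)) A"
      by (simp add: density_1)
  qed simp
  then have "AE x in lborel. f x + g x = 1"
    by (intro sigma_finite_measure.density_unique[OF sigma_finite_lborel]) auto
  \<comment> \<open>Truncation at 1 changes the density on a null set only and gives the pointwise
    bound demanded by \<open>density_le_one\<close>.\<close>
  then have ae: "AE x in lborel. f x = ennreal (enn2real (min 1 (f x)))"
  proof eventually_elim
    case (elim x)
    then have "f x \<le> 1" by (metis le_iff_add)
    moreover from this have "f x \<noteq> \<top>" using neq_top_trans[OF ennreal_one_neq_top] by blast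
    ultimately show ?case by (simp add: min_absorb2 ennreal_enn2real_if)
  qed
  show ?thesis unfolding density_le_one_def
  proof (intro exI[of _ "\<lambda>x. enn2real (min 1 (f x))"] conjI allI)
    show "(\<lambda>x. enn2real (min 1 (f x))) \<in> borel_measurable borel" by measurable
    show "0 \<le> enn2real (min 1 (f x))" "enn2real (min 1 (f x)) \<le> 1" for x
      by (auto intro: enn2real_leI)
    show "\<mu> = density lborel (\<lambda>x. ennreal (enn2real (min 1 (f x))))"
      unfolding f(2)[symmetric] using ae by (intro density_cong) auto
  qed
qed

text \<open>The bound on intervals passes to the limit when both endpoints are continuity points.
  These are dense, so general endpoints are approached from the right, by right continuity at a and
  monotonicity at b.\<close>

lemma density_le_one_of_weak_conv:
  assumes rd: "\<And>n. real_distribution (\<mu> n)" "real_distribution \<nu>" and wc: "weak_conv_m \<mu> \<nu>"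
    and gap: "\<And>n a b. a \<le> b \<Longrightarrow> measure (\<mu> n) {a<..b} \<le> b - a + e n" and e: "e \<longlonglongrightarrow> 0"
  shows "density_le_one \<nu>"
proof (rule density_le_one_of_lipschitz_cdf[OF rd(2)])
  interpret \<mu>: real_distribution "\<mu> n" for n by fact
  interpret \<nu>: real_distribution \<nu> by fact
  have cont: "cdf \<nu> b - cdf \<nu> a \<le> b - a" if "a \<le> b" "isCont (cdf \<nu>) a" "isCont (cdf \<nu>) b" for a b
  proof (cases "a = b")
    case False
    then have "a < b" using that by simp
    have "(\<lambda>n. cdf (\<mu> n) b - cdf (\<mu> n) a) \<longlonglongrightarrow> cdf \<nu> b - cdf \<nu> a"
      using wc that unfolding weak_conv_m_def weak_conv_def by (intro tendsto_diff) auto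
    moreover have "(\<lambda>n. b - a + e n) \<longlonglongrightarrow> b - a + 0" by (intro tendsto_intros e)
    ultimately show ?thesis
      using gap[OF that(1)] \<mu>.cdf_diff_eq[OF \<open>a < b\<close>]
      by (intro LIMSEQ_le[of _ _ "\<lambda>n. b - a + e n" "b - a"]) auto
  qed simp
  have dense: "\<exists>y. x < y \<and> y < x + d \<and> isCont (cdf \<nu>) y" if "d > 0" for x d
  proof -
    have "uncountable ({x<..<x + d} - {x. measure \<nu> {x} > 0})"
      using that by (intro uncountable_minus_countable \<nu>.countable_atoms) (simp add: uncountable_open_interval)
    then have "{x<..<x + d} - {x. measure \<nu> {x} > 0} \<noteq> {}" by (metis countable_empty)
    then show ?thesis unfolding \<nu>.isCont_cdf by (auto simp: zero_less_measure_iff)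
  qed
  fix a b :: real assume ab: "a \<le> b"
  show "cdf \<nu> b - cdf \<nu> a \<le> b - a"
  proof (rule field_le_epsilon)
    fix d :: real assume "d > 0"
    obtain b' where b': "b < b'" "b' < b + d / 2" "isCont (cdf \<nu>) b'" using dense[of "d / 2" b] \<open>d > 0\<close> by auto
    have "(cdf \<nu> \<longlongrightarrow> cdf \<nu> a) (at_right a)"
      using \<nu>.cdf_is_right_cont[of a] by (simp add: continuous_within)
    then have "eventually (\<lambda>y. cdf \<nu> y < cdf \<nu> a + d / 2) (at_right a)"
      by (rule order_tendstoD) (use \<open>d > 0\<close> in simp)
    then obtain c where c: "c > a" "\<And>y. a < y \<Longrightarrow> y < c \<Longrightarrow> cdf \<nu> y < cdf \<nu> a + d / 2"
      by (auto simp: eventually_at_right_field)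
    \<comment> \<open>Taking a' below c' keeps it left of b' as well as inside the range where right
      continuity at a applies.\<close>
    define c' where "c' = min c b'"
    have "c' > a" using c b' ab by (simp add: c'_def)
    then obtain a' where a': "a < a'" "a' < a + (c' - a)" "isCont (cdf \<nu>) a'" using dense[of "c' - a" a] by auto
    then have "a' < c" "a' < b'" by (auto simp: c'_def)
    have "cdf \<nu> b \<le> cdf \<nu> b'" using b' by (intro \<nu>.cdf_nondecreasing) auto
    moreover have "cdf \<nu> a' < cdf \<nu> a + d / 2" using c a' \<open>a' < c\<close> by auto
    moreover have "cdf \<nu> b' - cdf \<nu> a' \<le> b' - a'" using \<open>a' < b'\<close> a' b' by (intro cont) auto
    ultimately show "cdf \<nu> b - cdf \<nu> a \<le> b - a + d" using b' a' by linarith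
  qed
qed

text \<open>What \<open>measure_of\<close> yields depends on countable additivity. The image of the
  uniform distribution on indices supplies it, and turns integrals into finite sums.\<close>

lemma emp_eq_distr:
  assumes "n \<ge> 1"
  shows "emp n \<theta> x = distr (measure_pmf (pmf_of_set {..<n})) borel (\<lambda>i. x i / (\<theta> * real n))" (is "_ = ?D")
proof -
  have ne: "{..<n} \<noteq> {}" using assms by (simp add: lessThan_empty_iff)
  have "?D = measure_of UNIV (sets borel) (emeasure ?D)"
    using measure_of_of_measure[of ?D] by simp
  also have "\<dots> = emp n \<theta> x" unfolding emp_def
  proof (rule measure_of_eq)
    fix A :: "real set" assume "A \<in> sigma_sets UNIV (sets borel)"
    then have A: "A \<in> sets borel" by (metis sets.sigma_sets_eq space_borel)
    have "emeasure ?D A = ennreal (real (card ({..<n} \<inter> ((\<lambda>i. x i / (\<theta> * real n)) -` A))) / real n)"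
      using A ne by (subst emeasure_distr) (auto simp: emeasure_pmf_of_set)
    also have "{..<n} \<inter> ((\<lambda>i. x i / (\<theta> * real n)) -` A) = {i. i < n \<and> x i / (\<theta> * real n) \<in> A}" by auto
    finally show "emeasure ?D A = ennreal (real (card {i. i < n \<and> x i / (\<theta> * real n) \<in> A}) / real n)" .
  qed simp
  finally show ?thesis by simp
qed

lemma real_distribution_emp: "n \<ge> 1 \<Longrightarrow> real_distribution (emp n \<theta> x)"
  unfolding emp_eq_distr
  by (intro prob_space.real_distribution_distr) (auto intro: prob_space_measure_pmf)

lemma measure_emp:
  assumes "n \<ge> 1" "A \<in> sets borel"
  shows "measure (emp n \<theta> x) A = real (card {i. i < n \<and> x i / (\<theta> * real n) \<in> A}) / real n"
proof -
  have ne: "{..<n} \<noteq> {}" using assms by (simp add: lessThan_empty_iff)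
  have "measure (emp n \<theta> x) A = real (card ({..<n} \<inter> ((\<lambda>i. x i / (\<theta> * real n)) -` A))) / real n"
    unfolding emp_eq_distr[OF assms(1)] using assms ne by (subst measure_distr) (auto simp: measure_pmf_of_set)
  also have "{..<n} \<inter> ((\<lambda>i. x i / (\<theta> * real n)) -` A) = {i. i < n \<and> x i / (\<theta> * real n) \<in> A}" by auto
  finally show ?thesis .
qed

lemma integral_emp:
  fixes f :: "real \<Rightarrow> complex"
  assumes "n \<ge> 1" "f \<in> borel_measurable borel"
  shows "integral\<^sup>L (emp n \<theta> x) f = (\<Sum>i<n. f (x i / (\<theta> * real n))) / of_nat n"
proof -
  have ne: "{..<n} \<noteq> {}" using assms by (simp add: lessThan_empty_iff)
  have "integral\<^sup>L (emp n \<theta> x) f = (\<integral>i. f (x i / (\<theta> * real n)) \<partial>measure_pmf (pmf_of_set {..<n}))"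
    unfolding emp_eq_distr[OF assms(1)] using assms by (subst integral_distr) auto
  also have "\<dots> = (\<Sum>i\<in>{..<n}. pmf (pmf_of_set {..<n}) i *\<^sub>R f (x i / (\<theta> * real n)))"
    using ne by (intro integral_measure_pmf) auto
  also have "\<dots> = (\<Sum>i<n. f (x i / (\<theta> * real n))) / of_nat n"
    using ne by (simp add: pmf_of_set scaleR_conv_of_real sum_divide_distrib divide_simps)
  finally show ?thesis .
qed

lemma stieltjes_emp:
  "n \<ge> 1 \<Longrightarrow> stieltjes (emp n \<theta> x) z = (\<Sum>i<n. 1 / (complex_of_real (x i / (\<theta> * real n)) - z)) / of_nat n"
  unfolding stieltjes_def by (subst integral_emp) auto

lemma measure_emp_antimono:
  assumes "n \<ge> 1" "\<theta> > 0" "\<And>i. i < n \<Longrightarrow> x i \<le> x' i"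
  shows "measure (emp n \<theta> x') {..<y} \<le> measure (emp n \<theta> x) {..<y}"
proof -
  have "{i. i < n \<and> x' i / (\<theta> * real n) \<in> {..<y}} \<subseteq> {i. i < n \<and> x i / (\<theta> * real n) \<in> {..<y}}"
  proof clarsimp
    fix i assume "i < n" "x' i / (\<theta> * real n) < y"
    moreover have "x i / (\<theta> * real n) \<le> x' i / (\<theta> * real n)"
      using assms \<open>i < n\<close> by (intro divide_right_mono) auto
    ultimately show "x i / (\<theta> * real n) < y" by linarith
  qed
  then show ?thesis using assms(1) by (simp add: measure_emp divide_right_mono card_mono)
qed

lemma Wset_gap:
  assumes "x \<in> Wset n \<theta>" "i \<le> j" "j < n"
  shows "real (j - i) * \<theta> \<le> x i - x j"
proof -
  obtain l :: "nat \<Rightarrow> nat" where l: "\<And>i j. i \<le> j \<Longrightarrow> j < n \<Longrightarrow> l j \<le> l i"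
     "\<And>i. i < n \<Longrightarrow> x i = real (l i) + real (n - 1 - i) * \<theta>"
    using assms(1) unfolding Wset_def by blast
  have "x i - x j = real (l i) - real (l j) + real (j - i) * \<theta>"
    using l(2)[of i] l(2)[of j] assms by (simp add: of_nat_diff algebra_simps)
  then show ?thesis using l(1)[OF assms(2,3)] by simp
qed

text \<open>The origin of the density bound: the indices caught in the interval span at most n (b -
  a) steps because of the spacing, and counting both end indices adds the 1 / n.\<close>

lemma measure_emp_Ioc_le:
  assumes "n \<ge> 1" "\<theta> > 0" "x \<in> Wset n \<theta>" "a \<le> b"
  shows "measure (emp n \<theta> x) {a<..b} \<le> b - a + 1 / real n"
proof -
  define I where "I = {i. i < n \<and> x i / (\<theta> * real n) \<in> {a<..b}}"
  have fin: "finite I" by (simp add: I_def)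
  have "real (card I) / real n \<le> b - a + 1 / real n"
  proof (cases "I = {}")
    case False
    have pq: "Min I \<in> I" "Max I \<in> I" using fin False by auto
    then have le: "Min I \<le> Max I" using fin by simp
    have "card I \<le> card {Min I..Max I}" using fin by (intro card_mono) auto
    then have c: "real (card I) \<le> real (Max I - Min I) + 1" using le by simp
    have "real (Max I - Min I) * \<theta> \<le> x (Min I) - x (Max I)"
      using pq le by (intro Wset_gap[OF assms(3)]) (auto simp: I_def)
    then have "real (Max I - Min I) * \<theta> / (\<theta> * real n) \<le> x (Min I) / (\<theta> * real n) - x (Max I) / (\<theta> * real n)"
      unfolding diff_divide_distrib[symmetric] using assms by (intro divide_right_mono) auto
    also have "\<dots> \<le> b - a" using pq by (auto simp: I_def)
    finally have "real (Max I - Min I) / real n \<le> b - a" using assms by simp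
    moreover have "real (card I) / real n \<le> real (Max I - Min I) / real n + 1 / real n"
      using c assms by (simp add: add_divide_distrib[symmetric] divide_right_mono)
    ultimately show ?thesis by linarith
  qed (use assms in simp)
  then show ?thesis using assms by (simp add: measure_emp I_def)
qed

section \<open>The generator of the walk\<close>

text \<open>Both claims are proved in one induction, because the coefficient of a new node k is the
  product of the first claim evaluated at w = y k. In the second claim the cross terms e / (y k - y
  i) and e / (y i - y k) cancel. The first identity will compute the drift of the walk, the second
  its total jump rate.\<close>

lemma
  fixes y :: "'i \<Rightarrow> 'a::field" and e :: 'a
  assumes "finite I" "inj_on y I"
  shows prod_partial_fractions: "w \<notin> y ` I \<Longrightarrow>
      (\<Prod>i\<in>I. 1 + e / (w - y i)) = 1 + (\<Sum>i\<in>I. (\<Prod>j\<in>I - {i}. 1 + e / (y i - y j)) * (e / (w - y i)))"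
    and sum_partial_fraction_coeffs: "(\<Sum>i\<in>I. \<Prod>j\<in>I - {i}. 1 + e / (y i - y j)) = of_nat (card I)"
proof -
  have "(\<forall>w. w \<notin> y ` I \<longrightarrow>
      (\<Prod>i\<in>I. 1 + e / (w - y i)) = 1 + (\<Sum>i\<in>I. (\<Prod>j\<in>I - {i}. 1 + e / (y i - y j)) * (e / (w - y i))))
     \<and> (\<Sum>i\<in>I. \<Prod>j\<in>I - {i}. 1 + e / (y i - y j)) = of_nat (card I)"
    using assms
  proof (induction I rule: finite_induct)
    case empty
    show ?case by simp
  next
    case (insert k I)
    let ?c = "\<lambda>i. \<Prod>j\<in>I - {i}. 1 + e / (y i - y j)"
    have inj: "inj_on y I" and yk: "y k \<notin> y ` I" using insert.prems insert.hyps by auto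
    have IH1: "(\<Prod>i\<in>I. 1 + e / (w - y i)) = 1 + (\<Sum>i\<in>I. ?c i * (e / (w - y i)))" if "w \<notin> y ` I" for w
      using insert.IH inj that by blast
    have IH2: "(\<Sum>i\<in>I. ?c i) = of_nat (card I)" using insert.IH inj by blast
    have ck: "(\<Prod>j\<in>insert k I - {k}. 1 + e / (y k - y j)) = 1 + (\<Sum>i\<in>I. ?c i * (e / (y k - y i)))"
      using insert.hyps IH1[OF yk] by simp
    have ci: "(\<Prod>j\<in>insert k I - {i}. 1 + e / (y i - y j)) = (1 + e / (y i - y k)) * ?c i" if "i \<in> I" for i
    proof -
      have "insert k I - {i} = insert k (I - {i})" using that insert.hyps by auto
      then show ?thesis using insert.hyps by simp
    qed
    show ?case
    proof (intro conjI allI impI)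
      fix w assume w: "w \<notin> y ` insert k I"
      then have wk: "w - y k \<noteq> 0" and wI: "w \<notin> y ` I" by auto
      \<comment> \<open>Partial fractions for two poles: multiplying by the new factor leaves only
        simple poles.\<close>
      have pf: "e / (w - y k) * (e / (w - y i)) = e / (y k - y i) * (e / (w - y k)) + e / (y i - y k) * (e / (w - y i))"
        if "i \<in> I" for i
      proof -
        have "y k - y i \<noteq> 0" "w - y i \<noteq> 0" using yk wI that by auto
        moreover have "e / p * (e / q) = e / (q - p) * (e / p) + e / (p - q) * (e / q)"
          if "p \<noteq> 0" "q \<noteq> 0" "q - p \<noteq> 0" for p q :: 'a
        proof -
          have eq: "e / (p - q) = - (e / (q - p))" by (metis minus_diff_eq minus_divide_right)
          show ?thesis unfolding eq using that by (simp add: divide_simps) (simp add: algebra_simps)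
        qed
        from this[of "w - y k" "w - y i"] show ?thesis using wk calculation by (simp add: algebra_simps)
      qed
      have expand: "(1 + a) * (1 + (\<Sum>i\<in>I. c i * f i)) = 1 + a + (\<Sum>i\<in>I. c i * f i) + (\<Sum>i\<in>I. c i * (a * f i))"
        for a :: 'a and c f by (simp add: distrib_left distrib_right sum_distrib_left mult.left_commute add.assoc sum.distrib)
      have collect: "1 + a + (\<Sum>i\<in>I. c i * f i) + ((\<Sum>i\<in>I. c i * g i * a) + (\<Sum>i\<in>I. c i * h i * f i))
         = 1 + (1 + (\<Sum>i\<in>I. c i * g i)) * a + (\<Sum>i\<in>I. (1 + h i) * c i * f i)" for a :: 'a and c f g h
        by (simp add: distrib_right sum_distrib_right sum.distrib) (simp add: ac_simps)
      have "(\<Prod>i\<in>insert k I. 1 + e / (w - y i)) = (1 + e / (w - y k)) * (1 + (\<Sum>i\<in>I. ?c i * (e / (w - y i))))"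
        using insert.hyps IH1[OF wI] by simp
      also have "\<dots> = 1 + e / (w - y k) + (\<Sum>i\<in>I. ?c i * (e / (w - y i)))
           + (\<Sum>i\<in>I. ?c i * (e / (w - y k) * (e / (w - y i))))"
        by (rule expand)
      also have "(\<Sum>i\<in>I. ?c i * (e / (w - y k) * (e / (w - y i)))) =
          (\<Sum>i\<in>I. ?c i * (e / (y k - y i)) * (e / (w - y k))) + (\<Sum>i\<in>I. ?c i * (e / (y i - y k)) * (e / (w - y i)))"
        unfolding sum.distrib[symmetric] by (intro sum.cong refl) (simp only: pf distrib_left mult.assoc)
      finally have "(\<Prod>i\<in>insert k I. 1 + e / (w - y i)) =
         1 + (1 + (\<Sum>i\<in>I. ?c i * (e / (y k - y i)))) * (e / (w - y k))
           + (\<Sum>i\<in>I. (1 + e / (y i - y k)) * ?c i * (e / (w - y i)))"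
        by (simp only: collect)
      also have "\<dots> = 1 + (\<Sum>i\<in>insert k I. (\<Prod>j\<in>insert k I - {i}. 1 + e / (y i - y j)) * (e / (w - y i)))"
        unfolding sum.insert[OF insert.hyps] ck by (simp add: ci)
      finally show "(\<Prod>i\<in>insert k I. 1 + e / (w - y i)) =
          1 + (\<Sum>i\<in>insert k I. (\<Prod>j\<in>insert k I - {i}. 1 + e / (y i - y j)) * (e / (w - y i)))" .
    next
      have opp: "e / (y k - y i) = - (e / (y i - y k))" for i by (metis minus_diff_eq minus_divide_right)
      have "(\<Sum>i\<in>insert k I. \<Prod>j\<in>insert k I - {i}. 1 + e / (y i - y j))
          = 1 + (\<Sum>i\<in>I. ?c i * (e / (y k - y i))) + (\<Sum>i\<in>I. (1 + e / (y i - y k)) * ?c i)"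
        unfolding sum.insert[OF insert.hyps] ck by (simp add: ci)
      also have "\<dots> = 1 + (\<Sum>i\<in>I. ?c i)"
        unfolding opp by (simp add: distrib_right sum.distrib sum_negf mult.commute)
      finally show "(\<Sum>i\<in>insert k I. \<Prod>j\<in>insert k I - {i}. 1 + e / (y i - y j)) = of_nat (card (insert k I))"
        using insert.hyps by (simp add: IH2)
    qed
  qed
  then show "w \<notin> y ` I \<Longrightarrow>
      (\<Prod>i\<in>I. 1 + e / (w - y i)) = 1 + (\<Sum>i\<in>I. (\<Prod>j\<in>I - {i}. 1 + e / (y i - y j)) * (e / (w - y i)))"
    and "(\<Sum>i\<in>I. \<Prod>j\<in>I - {i}. 1 + e / (y i - y j)) = of_nat (card I)" by blast+
qed

section \<open>Jump weights, the state space and short-time transitions\<close>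

definition jump :: "(nat \<Rightarrow> real) \<Rightarrow> nat \<Rightarrow> nat \<Rightarrow> real" where
  "jump x i = (\<lambda>j. x j + unit_vec i j)"

definition jump_weight :: "nat \<Rightarrow> real \<Rightarrow> (nat \<Rightarrow> real) \<Rightarrow> nat \<Rightarrow> real" where
  "jump_weight n \<theta> x i = (\<Prod>j\<in>{j. j < n \<and> j \<noteq> i}. (x i - x j + \<theta>) / (x i - x j))"

lemma gen_eq: "gen n \<theta> f x = \<theta> * real n * (\<Sum>i<n. jump_weight n \<theta> x i * (f (jump x i) - f x))"
  by (simp add: gen_def jump_weight_def jump_def)

lemma jump_apply: "jump x i j = (if j = i then x j + 1 else x j)"
  by (simp add: jump_def unit_vec_def)

lemma le_jump: "x \<le> jump x i"
  by (auto simp: le_fun_def jump_apply)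

text \<open>Jumps only increase coordinates, so states not below y never lead to states below y.
  This makes paths monotone later.\<close>

lemma gen_vanishes:
  assumes "\<And>x. \<not> x \<le> y \<Longrightarrow> f x = 0" and "\<not> x \<le> y"
  shows "((gen n \<theta> ^^ k) f) x = 0"
  using assms(2)
proof (induction k arbitrary: x)
  case (Suc k)
  have "\<not> jump x i \<le> y" for i using Suc.prems le_jump order_trans by blast
  then show ?case using Suc by (simp add: gen_eq)
qed (use assms in simp)

context
  fixes n :: nat and \<theta> :: real
  assumes n: "n \<ge> 1" and \<theta>: "\<theta> > 0"
begin

lemma Wset_inj: "x \<in> Wset n \<theta> \<Longrightarrow> inj_on x {..<n}"
proof (rule linorder_inj_onI)
  fix i j assume x: "x \<in> Wset n \<theta>" and ij: "i < j" "i \<in> {..<n}" "j \<in> {..<n}"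
  then have "real (j - i) * \<theta> \<le> x i - x j" by (intro Wset_gap) auto
  moreover have "real (j - i) * \<theta> > 0" using ij \<theta> by simp
  ultimately have "x i - x j > 0" by linarith
  then show "x i \<noteq> x j" by simp
qed auto

lemma jump_weight_eq:
  assumes "x \<in> Wset n \<theta>" "i < n"
  shows "jump_weight n \<theta> x i = (\<Prod>j\<in>{..<n} - {i}. 1 + \<theta> / (x i - x j))"
  unfolding jump_weight_def
proof (rule prod.cong)
  fix j assume "j \<in> {..<n} - {i}"
  then have "x i \<noteq> x j" using Wset_inj[OF assms(1)] assms(2) by (auto dest: inj_onD)
  then show "(x i - x j + \<theta>) / (x i - x j) = 1 + \<theta> / (x i - x j)" by (simp add: add_divide_distrib)
qed auto

lemma sum_jump_weight: "x \<in> Wset n \<theta> \<Longrightarrow> (\<Sum>i<n. jump_weight n \<theta> x i) = real n"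
  using sum_partial_fraction_coeffs[OF _ Wset_inj, of x \<theta>] by (simp add: jump_weight_eq)

text \<open>For i < j numerator and denominator are nonnegative. For j < i the gap is at least
  \<theta>, so both are nonpositive.\<close>

lemma jump_weight_nonneg:
  assumes "x \<in> Wset n \<theta>" "i < n"
  shows "jump_weight n \<theta> x i \<ge> 0"
  unfolding jump_weight_def
proof (rule prod_nonneg)
  fix j assume j: "j \<in> {j. j < n \<and> j \<noteq> i}"
  show "0 \<le> (x i - x j + \<theta>) / (x i - x j)"
  proof (cases "i < j")
    case True
    then have "real (j - i) * \<theta> \<le> x i - x j" using assms j by (intro Wset_gap) auto
    moreover have "real (j - i) * \<theta> \<ge> 0" using \<theta> by simp
    ultimately show ?thesis using \<theta> by (intro divide_nonneg_nonneg) linarith+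
  next
    case False
    then have "real (i - j) * \<theta> \<le> x j - x i" using assms j by (intro Wset_gap) auto
    moreover have "1 * \<theta> \<le> real (i - j) * \<theta>" using False j \<theta> by (intro mult_right_mono) auto
    ultimately have "x i - x j + \<theta> \<le> 0" "x i - x j \<le> 0" using \<theta> by linarith+
    then show ?thesis by (rule divide_nonpos_nonpos)
  qed
qed

text \<open>A jump leaving the state space has weight \<open>0\<close>: it would violate the gap condition
  with the neighbour above, and the corresponding factor vanishes.\<close>
lemma jump_in_Wset:
  assumes "x \<in> Wset n \<theta>" "i < n" "jump_weight n \<theta> x i \<noteq> 0"
  shows "jump x i \<in> Wset n \<theta>"
proof -
  obtain l :: "nat \<Rightarrow> nat" where l: "\<And>i j. i \<le> j \<Longrightarrow> j < n \<Longrightarrow> l j \<le> l i"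
     "\<And>i. i < n \<Longrightarrow> x i = real (l i) + real (n - 1 - i) * \<theta>" "\<And>i. n \<le> i \<Longrightarrow> x i = 0"
    using assms(1) unfolding Wset_def by blast
  have less: "Suc (l i) \<le> l k" if "k < i" for k
  proof (rule ccontr)
    assume neg: "\<not> Suc (l i) \<le> l k"
    have i1: "i - 1 < n" "i - 1 \<noteq> i" "k \<le> i - 1" "i - 1 \<le> i" using that assms(2) by auto
    have "l (i - 1) \<le> l k" "l i \<le> l (i - 1)" using l(1) i1 assms(2) by auto
    with neg have "l (i - 1) = l i" by simp
    moreover have "n - 1 - (i - 1) = Suc (n - 1 - i)" using that assms(2) by simp
    ultimately have "x i - x (i - 1) + \<theta> = 0"
      using l(2)[OF assms(2)] l(2)[OF i1(1)] by (simp add: algebra_simps)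
    then have "jump_weight n \<theta> x i = 0"
      unfolding jump_weight_def using i1 by (intro prod_zero bexI[of _ "i - 1"]) auto
    with assms(3) show False by simp
  qed
  have "(l(i := Suc (l i))) q \<le> (l(i := Suc (l i))) p" if "p \<le> q" "q < n" for p q
    using that l(1)[OF that] less[of p] by (auto simp: le_Suc_eq)
  moreover have "jump x i p = real ((l(i := Suc (l i))) p) + real (n - 1 - p) * \<theta>" if "p < n" for p
    using l(2)[OF that] by (auto simp: jump_apply)
  moreover have "jump x i p = 0" if "n \<le> p" for p using l(3)[OF that] that assms(2) by (auto simp: jump_apply)
  ultimately show ?thesis unfolding Wset_def by blast
qed

text \<open>Jumps out of the state space have weight 0, so a bound on \<open>Wset\<close> is enough.
  The total rate is \<theta> n^2, and each jump changes f by at most 2 B.\<close>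

lemma abs_gen_le:
  assumes f: "\<And>y. y \<in> Wset n \<theta> \<Longrightarrow> \<bar>f y\<bar> \<le> B" and x: "x \<in> Wset n \<theta>"
  shows "\<bar>gen n \<theta> f x\<bar> \<le> 2 * \<theta> * (real n)\<^sup>2 * B"
proof -
  have "\<bar>\<Sum>i<n. jump_weight n \<theta> x i * (f (jump x i) - f x)\<bar> \<le> (\<Sum>i<n. jump_weight n \<theta> x i * (2 * B))"
  proof (rule order_trans[OF sum_abs sum_mono])
    fix i assume "i \<in> {..<n}"
    then have i: "i < n" by simp
    show "\<bar>jump_weight n \<theta> x i * (f (jump x i) - f x)\<bar> \<le> jump_weight n \<theta> x i * (2 * B)"
    proof (cases "jump_weight n \<theta> x i = 0")
      case False
      have "\<bar>f (jump x i) - f x\<bar> \<le> 2 * B"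
        using f[OF x] f[OF jump_in_Wset[OF x i False]] by linarith
      then show ?thesis using jump_weight_nonneg[OF x i] by (simp add: abs_mult mult_left_mono)
    qed simp
  qed
  also have "\<dots> = real n * (2 * B)" unfolding sum_distrib_right[symmetric] sum_jump_weight[OF x] ..
  finally have "\<theta> * real n * \<bar>\<Sum>i<n. jump_weight n \<theta> x i * (f (jump x i) - f x)\<bar> \<le> \<theta> * real n * (real n * (2 * B))"
    using \<theta> by (intro mult_left_mono) auto
  then show ?thesis using \<theta> by (simp add: gen_eq abs_mult power2_eq_square algebra_simps)
qed

lemma abs_gen_power_le:
  assumes f: "\<And>y. y \<in> Wset n \<theta> \<Longrightarrow> \<bar>f y\<bar> \<le> 1" and x: "x \<in> Wset n \<theta>"
  shows "\<bar>((gen n \<theta> ^^ k) f) x\<bar> \<le> (2 * \<theta> * (real n)\<^sup>2) ^ k"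
  using x
proof (induction k arbitrary: x)
  case (Suc k)
  from abs_gen_le[OF Suc.IH Suc.prems] show ?case by simp
qed (use f in simp)

text \<open>Each generator power costs at most a factor \<Lambda>, so the exponential series beyond
  its linear part is dominated by t^2 times that of exp \<Lambda>. The constant is enormous in n,
  but t^2 makes it vanish when the time step shrinks.\<close>

lemma trans_sg_approx:
  assumes f: "\<And>y. y \<in> Wset n \<theta> \<Longrightarrow> \<bar>f y\<bar> \<le> 1" and x: "x \<in> Wset n \<theta>" and t: "0 \<le> t" "t \<le> 1"
  defines "\<Lambda> \<equiv> 2 * \<theta> * (real n)\<^sup>2"
  shows "\<bar>trans_sg n \<theta> t f x - (f x + t * gen n \<theta> f x)\<bar> \<le> \<Lambda>\<^sup>2 * exp \<Lambda> * t\<^sup>2"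
proof -
  have \<Lambda>: "\<Lambda> \<ge> 0" using \<theta> by (simp add: \<Lambda>_def)
  define a where "a k = t ^ k / fact k * ((gen n \<theta> ^^ k) f) x" for k
  have bd: "\<bar>a k\<bar> \<le> (\<Lambda> * t) ^ k / fact k" for k
    using mult_left_mono[OF abs_gen_power_le[OF f x, where k = k], where c = "t ^ k / fact k"] t
    by (simp add: a_def abs_mult \<Lambda>_def power_mult_distrib mult.commute)
  have se: "(\<lambda>k. u ^ k / fact k) sums exp u" for u :: real
    using exp_converges[of u] by (simp add: divide_inverse mult.commute)
  have sa: "summable a"
    by (rule summable_comparison_test'[OF sums_summable[OF se[of "\<Lambda> * t"]], of 0]) (use bd in simp)
  have bd2: "\<bar>a (k + 2)\<bar> \<le> \<Lambda>\<^sup>2 * t\<^sup>2 * (\<Lambda> ^ k / fact k)" for k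
  proof -
    have "\<bar>a (k + 2)\<bar> \<le> (\<Lambda> * t) ^ (k + 2) / fact (k + 2)" by (rule bd)
    also have "\<dots> \<le> (\<Lambda> * t) ^ (k + 2) / fact k"
      using \<Lambda> t by (intro divide_left_mono fact_mono) (auto simp del: fact_Suc)
    also have "\<dots> = \<Lambda>\<^sup>2 * t\<^sup>2 * (\<Lambda> ^ k / fact k) * t ^ k"
      by (simp add: power_mult_distrib power_add power2_eq_square)
    also have "\<dots> \<le> \<Lambda>\<^sup>2 * t\<^sup>2 * (\<Lambda> ^ k / fact k)"
      using \<Lambda> t by (intro mult_left_le power_le_one) auto
    finally show ?thesis .
  qed
  have s2: "(\<lambda>k. \<Lambda>\<^sup>2 * t\<^sup>2 * (\<Lambda> ^ k / fact k)) sums (\<Lambda>\<^sup>2 * t\<^sup>2 * exp \<Lambda>)"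
    by (intro sums_mult se)
  have sabs: "summable (\<lambda>k. \<bar>a (k + 2)\<bar>)"
    by (rule summable_comparison_test'[OF sums_summable[OF s2], of 0]) (use bd2 in simp)
  have "trans_sg n \<theta> t f x = (\<Sum>k. a (k + 2)) + (\<Sum>k<2. a k)"
    unfolding trans_sg_def a_def[symmetric] by (rule suminf_split_initial_segment[OF sa])
  also have "(\<Sum>k<2. a k) = f x + t * gen n \<theta> f x"
    by (simp add: a_def numeral_2_eq_2)
  finally have "\<bar>trans_sg n \<theta> t f x - (f x + t * gen n \<theta> f x)\<bar> = \<bar>\<Sum>k. a (k + 2)\<bar>" by simp
  also have "\<dots> \<le> (\<Sum>k. \<bar>a (k + 2)\<bar>)" by (rule summable_rabs[OF sabs])
  also have "\<dots> \<le> \<Lambda>\<^sup>2 * t\<^sup>2 * exp \<Lambda>"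
    using suminf_le[OF bd2 sabs sums_summable[OF s2]] sums_unique[OF s2] by simp
  finally show ?thesis by (simp add: algebra_simps)
qed

text \<open>The product of \<open>prod_partial_fractions\<close> in rescaled variables: each factor
  is 1 + \<theta> / (\<theta> n w - x j). To leading order it is exp (- m(w)).\<close>

definition emp_prod :: "(nat \<Rightarrow> real) \<Rightarrow> complex \<Rightarrow> complex" where
  "emp_prod x w = (\<Prod>j<n. 1 + 1 / (of_nat n * (w - complex_of_real (x j / (\<theta> * real n)))))"

text \<open>Moving a particle up by 1 is written as moving the rescaled argument \<theta> n w down
  by 1, so that partial fractions can be applied at two arguments with the same nodes.\<close>

lemma stieltjes_jump:
  assumes "i < n" "Im w \<noteq> 0"
  shows "stieltjes (emp n \<theta> (jump x i)) w - stieltjes (emp n \<theta> x) w =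
     complex_of_real \<theta> / (of_real (x i) - (of_real (\<theta> * real n) * w - 1)) - of_real \<theta> / (of_real (x i) - of_real (\<theta> * real n) * w)"
proof -
  let ?g = "\<lambda>y. 1 / (complex_of_real (y / (\<theta> * real n)) - w)"
  have "(\<Sum>j<n. ?g (jump x i j)) - (\<Sum>j<n. ?g (x j)) = (\<Sum>j<n. if j = i then ?g (x i + 1) - ?g (x i) else 0)"
    unfolding sum_subtractf[symmetric] by (intro sum.cong) (auto simp: jump_apply)
  also have "\<dots> = ?g (x i + 1) - ?g (x i)" using assms by simp
  finally have "stieltjes (emp n \<theta> (jump x i)) w - stieltjes (emp n \<theta> x) w = (?g (x i + 1) - ?g (x i)) / of_nat n"
    by (simp add: stieltjes_emp[OF n] diff_divide_distrib[symmetric])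
  moreover have "?g y / of_nat n = of_real \<theta> / (of_real y - of_real (\<theta> * real n) * w)" for y
  proof -
    have "complex_of_real (\<theta> * real n) \<noteq> 0" using n \<theta> by simp
    moreover have "complex_of_real (y / (\<theta> * real n)) - w = (of_real y - of_real (\<theta> * real n) * w) / of_real (\<theta> * real n)"
      using calculation by (simp add: diff_divide_distrib del: of_real_mult)
    ultimately show ?thesis using n \<theta> by (simp add: divide_simps)
  qed
  ultimately have "stieltjes (emp n \<theta> (jump x i)) w - stieltjes (emp n \<theta> x) w =
      of_real \<theta> / (of_real (x i + 1) - of_real (\<theta> * real n) * w) - of_real \<theta> / (of_real (x i) - of_real (\<theta> * real n) * w)"
    by (simp only: diff_divide_distrib)
  then show ?thesis by (simp only: of_real_add of_real_1 diff_diff_eq2)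
qed

text \<open>Both denominators have norm at least \<theta> n and differ by 1. Squared and multiplied
  by the total rate \<theta> n^2, this gives a quadratic variation of at most 1 / (\<theta> n^2) per
  unit time.\<close>

lemma norm_stieltjes_jump_le:
  assumes "i < n" "Im w \<ge> 1"
  shows "norm (stieltjes (emp n \<theta> (jump x i)) w - stieltjes (emp n \<theta> x) w) \<le> 1 / (\<theta> * (real n)\<^sup>2)"
proof -
  let ?W = "complex_of_real (\<theta> * real n) * w"
  have c: "\<theta> * real n > 0" using n \<theta> by simp
  have imW: "Im ?W = \<theta> * real n * Im w" by simp
  have ge: "\<theta> * real n \<le> \<theta> * real n * Im w"
    using mult_left_mono[OF assms(2), of "\<theta> * real n"] c by simp
  have a: "norm (complex_of_real (x i) - (?W - 1)) \<ge> \<theta> * real n" (is "norm ?a \<ge> _")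
    using Im_le_norm_of_real_diff[of "?W - 1" "x i"] imW ge c by simp
  have b: "norm (complex_of_real (x i) - ?W) \<ge> \<theta> * real n" (is "norm ?b \<ge> _")
    using Im_le_norm_of_real_diff[of "?W" "x i"] imW ge c by simp
  have nz: "?a \<noteq> 0" "?b \<noteq> 0" using a b c by auto
  have ab: "?b - ?a = - 1" by simp
  have "complex_of_real \<theta> / ?a - of_real \<theta> / ?b = of_real \<theta> * (?b - ?a) / (?a * ?b)"
    using nz by (simp add: diff_frac_eq algebra_simps)
  also have "norm \<dots> = \<theta> / (norm ?a * norm ?b)" unfolding ab using \<theta> by (simp add: norm_divide norm_mult)
  also have "\<dots> \<le> \<theta> / ((\<theta> * real n) * (\<theta> * real n))"
  proof (rule divide_left_mono)
    show "\<theta> * real n * (\<theta> * real n) \<le> norm ?a * norm ?b"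
      by (rule mult_mono[OF a b]) (use c in auto)
    show "0 < norm ?a * norm ?b * (\<theta> * real n * (\<theta> * real n))"
      using nz mult_pos_pos[OF c c] by (intro mult_pos_pos[of "norm ?a * norm ?b"]) auto
  qed (use \<theta> in simp)
  also have "\<dots> = 1 / (\<theta> * (real n)\<^sup>2)" using \<theta> by (simp add: power2_eq_square)
  finally show ?thesis using stieltjes_jump[OF assms(1), of w x] assms(2) by simp
qed

text \<open>Partial fractions at \<theta> n w and \<theta> n w - 1; the constant terms 1 cancel in
  the difference.\<close>

lemma drift_eq:
  assumes x: "x \<in> Wset n \<theta>" and w: "Im w > 0"
  shows "(\<Sum>i<n. complex_of_real (jump_weight n \<theta> x i) * (stieltjes (emp n \<theta> (jump x i)) w - stieltjes (emp n \<theta> x) w))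
     = emp_prod x w - emp_prod x (w - 1 / of_real (\<theta> * real n))"
proof -
  let ?W = "complex_of_real (\<theta> * real n) * w"
  let ?y = "\<lambda>i. complex_of_real (x i)"
  have c: "\<theta> * real n > 0" using n \<theta> by simp
  then have c': "complex_of_real (\<theta> * real n) \<noteq> 0" unfolding of_real_eq_0_iff by linarith
  have inj: "inj_on ?y {..<n}" using Wset_inj[OF x] by (auto simp: inj_on_def)
  have im: "Im ?W > 0" using c w by simp
  then have W: "?W \<notin> ?y ` {..<n}" "?W - 1 \<notin> ?y ` {..<n}" by (auto simp: complex_eq_iff)
  have prodeq: "emp_prod x v = (\<Prod>j<n. 1 + of_real \<theta> / (of_real (\<theta> * real n) * v - ?y j))" for v
    unfolding emp_prod_def
  proof (intro prod.cong refl arg_cong2[where f = "(+)"])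
    fix j
    have "complex_of_real (\<theta> * real n) * (v - complex_of_real (x j / (\<theta> * real n))) = of_real (\<theta> * real n) * v - ?y j"
      using c' by (simp add: right_diff_distrib)
    then have "of_real \<theta> / (of_real (\<theta> * real n) * v - ?y j) =
        of_real \<theta> / (complex_of_real \<theta> * (of_nat n * (v - complex_of_real (x j / (\<theta> * real n)))))"
      by (simp add: mult.assoc)
    then show "1 / (of_nat n * (v - complex_of_real (x j / (\<theta> * real n)))) = of_real \<theta> / (of_real (\<theta> * real n) * v - ?y j)"
      using \<theta> by simp
  qed
  have jw: "complex_of_real (jump_weight n \<theta> x i) = (\<Prod>j\<in>{..<n} - {i}. 1 + of_real \<theta> / (?y i - ?y j))" if "i < n" for i
    using jump_weight_eq[OF x that] by simp
  have pf: "(\<Prod>i<n. 1 + of_real \<theta> / (v - ?y i)) = 1 + (\<Sum>i<n. of_real (jump_weight n \<theta> x i) * (of_real \<theta> / (v - ?y i)))"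
    if "v \<notin> ?y ` {..<n}" for v
    using prod_partial_fractions[OF _ inj that, of "of_real \<theta>"] by (simp add: jw)
  have "(\<Sum>i<n. complex_of_real (jump_weight n \<theta> x i) * (stieltjes (emp n \<theta> (jump x i)) w - stieltjes (emp n \<theta> x) w))
    = (\<Sum>i<n. of_real (jump_weight n \<theta> x i) * (of_real \<theta> / (?W - ?y i)) - of_real (jump_weight n \<theta> x i) * (of_real \<theta> / (?W - 1 - ?y i)))"
  proof (intro sum.cong refl)
    fix i assume i: "i \<in> {..<n}"
    have neg: "a / (b - c) = - (a / (c - b))" for a b c :: complex by (metis minus_diff_eq minus_divide_right)
    have "stieltjes (emp n \<theta> (jump x i)) w - stieltjes (emp n \<theta> x) w =
        of_real \<theta> / (?W - ?y i) - of_real \<theta> / (?W - 1 - ?y i)"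
      using stieltjes_jump[of i w x] i w neg[of "of_real \<theta>" "?y i" "?W"] neg[of "of_real \<theta>" "?y i" "?W - 1"] by simp
    then show "complex_of_real (jump_weight n \<theta> x i) * (stieltjes (emp n \<theta> (jump x i)) w - stieltjes (emp n \<theta> x) w)
      = of_real (jump_weight n \<theta> x i) * (of_real \<theta> / (?W - ?y i)) - of_real (jump_weight n \<theta> x i) * (of_real \<theta> / (?W - 1 - ?y i))"
      by (simp add: right_diff_distrib)
  qed
  also have "\<dots> = (\<Prod>i<n. 1 + of_real \<theta> / (?W - ?y i)) - (\<Prod>i<n. 1 + of_real \<theta> / (?W - 1 - ?y i))"
    unfolding pf[OF W(1)] pf[OF W(2)] by (simp add: sum_subtractf)
  also have "?W - 1 = of_real (\<theta> * real n) * (w - 1 / of_real (\<theta> * real n))"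
    using c' by (simp add: right_diff_distrib)
  finally show ?thesis by (simp only: prodeq)
qed

end

section \<open>The drift of the empirical Stieltjes transform\<close>

text \<open>With N steps of length T / N the quadratic errors add up to K T^2 / N, which tends to 0.
  Hence K is absent from the conclusion and may be any constant. No regularity of y in time
  enters.\<close>

lemma discrete_gronwall:
  fixes y :: "real \<Rightarrow> real"
  assumes "A \<ge> 0" "B \<ge> 0" "K \<ge> 0" "T \<ge> 0"
    and nonneg: "\<And>t. 0 \<le> t \<Longrightarrow> t \<le> T \<Longrightarrow> y t \<ge> 0"
    and step: "\<And>t h. 0 \<le> t \<Longrightarrow> 0 \<le> h \<Longrightarrow> h \<le> 1 \<Longrightarrow> t + h \<le> T \<Longrightarrow> y (t + h) \<le> (1 + A * h) * y t + B * h + K * h\<^sup>2"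
  shows "y T \<le> exp (A * T) * (y 0 + B * T)"
proof -
  have main: "y T \<le> exp (A * T) * (y 0 + B * T + K * T\<^sup>2 * (1 / real N))" if N: "N \<ge> 1" "real N \<ge> T" for N :: nat
  proof -
    define h where "h = T / real N"
    have h: "0 \<le> h" "h \<le> 1" "real N * h = T" using N \<open>T \<ge> 0\<close> by (auto simp: h_def divide_simps)
    have "y (real k * h) \<le> exp (A * (real k * h)) * (y 0 + real k * (B * h + K * h\<^sup>2))" if "k \<le> N" for k
      using that
    proof (induction k)
      case (Suc k)
      let ?R = "B * h + K * h\<^sup>2"
      have R: "?R \<ge> 0" using assms h by simp
      have le: "real (Suc k) * h \<le> T" unfolding h(3)[symmetric] using Suc.prems h(1) by (intro mult_right_mono) auto
      have Skh: "real (Suc k) * h = real k * h + h" by (simp add: algebra_simps)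
      have ex: "exp (A * (real (Suc k) * h)) = exp (A * h) * exp (A * (real k * h))"
        unfolding exp_add[symmetric] by (simp add: algebra_simps)
      have "y (real k * h + h) \<le> (1 + A * h) * y (real k * h) + B * h + K * h\<^sup>2"
        using h(1,2) le[unfolded Skh] by (intro step) auto
      also have "(1 + A * h) * y (real k * h) \<le> exp (A * h) * (exp (A * (real k * h)) * (y 0 + real k * ?R))"
        using Suc h le Skh assms(1) by (intro mult_mono nonneg exp_ge_add_one_self) (auto simp: mult_nonneg_nonneg)
      also have "\<dots> = exp (A * (real (Suc k) * h)) * (y 0 + real k * ?R)"
        unfolding ex by (simp only: mult.assoc)
      finally have "y (real (Suc k) * h) \<le> exp (A * (real (Suc k) * h)) * (y 0 + real k * ?R) + 1 * ?R"
        by (simp only: Skh mult_1 add.assoc)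
      also have "1 * ?R \<le> exp (A * (real (Suc k) * h)) * ?R"
        using R h assms(1) by (intro mult_right_mono) auto
      finally show ?case by (simp add: algebra_simps)
    qed simp
    from this[of N] have "y T \<le> exp (A * T) * (y 0 + real N * (B * h + K * h\<^sup>2))" by (simp add: h(3))
    also have "real N * (B * h + K * h\<^sup>2) = B * T + K * T\<^sup>2 * (1 / real N)"
      using N by (simp add: h_def power2_eq_square field_simps)
    finally show ?thesis by (simp add: add.assoc)
  qed
  have "(\<lambda>N. exp (A * T) * (y 0 + B * T + K * T\<^sup>2 * (1 / real N))) \<longlonglongrightarrow> exp (A * T) * (y 0 + B * T + K * T\<^sup>2 * 0)"
    by (intro tendsto_intros lim_1_over_n)
  moreover obtain N0 :: nat where "real N0 \<ge> T" using real_arch_simple by blast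
  then have "eventually (\<lambda>N. y T \<le> exp (A * T) * (y 0 + B * T + K * T\<^sup>2 * (1 / real N))) sequentially"
    using main by (intro eventually_sequentiallyI[of "max 1 N0"]) (auto intro: order_trans)
  ultimately have "y T \<le> exp (A * T) * (y 0 + B * T + K * T\<^sup>2 * 0)"
    by (rule tendsto_lowerbound) simp
  then show ?thesis by simp
qed

text \<open>The telescoping bound \<open>norm_prod_diff\<close> concerns factors in the unit disc;
  dividing every factor by M reduces to it.\<close>

lemma norm_prod_diff_scaled:
  fixes a b :: "'i \<Rightarrow> complex"
  assumes "finite I" "M > 0" "\<And>i. i \<in> I \<Longrightarrow> norm (a i) \<le> M" "\<And>i. i \<in> I \<Longrightarrow> norm (b i) \<le> M"
    and "\<And>i. i \<in> I \<Longrightarrow> norm (a i - b i) \<le> d" "M \<ge> 1"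
  shows "norm (prod a I - prod b I) \<le> M ^ card I * (real (card I) * d)"
proof -
  let ?M = "complex_of_real M"
  have M: "?M \<noteq> 0" using assms by simp
  have "prod a I - prod b I = ?M ^ card I * ((\<Prod>i\<in>I. a i / ?M) - (\<Prod>i\<in>I. b i / ?M))"
    using M by (simp add: prod_dividef right_diff_distrib)
  then have "norm (prod a I - prod b I) = M ^ card I * norm ((\<Prod>i\<in>I. a i / ?M) - (\<Prod>i\<in>I. b i / ?M))"
    using assms by (simp add: norm_mult norm_power)
  also have "\<dots> \<le> M ^ card I * (\<Sum>i\<in>I. norm (a i / ?M - b i / ?M))"
    using assms by (intro mult_left_mono norm_prod_diff) (auto simp: norm_divide)
  also have "(\<Sum>i\<in>I. norm (a i / ?M - b i / ?M)) \<le> (\<Sum>i\<in>I. d)"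
  proof (rule sum_mono)
    fix i assume i: "i \<in> I"
    have "norm (a i / ?M - b i / ?M) = norm (a i - b i) / M"
      using assms by (simp add: diff_divide_distrib[symmetric] norm_divide)
    also have "\<dots> \<le> norm (a i - b i) / 1" using assms by (intro divide_left_mono) auto
    finally show "norm (a i / ?M - b i / ?M) \<le> d" using assms(5)[OF i] by simp
  qed
  finally show ?thesis using assms by (simp add: mult_left_mono)
qed

lemma (in real_distribution) norm_stieltjes_le_1: "Im w \<ge> 1 \<Longrightarrow> norm (stieltjes M w) \<le> 1"
  using norm_stieltjes_le_of_Im[of 1 w] by simp

lemma (in real_distribution) norm_stieltjes'_le_1: "Im w \<ge> 1 \<Longrightarrow> norm (stieltjes' M w) \<le> 1"
  using norm_stieltjes'_le_of_Im[of 1 w] by simp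

lemma (in real_distribution) norm_stieltjes_le_2: "Im w \<ge> 1 / 2 \<Longrightarrow> norm (stieltjes M w) \<le> 2"
  using norm_stieltjes_le_of_Im[of "1/2" w] by simp

lemma (in real_distribution) holomorphic_exp_stieltjes:
  "(\<lambda>w. exp (- stieltjes M w)) holomorphic_on {w. Im w > 0}"
  by (intro holomorphic_intros holomorphic_stieltjes)

lemma (in real_distribution) DERIV_exp_stieltjes:
  assumes "Im w \<noteq> 0"
  shows "((\<lambda>w. exp (- stieltjes M w)) has_field_derivative - (exp (- stieltjes M w) * stieltjes' M w)) (at w)"
  using DERIV_stieltjes[OF assms] by (auto intro!: derivative_eq_intros)

text \<open>One step along a line of frozen speed c = exp (- a), for a fixed measure. Moving the
  argument adds h c m', the equation removes h exp (- m) m', and what remains is controlled by |m -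
  a|. Of the 18 h^2, half is the Taylor remainder and half comes from moving m in the exponent. The
  step serves both the walk and the limit equation.\<close>

lemma (in real_distribution) stieltjes_step:
  assumes w: "Im w \<ge> 1" "Im (w + of_real h * c) \<ge> 1" and h: "0 \<le> h"
    and a: "norm a \<le> 1" "c = exp (- a)"
  defines "w' \<equiv> w + of_real h * c"
  shows "norm (stieltjes M w' - a - of_real h * (exp (- stieltjes M w') * stieltjes' M w'))
     \<le> (1 + 3 * h) * norm (stieltjes M w - a) + 18 * h\<^sup>2"
proof -
  let ?s = "stieltjes M w - a"
  have c: "norm c \<le> 3" using norm_exp_uminus_le_3[OF a(1)] a(2) by simp
  have d: "norm (w' - w) \<le> 3 * h" using c h by (simp add: w'_def norm_mult mult.commute mult_left_mono)
  have im: "Im w \<noteq> 0" "Im w' \<noteq> 0" "Im w' \<ge> 1" using w by (auto simp: w'_def)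
  have im1: "\<bar>Im w\<bar> * \<bar>Im w'\<bar>\<^sup>2 \<ge> 1" "\<bar>Im w'\<bar> * \<bar>Im w\<bar> \<ge> 1"
    using w im mult_mono[of 1 "Im w" 1 "(Im w')\<^sup>2"] mult_mono[of 1 "Im w'" 1 "Im w"] by auto
  define r where "r = stieltjes M w - stieltjes M w' - stieltjes' M w' * (w - w')"
  have "norm r \<le> norm (w - w')^2 / (\<bar>Im w\<bar> * \<bar>Im w'\<bar>\<^sup>2)"
    unfolding r_def by (rule stieltjes_taylor) (use im in auto)
  also have "\<dots> \<le> norm (w - w')^2 / 1" using im1 by (intro divide_left_mono) auto
  also have "\<dots> \<le> (3 * h)^2" using power_mono[OF d, of 2] by (simp add: norm_minus_commute)
  finally have r: "norm r \<le> 9 * h\<^sup>2" by (simp add: power_mult_distrib)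
  have "norm (stieltjes M w' - stieltjes M w) \<le> norm (w' - w) / (\<bar>Im w'\<bar> * \<bar>Im w\<bar>)"
    by (rule stieltjes_lipschitz) (use im in auto)
  also have "\<dots> \<le> norm (w' - w) / 1" using im1 by (intro divide_left_mono) auto
  finally have lip: "norm (stieltjes M w' - stieltjes M w) \<le> 3 * h" using d by simp
  have "norm (c - exp (- stieltjes M w')) \<le> 3 * norm (a - stieltjes M w')"
    unfolding a(2) using a(1) norm_stieltjes_le_1[OF im(3)] by (rule norm_exp_uminus_diff_le_3)
  also have "norm (a - stieltjes M w') \<le> norm ?s + 3 * h"
    using norm_triangle_ineq[of ?s "stieltjes M w' - stieltjes M w"] lip by (simp add: norm_minus_commute)
  finally have ce: "norm (c - exp (- stieltjes M w')) \<le> 3 * (norm ?s + 3 * h)" by simp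
  have "stieltjes M w' - a - of_real h * (exp (- stieltjes M w') * stieltjes' M w')
      = ?s + of_real h * ((c - exp (- stieltjes M w')) * stieltjes' M w') + (- r)"
    by (simp add: r_def w'_def algebra_simps)
  also have "norm \<dots> \<le> norm ?s + norm (of_real h * ((c - exp (- stieltjes M w')) * stieltjes' M w')) + norm (- r)"
    by (intro norm_triangle_le add_mono norm_triangle_ineq order_refl)
  also have "norm (of_real h * ((c - exp (- stieltjes M w')) * stieltjes' M w')) \<le> h * (3 * (norm ?s + 3 * h) * 1)"
    unfolding norm_mult using h ce norm_stieltjes'_le_1[OF im(3)]
    by (intro mult_mono mult_nonneg_nonneg) auto
  finally show ?thesis using r by (simp add: algebra_simps power2_eq_square)
qed

lemma norm_add_scaled_sq_expand:
  fixes q :: complex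
  shows "(norm (q + d))\<^sup>2 - (norm q)\<^sup>2 = 2 * (q \<bullet> d) + (norm d)\<^sup>2"
  by (simp add: power2_norm_eq_inner inner_add_left inner_add_right inner_commute)

text \<open>The cross term 2 u D is split into u^2 + D^2, so that D enters squared and contributes
  order 1 / n^2 when D is of order 1 / n. The constants are 19 = 15 + 4, 6 = 4 + 2 and 936 = 288 +
  648.\<close>

lemma square_step_le:
  fixes u h D r s :: real
  assumes u: "0 \<le> u" "u \<le> 2" and h: "0 \<le> h" "h \<le> 1" and D: "D \<ge> 0"
    and r: "0 \<le> r" "r \<le> (1 + 3 * h) * u + 18 * h\<^sup>2 + h * D"
  shows "r\<^sup>2 \<le> (1 + 19 * h) * u\<^sup>2 + 6 * D\<^sup>2 * h + 936 * h\<^sup>2"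
proof -
  have hh: "h\<^sup>2 \<le> h" "0 \<le> h\<^sup>2" using h by (auto simp: power2_eq_square mult_left_le)
  have "r\<^sup>2 \<le> ((1 + 3 * h) * u + 18 * h\<^sup>2 + h * D)\<^sup>2" using r by (intro power_mono) auto
  also have "\<dots> = (1 + 6 * h + 9 * h\<^sup>2) * u\<^sup>2 + (1 + 3 * h) * h * (2 * u * D) + 36 * h\<^sup>2 * ((1 + 3 * h) * u)
      + (18 * h\<^sup>2 + h * D)\<^sup>2"
    by (simp add: power2_eq_square algebra_simps)
  also have "(1 + 6 * h + 9 * h\<^sup>2) * u\<^sup>2 \<le> (1 + 15 * h) * u\<^sup>2" using hh by (intro mult_right_mono) auto
  also have "(1 + 3 * h) * h * (2 * u * D) \<le> 4 * h * (u\<^sup>2 + D\<^sup>2)"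
    using h u D sum_squares_bound[of u D] by (intro mult_mono) auto
  also have "36 * h\<^sup>2 * ((1 + 3 * h) * u) \<le> 36 * h\<^sup>2 * (4 * 2)"
    using h u by (intro mult_left_mono mult_mono) auto
  also have "(18 * h\<^sup>2 + h * D)\<^sup>2 \<le> 2 * (18 * h\<^sup>2)\<^sup>2 + 2 * (h * D)\<^sup>2"
    using sum_squares_bound[of "18 * h\<^sup>2" "h * D"] by (simp add: power2_sum)
  also have "2 * (18 * h\<^sup>2)\<^sup>2 \<le> 648 * h\<^sup>2"
    using mult_mono[of "h\<^sup>2" 1 "h\<^sup>2" "h\<^sup>2"] hh h by (simp add: power2_eq_square)
  also have "2 * (h * D)\<^sup>2 \<le> 2 * h * D\<^sup>2"
    unfolding power_mult_distrib using hh mult_right_mono[OF hh(1), of "D\<^sup>2"] by simp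
  finally show ?thesis by (simp add: algebra_simps)
qed

section \<open>The approximate drift and the squared deviation over one short step\<close>

context
  fixes n :: nat and \<theta> :: real
  assumes n: "n \<ge> 1" and \<theta>: "\<theta> > 0"
begin

interpretation emp: real_distribution "emp n \<theta> x" for x
  by (rule real_distribution_emp[OF n])

abbreviation "emp_st x w \<equiv> stieltjes (emp n \<theta> x) w"

text \<open>Each of the n factors differs from an exponential by a quadratic term of order 1 / n^2.
  The constant is 324 = 9 * 9 * 4.\<close>

lemma emp_prod_approx:
  assumes w: "Im w \<ge> 1 / 2"
  shows "norm (emp_prod n \<theta> x w - exp (- emp_st x w)) \<le> 324 / real n"
proof -
  define \<zeta> where "\<zeta> j = 1 / (of_nat n * (w - complex_of_real (x j / (\<theta> * real n))))" for j
  have n0: "real n > 0" using n by simp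
  have \<zeta>: "norm (\<zeta> j) \<le> 2 / real n" for j
  proof -
    have "1 / 2 \<le> norm (w - complex_of_real (x j / (\<theta> * real n)))"
      using Im_le_norm_of_real_diff[of w "x j / (\<theta> * real n)"] w by (simp add: norm_minus_commute)
    then have "real n * (1 / 2) \<le> real n * norm (w - complex_of_real (x j / (\<theta> * real n)))" by (intro mult_left_mono) auto
    then have "1 / (real n * norm (w - complex_of_real (x j / (\<theta> * real n)))) \<le> 1 / (real n * (1 / 2))"
      using n0 by (intro divide_left_mono mult_pos_pos) auto
    then show ?thesis unfolding \<zeta>_def by (simp add: norm_divide norm_mult)
  qed
  have le2: "2 / real n \<le> 2" using n by (simp add: divide_simps)
  have sum: "- emp_st x w = (\<Sum>j<n. \<zeta> j)"
  proof -
    have "- (1 / (complex_of_real y - w) / of_nat n) = 1 / (of_nat n * (w - complex_of_real y))" for y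
    proof -
      have "1 / (complex_of_real y - w) = - (1 / (w - complex_of_real y))"
        using minus_divide_right[of 1 "w - complex_of_real y"] by simp
      then show ?thesis by (simp add: mult.commute)
    qed
    then show ?thesis
      unfolding stieltjes_emp[OF n] \<zeta>_def sum_divide_distrib sum_negf[symmetric] by (intro sum.cong refl)
  qed
  \<comment> \<open>Chosen so that its n-th power is e^2, independent of n.\<close>
  let ?M = "exp (2 / real n)"
  have "norm ((\<Prod>j<n. 1 + \<zeta> j) - (\<Prod>j<n. exp (\<zeta> j))) \<le> ?M ^ card {..<n} * (real (card {..<n}) * (9 * (2 / real n)\<^sup>2))"
  proof (rule norm_prod_diff_scaled)
    fix j
    have "norm (1 + \<zeta> j) \<le> 1 + 2 / real n" using norm_triangle_ineq[of 1 "\<zeta> j"] \<zeta>[of j] by simp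
    also have "\<dots> \<le> ?M" by (rule exp_ge_add_one_self)
    finally show "norm (1 + \<zeta> j) \<le> ?M" .
    show "norm (exp (\<zeta> j)) \<le> ?M" by (rule order_trans[OF norm_exp]) (use \<zeta> in simp)
    have "norm (exp (\<zeta> j) - (\<Sum>i\<le>Suc 0. \<zeta> j ^ i / fact i)) \<le> exp \<bar>Re (\<zeta> j)\<bar> * norm (\<zeta> j) ^ Suc (Suc 0) / fact (Suc 0)"
      by (rule Taylor_exp)
    then have "norm (exp (\<zeta> j) - (1 + \<zeta> j)) \<le> exp \<bar>Re (\<zeta> j)\<bar> * norm (\<zeta> j) ^ 2"
      by (simp add: numeral_2_eq_2)
    also have "\<dots> \<le> 9 * (2 / real n)^2"
    proof (intro mult_mono power_mono \<zeta>)
      have "\<bar>Re (\<zeta> j)\<bar> \<le> 2" using abs_Re_le_cmod[of "\<zeta> j"] \<zeta>[of j] le2 by linarith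
      then show "exp \<bar>Re (\<zeta> j)\<bar> \<le> 9" using exp_2_le by (intro order_trans[OF _ exp_2_le]) simp
    qed auto
    finally show "norm (1 + \<zeta> j - exp (\<zeta> j)) \<le> 9 * (2 / real n)\<^sup>2" by (simp add: norm_minus_commute)
  qed auto
  also have "?M ^ card {..<n} = exp 2" using n0 by (simp add: exp_of_nat_mult[symmetric])
  also have "exp 2 * (real (card {..<n}) * (9 * (2 / real n)\<^sup>2)) \<le> 9 * (real n * (9 * (2 / real n)\<^sup>2))"
    unfolding card_lessThan by (intro mult_right_mono exp_2_le) simp
  also have "\<dots> = 324 / real n" using n0 by (simp add: power2_eq_square)
  also have "(\<Prod>j<n. exp (\<zeta> j)) = exp (- emp_st x w)" by (simp add: sum exp_sum)
  finally show ?thesis by (simp add: emp_prod_def[OF n \<theta>] \<zeta>_def)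
qed

text \<open>The generator applied to the empirical transform. \<open>gen\<close> acts on real
  functions, so the complex version is spelled out.\<close>

definition drift :: "(nat \<Rightarrow> real) \<Rightarrow> complex \<Rightarrow> complex" where
  "drift x w = of_real (\<theta> * real n) *
     (\<Sum>i<n. of_real (jump_weight n \<theta> x i) * (emp_st (jump x i) w - emp_st x w))"

text \<open>The drift is a difference quotient of the product with step 1 / (\<theta> n). Replacing
  the product by exp (- m) under a quotient would seem to lose a factor n; the Cauchy estimate for
  the holomorphic difference avoids this. The constants are 648 = 2 * 324 and 72 = 8 * 9.\<close>

lemma drift_approx:
  assumes x: "x \<in> Wset n \<theta>" and w: "Im w \<ge> 1"
  shows "norm (drift x w + exp (- emp_st x w) * stieltjes' (emp n \<theta> x) w) \<le> (648 + 72 / \<theta>) / real n"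
proof -
  let ?E = "\<lambda>w. exp (- emp_st x w)" and ?B = "emp_prod n \<theta> x"
  define \<delta> where "\<delta> = 1 / (\<theta> * real n)"
  have n0: "\<theta> * real n > 0" using n \<theta> by simp
  then have \<delta>: "\<delta> > 0" "\<theta> * real n * \<delta> = 1" using n \<theta> by (simp_all add: \<delta>_def)
  define v where "v = w - of_real \<delta>"
  have v: "Im v \<ge> 1" using w by (simp add: v_def)
  have dr: "drift x w = of_real (\<theta> * real n) * (?B w - ?B v)"
    unfolding drift_def using drift_eq[OF n \<theta> x, of w] w by (simp add: v_def \<delta>_def)
  have holB: "?B holomorphic_on {w. Im w > 0}"
    unfolding emp_prod_def[OF n \<theta>] using n
    by (intro holomorphic_intros) (auto simp: complex_eq_iff)
  have "norm ((?B w - ?E w) - (?B v - ?E v)) \<le> 2 * (324 / real n) * norm (w - v)"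
    by (rule norm_diff_le_half_plane)
       (use v w emp_prod_approx in \<open>auto intro!: holomorphic_on_diff holB emp.holomorphic_exp_stieltjes\<close>)
  then have 1: "norm ((?B w - ?E w) - (?B v - ?E v)) \<le> 648 / real n * \<delta>" using \<delta> by (simp add: v_def)
  have dE: "deriv ?E w = - (?E w * stieltjes' (emp n \<theta> x) w)"
    using emp.DERIV_exp_stieltjes[of w x] w by (intro DERIV_imp_deriv) auto
  have "norm (?E v - ?E w - deriv ?E w * (v - w)) \<le> 8 * 9 * norm (v - w) ^ 2"
    by (rule norm_taylor_le_half_plane[OF emp.holomorphic_exp_stieltjes _ w v])
       (rule norm_exp_uminus_le_9[OF emp.norm_stieltjes_le_2])
  then have 2: "norm (?E v - ?E w - deriv ?E w * (v - w)) \<le> 72 * \<delta>\<^sup>2" using \<delta> by (simp add: v_def)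
  have "drift x w + ?E w * stieltjes' (emp n \<theta> x) w =
     of_real (\<theta> * real n) * (((?B w - ?E w) - (?B v - ?E v)) - (?E v - ?E w - deriv ?E w * (v - w)))"
  proof -
    have "of_real (\<theta> * real n) * (deriv ?E w * (v - w)) = - deriv ?E w * of_real (\<theta> * real n * \<delta>)"
      by (simp add: v_def)
    then have e: "of_real (\<theta> * real n) * (deriv ?E w * (v - w)) = ?E w * stieltjes' (emp n \<theta> x) w"
      unfolding \<delta>(2) dE by simp
    show ?thesis unfolding dr e[symmetric] by (simp only: right_diff_distrib distrib_left) (simp add: algebra_simps)
  qed
  also have "norm \<dots> \<le> (\<theta> * real n) * (648 / real n * \<delta> + 72 * \<delta>\<^sup>2)"
    unfolding norm_mult norm_of_real abs_of_pos[OF n0]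
    using n0 by (intro mult_left_mono order_trans[OF norm_triangle_ineq4 add_mono[OF 1 2]]) auto
  also have "\<dots> = (\<theta> * real n * \<delta>) * (648 / real n + 72 * \<delta>)" by (simp add: power2_eq_square algebra_simps)
  also have "\<dots> = (648 + 72 / \<theta>) / real n" unfolding \<delta>(2) by (simp add: \<delta>_def add_divide_distrib)
  finally show ?thesis .
qed

text \<open>The linear part of the squared increments is the inner product with the drift, and
  completing the square only adds a nonnegative term. The remaining squared jumps cost h / (\<theta>
  n^2).\<close>

lemma gen_square_le:
  fixes a :: complex
  assumes x: "x \<in> Wset n \<theta>" and w: "Im w \<ge> 1" and h: "h \<ge> 0"
  defines "g \<equiv> \<lambda>y. (norm (emp_st y w - a))\<^sup>2"
  shows "g x + h * gen n \<theta> g x \<le> (norm (emp_st x w - a + of_real h * drift x w))\<^sup>2 + h / (\<theta> * (real n)\<^sup>2)"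
proof -
  define q where "q = emp_st x w - a"
  define \<Delta> where "\<Delta> i = emp_st (jump x i) w - emp_st x w" for i
  let ?p = "jump_weight n \<theta> x"
  have n0: "\<theta> * real n > 0" using n \<theta> by simp
  have gi: "g (jump x i) - g x = 2 * (q \<bullet> \<Delta> i) + (norm (\<Delta> i))\<^sup>2" for i
    using norm_add_scaled_sq_expand[of q "\<Delta> i"] by (simp add: g_def q_def \<Delta>_def)
  have dr: "drift x w = (\<Sum>i<n. (\<theta> * real n * ?p i) *\<^sub>R \<Delta> i)"
    by (simp add: drift_def \<Delta>_def sum_distrib_left scaleR_conv_of_real mult.assoc)
  have "gen n \<theta> g x = (\<Sum>i<n. \<theta> * real n * ?p i * (2 * (q \<bullet> \<Delta> i) + (norm (\<Delta> i))\<^sup>2))"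
    by (simp add: gen_eq gi sum_distrib_left mult.assoc)
  also have "\<dots> = 2 * (q \<bullet> drift x w) + \<theta> * real n * (\<Sum>i<n. ?p i * (norm (\<Delta> i))\<^sup>2)"
    unfolding dr inner_sum_right by (simp add: distrib_left sum.distrib sum_distrib_left) (simp add: ac_simps)
  finally have gen: "gen n \<theta> g x = 2 * (q \<bullet> drift x w) + \<theta> * real n * (\<Sum>i<n. ?p i * (norm (\<Delta> i))\<^sup>2)" .
  have "(\<Sum>i<n. ?p i * (norm (\<Delta> i))\<^sup>2) \<le> (\<Sum>i<n. ?p i * (1 / (\<theta> * (real n)\<^sup>2))\<^sup>2)"
    unfolding \<Delta>_def using w
    by (intro sum_mono mult_left_mono power_mono norm_stieltjes_jump_le[OF n \<theta>] jump_weight_nonneg[OF n \<theta> x]) auto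
  also have "\<dots> = real n * (1 / (\<theta> * (real n)\<^sup>2))\<^sup>2"
    unfolding sum_distrib_right[symmetric] sum_jump_weight[OF n \<theta> x] ..
  finally have "\<theta> * real n * (\<Sum>i<n. ?p i * (norm (\<Delta> i))\<^sup>2) \<le> \<theta> * real n * (real n * (1 / (\<theta> * (real n)\<^sup>2))\<^sup>2)"
    using n0 by (intro mult_left_mono) auto
  also have "\<dots> = 1 / (\<theta> * (real n)\<^sup>2)" using n \<theta> by (simp add: power2_eq_square)
  finally have "gen n \<theta> g x \<le> 2 * (q \<bullet> drift x w) + 1 / (\<theta> * (real n)\<^sup>2)" using gen by simp
  then have "h * gen n \<theta> g x \<le> h * (2 * (q \<bullet> drift x w) + 1 / (\<theta> * (real n)\<^sup>2))" using h by (intro mult_left_mono)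
  moreover have "(norm (q + of_real h * drift x w))\<^sup>2 - (norm q)\<^sup>2 = 2 * (h * (q \<bullet> drift x w)) + (norm (of_real h * drift x w))\<^sup>2"
    unfolding norm_add_scaled_sq_expand scaleR_conv_of_real[symmetric] by simp
  moreover have "0 \<le> (norm (of_real h * drift x w))\<^sup>2" by simp
  moreover have "h * (2 * (q \<bullet> drift x w) + 1 / (\<theta> * (real n)\<^sup>2)) = 2 * (h * (q \<bullet> drift x w)) + h / (\<theta> * (real n)\<^sup>2)"
    by (simp add: distrib_left)
  moreover have "g x = (norm q)\<^sup>2" by (simp add: g_def q_def)
  ultimately show ?thesis unfolding q_def[symmetric] by linarith
qed

text \<open>The first term is 6 D^2 of \<open>square_step_le\<close> for the drift error D of
  \<open>drift_approx\<close>, the second the squared jumps, both without their factor 1 /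
  n^2.\<close>

definition var_const :: real where
  "var_const = 6 * (648 + 72 / \<theta>)\<^sup>2 + 1 / \<theta>"

lemma gen_square_step:
  assumes x: "x \<in> Wset n \<theta>" and w: "Im w \<ge> 1" "Im (w + of_real h * c) \<ge> 1" and h: "0 \<le> h" "h \<le> 1"
    and a: "norm a \<le> 1" "c = exp (- a)"
  defines "g \<equiv> \<lambda>v y. (norm (emp_st y v - a))\<^sup>2"
  shows "g (w + of_real h * c) x + h * gen n \<theta> (g (w + of_real h * c)) x
     \<le> (1 + 19 * h) * g w x + var_const / (real n)\<^sup>2 * h + 936 * h\<^sup>2"
proof -
  let ?w = "w + of_real h * c"
  let ?C = "648 + 72 / \<theta>"
  let ?r = "norm (emp_st x ?w - a + of_real h * drift x ?w)"
  have "emp_st x ?w - a + of_real h * drift x ?w =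
     (emp_st x ?w - a - of_real h * (exp (- emp_st x ?w) * stieltjes' (emp n \<theta> x) ?w))
     + of_real h * (drift x ?w + exp (- emp_st x ?w) * stieltjes' (emp n \<theta> x) ?w)"
    by (simp add: algebra_simps)
  also have "norm \<dots> \<le> ((1 + 3 * h) * norm (emp_st x w - a) + 18 * h\<^sup>2) + h * (?C / real n)"
  proof (rule norm_triangle_le[OF add_mono])
    show "norm (emp_st x ?w - a - of_real h * (exp (- emp_st x ?w) * stieltjes' (emp n \<theta> x) ?w))
       \<le> (1 + 3 * h) * norm (emp_st x w - a) + 18 * h\<^sup>2"
      by (rule emp.stieltjes_step) (use w h a in auto)
    show "norm (of_real h * (drift x ?w + exp (- emp_st x ?w) * stieltjes' (emp n \<theta> x) ?w)) \<le> h * (?C / real n)"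
      unfolding norm_mult using h by (intro mult_mono drift_approx[OF x w(2)]) auto
  qed
  finally have r: "?r \<le> (1 + 3 * h) * norm (emp_st x w - a) + 18 * h\<^sup>2 + h * (?C / real n)" .
  have "norm (emp_st x w - a) \<le> 2"
    using norm_triangle_ineq4[of "emp_st x w" a] emp.norm_stieltjes_le_1[OF w(1), of x] a(1) by linarith
  then have "?r\<^sup>2 \<le> (1 + 19 * h) * g w x + 6 * (?C / real n)\<^sup>2 * h + 936 * h\<^sup>2"
    unfolding g_def using h r \<theta> by (intro square_step_le) auto
  moreover have "g ?w x + h * gen n \<theta> (g ?w) x \<le> ?r\<^sup>2 + h / (\<theta> * (real n)\<^sup>2)"
    unfolding g_def by (rule gen_square_le[OF x w(2) h(1)])
  moreover have "6 * (?C / real n)\<^sup>2 * h + h / (\<theta> * (real n)\<^sup>2) = var_const / (real n)\<^sup>2 * h"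
  proof -
    have "6 * (C / real n)\<^sup>2 * h + h / (\<theta> * (real n)\<^sup>2) = (6 * C\<^sup>2 + 1 / \<theta>) / (real n)\<^sup>2 * h" for C
      by (simp add: power_divide add_divide_distrib distrib_right)
    then show ?thesis by (simp only: var_const_def)
  qed
  ultimately show ?thesis by linarith
qed

end

section \<open>Second moments along characteristics\<close>

lemma countable_Wset: "countable (Wset n \<theta>)"
proof (rule countable_subset)
  let ?F = "\<lambda>ls :: nat list. \<lambda>i. if i < n then real (ls ! i) + real (n - 1 - i) * \<theta> else 0"
  show "Wset n \<theta> \<subseteq> range ?F"
  proof
    fix x assume "x \<in> Wset n \<theta>"
    then obtain l :: "nat \<Rightarrow> nat" where "\<And>i. i < n \<Longrightarrow> x i = real (l i) + real (n - 1 - i) * \<theta>" "\<And>i. n \<le> i \<Longrightarrow> x i = 0"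
      unfolding Wset_def by blast
    then have "x = ?F (map l [0..<n])" by (auto simp: fun_eq_iff)
    then show "x \<in> range ?F" by blast
  qed
qed auto

text \<open>Plays the part of conditioning on V: expectations are compared on each event V = i and
  then summed.\<close>

lemma integral_le_by_countable_cases:
  fixes u v :: "'a \<Rightarrow> real"
  assumes I: "countable I" and V: "V \<in> measurable M (count_space I)"
    and u: "integrable M u" "\<And>\<omega>. u \<omega> \<ge> 0" and v: "integrable M v" "\<And>\<omega>. v \<omega> \<ge> 0"
    and le: "\<And>i. i \<in> I \<Longrightarrow> (\<integral>\<omega>. indicator {\<omega>\<in>space M. V \<omega> = i} \<omega> * u \<omega> \<partial>M) \<le> (\<integral>\<omega>. indicator {\<omega>\<in>space M. V \<omega> = i} \<omega> * v \<omega> \<partial>M)"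
  shows "integral\<^sup>L M u \<le> integral\<^sup>L M v"
proof -
  let ?E = "\<lambda>i. {\<omega>\<in>space M. V \<omega> = i}"
  have E: "?E i \<in> sets M" if "i \<in> I" for i
    using measurable_sets[OF V, of "{i}"] that by (simp add: vimage_def Int_def conj_commute)
  have VI: "V \<omega> \<in> I" if "\<omega> \<in> space M" for \<omega> using measurable_space[OF V that] by simp
  have split: "ennreal (integral\<^sup>L M w) = (\<integral>\<^sup>+i. ennreal (\<integral>\<omega>. indicator (?E i) \<omega> * w \<omega> \<partial>M) \<partial>count_space I)"
    if w: "integrable M w" "\<And>\<omega>. w \<omega> \<ge> 0" for w :: "'a \<Rightarrow> real"
  proof -
    have [measurable]: "w \<in> borel_measurable M" using w by auto
    have "ennreal (integral\<^sup>L M w) = (\<integral>\<^sup>+\<omega>. ennreal (w \<omega>) \<partial>M)"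
      using w by (intro nn_integral_eq_integral[symmetric]) auto
    also have "\<dots> = (\<integral>\<^sup>+\<omega>. (\<integral>\<^sup>+i. indicator (?E i) \<omega> * ennreal (w \<omega>) \<partial>count_space I) \<partial>M)"
    proof (rule nn_integral_cong)
      fix \<omega> assume \<omega>: "\<omega> \<in> space M"
      have "(\<integral>\<^sup>+i. indicator (?E i) \<omega> * ennreal (w \<omega>) \<partial>count_space I) = (\<integral>\<^sup>+i. ennreal (w \<omega>) * indicator {V \<omega>} i \<partial>count_space I)"
        using \<omega> by (intro nn_integral_cong) (auto simp: indicator_def)
      also have "\<dots> = ennreal (w \<omega>)" using VI[OF \<omega>] by (simp add: one_ennreal_def[symmetric])
      finally show "ennreal (w \<omega>) = (\<integral>\<^sup>+i. indicator (?E i) \<omega> * ennreal (w \<omega>) \<partial>count_space I)" by simp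
    qed
    also have "\<dots> = (\<integral>\<^sup>+i. (\<integral>\<^sup>+\<omega>. indicator (?E i) \<omega> * ennreal (w \<omega>) \<partial>M) \<partial>count_space I)"
      using I E by (intro nn_integral_count_space_nn_integral) auto
    also have "\<dots> = (\<integral>\<^sup>+i. ennreal (\<integral>\<omega>. indicator (?E i) \<omega> * w \<omega> \<partial>M) \<partial>count_space I)"
    proof (rule nn_integral_cong)
      fix i assume "i \<in> space (count_space I)"
      then have "?E i \<in> sets M" using E by simp
      then have int: "integrable M (\<lambda>\<omega>. indicator (?E i) \<omega> * w \<omega>)"
        using integrable_mult_indicator[of "?E i" M w] w by simp
      have "(\<integral>\<^sup>+\<omega>. indicator (?E i) \<omega> * ennreal (w \<omega>) \<partial>M) = (\<integral>\<^sup>+\<omega>. ennreal (indicator (?E i) \<omega> * w \<omega>) \<partial>M)"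
        by (intro nn_integral_cong) (auto simp: indicator_def)
      also have "\<dots> = ennreal (\<integral>\<omega>. indicator (?E i) \<omega> * w \<omega> \<partial>M)"
        using int w by (intro nn_integral_eq_integral) auto
      finally show "(\<integral>\<^sup>+\<omega>. indicator (?E i) \<omega> * ennreal (w \<omega>) \<partial>M) = ennreal (\<integral>\<omega>. indicator (?E i) \<omega> * w \<omega> \<partial>M)" .
    qed
    finally show ?thesis .
  qed
  have "ennreal (integral\<^sup>L M u) \<le> ennreal (integral\<^sup>L M v)"
    unfolding split[OF u] split[OF v] using le by (intro nn_integral_mono ennreal_leI) auto
  then show ?thesis using v by (subst (asm) ennreal_le_iff) (auto intro: integral_nonneg_AE)
qed

context
  fixes M :: "'a measure" and n :: nat and \<theta> :: real and X :: "real \<Rightarrow> 'a \<Rightarrow> nat \<Rightarrow> real"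
  assumes M: "prob_space M" and n: "n \<ge> 1" and \<theta>: "\<theta> > 0" and walk: "is_NIPRW M n \<theta> X"
begin

interpretation prob_space M by (rule M)
interpretation emp: real_distribution "emp n \<theta> x" for x
  by (rule real_distribution_emp[OF n])

lemma walk_measurable: "t \<ge> 0 \<Longrightarrow> X t \<in> measurable M (count_space UNIV)"
  using walk by (simp add: is_NIPRW_def)

lemma walk_in_Wset: "t \<ge> 0 \<Longrightarrow> \<omega> \<in> space M \<Longrightarrow> X t \<omega> \<in> Wset n \<theta>"
  using walk by (simp add: is_NIPRW_def)

lemma walk_measurable_Wset: "t \<ge> 0 \<Longrightarrow> X t \<in> measurable M (count_space (Wset n \<theta>))"
  using walk_in_Wset measurable_sets[OF walk_measurable, of t]
  by (subst measurable_count_space_eq_countable[OF countable_Wset]) auto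

lemma walk_set: "t \<ge> 0 \<Longrightarrow> {\<omega>\<in>space M. P (X t \<omega>)} \<in> sets M"
  using measurable_sets[OF walk_measurable, of t "{x. P x}"] by (simp add: vimage_def Int_def conj_commute)

lemma walk_set2: "0 \<le> s \<Longrightarrow> 0 \<le> t \<Longrightarrow> {\<omega>\<in>space M. P (X s \<omega>) \<and> Q (X t \<omega>)} \<in> sets M"
  using sets.Int[OF walk_set[of s P] walk_set[of t Q]] by (simp add: Int_def conj_ac)

lemma walk_compose_measurable: "t \<ge> 0 \<Longrightarrow> (\<lambda>\<omega>. f (X t \<omega>)) \<in> borel_measurable M"
  by (rule measurable_compose[OF walk_measurable]) simp_all

lemma walk_compose2_measurable:
  "0 \<le> s \<Longrightarrow> 0 \<le> t \<Longrightarrow> (\<lambda>\<omega>. f (X s \<omega>) (X t \<omega>)) \<in> borel_measurable M"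
  by (rule measurable_compose_countable'[where g = "X s", OF _ walk_measurable_Wset countable_Wset])
     (auto intro: walk_compose_measurable)

lemma event_in_nat_filt:
  assumes "0 \<le> s"
  shows "{\<omega>\<in>space M. X 0 \<omega> = x0 \<and> X s \<omega> = x} \<in> nat_filt M X s"
proof -
  let ?G = "{X r -` B \<inter> space M | r B. 0 \<le> r \<and> r \<le> s}"
  have sets_G: "sets (sigma (space M) ?G) = sigma_sets (space M) ?G"
    by (rule sets_measure_of) blast
  have "X r -` B \<inter> space M \<in> sigma_sets (space M) ?G" if "0 \<le> r" "r \<le> s" for r B
    using that by (intro sigma_sets.Basic CollectI exI[of _ r] exI[of _ B]) simp
  from this[of 0 "{x0}"] this[of s "{x}"]
  have "X 0 -` {x0} \<inter> space M \<in> sigma_sets (space M) ?G" "X s -` {x} \<inter> space M \<in> sigma_sets (space M) ?G"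
    using assms by simp_all
  then have "(X 0 -` {x0} \<inter> space M) \<inter> (X s -` {x} \<inter> space M) \<in> sigma_sets (space M) ?G"
    unfolding sets_G[symmetric] by (rule sets.Int)
  also have "(X 0 -` {x0} \<inter> space M) \<inter> (X s -` {x} \<inter> space M) = {\<omega>\<in>space M. X 0 \<omega> = x0 \<and> X s \<omega> = x}" by auto
  finally show ?thesis by (simp add: nat_filt_def)
qed

text \<open>The events record two states: the initial one fixes the characteristic line, the one at
  time s fixes the law of the next step.\<close>

lemma transition:
  fixes x x0 y :: "nat \<Rightarrow> real"
  assumes "0 \<le> s" "0 \<le> h"
  defines "A \<equiv> {\<omega>\<in>space M. X 0 \<omega> = x0 \<and> X s \<omega> = x}"
  shows "measure M (A \<inter> {\<omega>\<in>space M. X (s + h) \<omega> = y}) = measure M A * trans_sg n \<theta> h (\<lambda>z. if z = y then 1 else 0) x"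
proof -
  have "A \<in> nat_filt M X s" unfolding A_def by (rule event_in_nat_filt[OF assms(1)])
  then have "measure M (A \<inter> {\<omega>\<in>space M. X (s + h) \<omega> = y}) =
     (\<integral>\<omega>. indicator A \<omega> * trans_sg n \<theta> h (\<lambda>z. if z = y then 1 else 0) (X s \<omega>) \<partial>M)"
    using walk assms(1,2) unfolding is_NIPRW_def by blast
  also have "\<dots> = (\<integral>\<omega>. indicator A \<omega> * trans_sg n \<theta> h (\<lambda>z. if z = y then 1 else 0) x \<partial>M)"
    by (intro Bochner_Integration.integral_cong) (auto simp: A_def indicator_def)
  also have "\<dots> = measure M A * trans_sg n \<theta> h (\<lambda>z. if z = y then 1 else 0) x"
    using walk_set2[of 0 s "\<lambda>z. z = x0" "\<lambda>z. z = x"] assms(1) by (simp add: A_def)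
  finally show ?thesis .
qed

definition step_const :: real where
  "step_const = (2 * \<theta> * (real n)\<^sup>2)\<^sup>2 * exp (2 * \<theta> * (real n)\<^sup>2)"

text \<open>The transition law addresses one target at a time, each with error K, and such errors
  cannot be summed over infinitely many states. So only x and its n neighbours are summed, and the
  remaining probability is estimated as a complement. Both contributions cost at most F (n + 1) K,
  whence the factor 2.\<close>

lemma one_step:
  fixes x x0 :: "nat \<Rightarrow> real"
  assumes s: "0 \<le> s" and h: "0 \<le> h" "h \<le> 1" and x: "x \<in> Wset n \<theta>"
    and f: "\<And>y. 0 \<le> f y" "\<And>y. f y \<le> F"
  defines "A \<equiv> {\<omega>\<in>space M. X 0 \<omega> = x0 \<and> X s \<omega> = x}"
  shows "(\<integral>\<omega>. indicator A \<omega> * f (X (s + h) \<omega>) \<partial>M)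
    \<le> measure M A * (f x + h * gen n \<theta> f x + 2 * F * real (n + 1) * step_const * h\<^sup>2)"
proof -
  define Y where "Y = insert x (jump x ` {..<n})"
  define \<delta> :: "(nat \<Rightarrow> real) \<Rightarrow> (nat \<Rightarrow> real) \<Rightarrow> real" where "\<delta> y z = (if z = y then 1 else 0)" for y z
  define q where "q y = \<delta> y x + h * gen n \<theta> (\<delta> y) x" for y
  define K where "K = step_const * h\<^sup>2"
  define Ay where "Ay y = A \<inter> {\<omega>\<in>space M. X (s + h) \<omega> = y}" for y
  have A [measurable]: "A \<in> sets M"
    unfolding A_def using walk_set2[of 0 s "\<lambda>z. z = x0" "\<lambda>z. z = x"] s by simp
  have Ay [measurable]: "Ay y \<in> sets M" for y
    unfolding Ay_def using walk_set[of "s + h" "\<lambda>z. z = y"] s h by (intro sets.Int A) simp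
  have finY: "finite Y" by (simp add: Y_def)
  have cardY: "card Y \<le> n + 1"
    using card_image_le[of "{..<n}" "jump x"] card_insert_le_m1[of "n + 1" "jump x ` {..<n}" x] by (simp add: Y_def)
  have Fn: "F \<ge> 0" using f[of x] by linarith
  have Kn: "K \<ge> 0" by (simp add: K_def step_const_def)
  \<comment> \<open>\<open>q\<close> is the first-order transition law from x. For g = 1 its total
    mass is 1, which bounds the probability of leaving Y.\<close>
  have sumq: "(\<Sum>y\<in>Y. g y * q y) = g x + h * gen n \<theta> g x" for g
  proof -
    have d: "(\<Sum>y\<in>Y. g y * \<delta> y z) = g z" if "z \<in> Y" for z
      using that finY by (simp add: \<delta>_def if_distrib[of "(*) _"] cong: if_cong)
    have mem: "x \<in> Y" "\<And>i. i < n \<Longrightarrow> jump x i \<in> Y" by (auto simp: Y_def)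
    have "(\<Sum>y\<in>Y. g y * gen n \<theta> (\<delta> y) x)
       = \<theta> * real n * (\<Sum>i<n. jump_weight n \<theta> x i * ((\<Sum>y\<in>Y. g y * \<delta> y (jump x i)) - (\<Sum>y\<in>Y. g y * \<delta> y x)))"
      unfolding gen_eq sum_subtractf[symmetric] sum_distrib_left
      by (subst sum.swap) (simp add: algebra_simps)
    also have "\<dots> = gen n \<theta> g x"
      unfolding gen_eq by (intro arg_cong2[where f = "(*)"] sum.cong refl) (simp add: d mem)
    finally have "(\<Sum>y\<in>Y. g y * gen n \<theta> (\<delta> y) x) = gen n \<theta> g x" .
    moreover have "(\<Sum>y\<in>Y. g y * \<delta> y x) = g x" by (rule d) (simp add: Y_def)
    ultimately show ?thesis
      by (simp add: q_def distrib_left sum.distrib mult.left_commute sum_distrib_left[symmetric])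
  qed
  have PAy: "\<bar>measure M (Ay y) - measure M A * q y\<bar> \<le> measure M A * K" for y
  proof -
    have "measure M (Ay y) = measure M A * trans_sg n \<theta> h (\<delta> y) x"
      unfolding Ay_def A_def using transition[OF s h(1)] by (simp add: \<delta>_def[abs_def])
    then have "\<bar>measure M (Ay y) - measure M A * q y\<bar> = measure M A * \<bar>trans_sg n \<theta> h (\<delta> y) x - q y\<bar>"
      by (simp add: right_diff_distrib[symmetric] abs_mult)
    also have "\<bar>trans_sg n \<theta> h (\<delta> y) x - q y\<bar> \<le> K"
      unfolding q_def K_def step_const_def by (rule trans_sg_approx[OF n \<theta> _ x h]) (simp add: \<delta>_def)
    finally show ?thesis by (simp add: mult_left_mono)
  qed
  have disj: "disjoint_family_on Ay Y" by (auto simp: disjoint_family_on_def Ay_def)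
  \<comment> \<open>The part of A on which more than one jump must have been made by time s + h, or
    an unexpected state is reached.\<close>
  define R where "R = A - (\<Union>y\<in>Y. Ay y)"
  have R [measurable]: "R \<in> sets M" unfolding R_def by (rule sets.Diff[OF A sets.finite_UN[OF finY Ay]])
  have AyU: "(\<Union>y\<in>Y. Ay y) \<in> sets M" by (rule sets.finite_UN[OF finY Ay])
  have "measure M R = measure M A - measure M (\<Union>y\<in>Y. Ay y)"
    unfolding R_def by (rule finite_measure_Diff[OF A AyU]) (auto simp: Ay_def)
  moreover have "measure M (\<Union>y\<in>Y. Ay y) = (\<Sum>y\<in>Y. measure M (Ay y))"
    using finY disj by (intro finite_measure_finite_Union) auto
  moreover have "(\<Sum>y\<in>Y. measure M A * (1 * q y) - measure M A * K) \<le> (\<Sum>y\<in>Y. measure M (Ay y))"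
    using PAy by (intro sum_mono) (simp add: abs_le_iff algebra_simps)
  moreover have "(\<Sum>y\<in>Y. measure M A * (1 * q y) - measure M A * K) = measure M A * 1 - real (card Y) * (measure M A * K)"
    unfolding sum_subtractf sum_distrib_left[symmetric] using sumq[of "\<lambda>_. 1"] by (simp add: gen_eq)
  ultimately have PR: "measure M R \<le> real (card Y) * (measure M A * K)" by linarith
  have "(\<integral>\<omega>. indicator A \<omega> * f (X (s + h) \<omega>) \<partial>M) \<le> (\<integral>\<omega>. (\<Sum>y\<in>Y. f y * indicator (Ay y) \<omega>) + F * indicator R \<omega> \<partial>M)"
  proof (rule integral_mono)
    show "integrable M (\<lambda>\<omega>. indicator A \<omega> * f (X (s + h) \<omega>))"
      by (rule integrable_const_bound[where B = F])
         (use s h f Fn walk_compose_measurable[of "s + h" f] in \<open>auto simp: indicator_def\<close>)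
    show "integrable M (\<lambda>\<omega>. (\<Sum>y\<in>Y. f y * indicator (Ay y) \<omega>) + F * indicator R \<omega>)"
      by (intro Bochner_Integration.integrable_add Bochner_Integration.integrable_sum integrable_mult_right)
         (auto intro!: integrable_real_indicator simp: emeasure_eq_measure)
    fix \<omega> assume \<omega>: "\<omega> \<in> space M"
    show "indicator A \<omega> * f (X (s + h) \<omega>) \<le> (\<Sum>y\<in>Y. f y * indicator (Ay y) \<omega>) + F * indicator R \<omega>"
    proof (cases "\<omega> \<in> A")
      case True
      show ?thesis
      proof (cases "X (s + h) \<omega> \<in> Y")
        case in_Y: True
        have "f (X (s + h) \<omega>) * indicator (Ay (X (s + h) \<omega>)) \<omega> \<le> (\<Sum>y\<in>Y. f y * indicator (Ay y) \<omega>)"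
          using in_Y finY f by (intro member_le_sum[where f = "\<lambda>y. f y * indicator (Ay y) \<omega>"]) auto
        moreover have "\<omega> \<in> Ay (X (s + h) \<omega>)" using True \<omega> by (simp add: Ay_def)
        moreover have "0 \<le> F * indicator R \<omega>" using Fn by simp
        ultimately show ?thesis using True by simp
      next
        case False
        then have "\<omega> \<in> R" using True by (auto simp: R_def Ay_def)
        moreover have "0 \<le> (\<Sum>y\<in>Y. f y * indicator (Ay y) \<omega>)" using f by (intro sum_nonneg) auto
        ultimately show ?thesis using True f(2)[of "X (s + h) \<omega>"] by simp
      qed
    next
      case False
      have "0 \<le> (\<Sum>y\<in>Y. f y * indicator (Ay y) \<omega>)" using f by (intro sum_nonneg) auto
      then show ?thesis using False Fn by simp
    qed
  qed
  also have "\<dots> = (\<Sum>y\<in>Y. f y * measure M (Ay y)) + F * measure M R"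
  proof -
    have i: "integrable M (\<lambda>\<omega>. c * indicator B \<omega>)" if "B \<in> sets M" for B and c :: real
      using that by (intro integrable_mult_right integrable_real_indicator) (auto simp: emeasure_eq_measure)
    have ii: "(\<integral>\<omega>. c * indicator B \<omega> \<partial>M) = c * measure M B" if "B \<in> sets M" for B and c :: real
      using that sets.sets_into_space[OF that] by (simp add: Int_absorb1 Int_absorb2)
    show ?thesis
      unfolding Bochner_Integration.integral_add[OF Bochner_Integration.integrable_sum[OF i[OF Ay]] i[OF R]]
        Bochner_Integration.integral_sum[OF i[OF Ay]] ii[OF Ay] ii[OF R] ..
  qed
  also have "\<dots> \<le> (\<Sum>y\<in>Y. measure M A * (f y * q y) + F * (measure M A * K)) + F * (real (card Y) * (measure M A * K))"
  proof (intro add_mono sum_mono mult_left_mono PR Fn)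
    fix y
    have "f y * measure M (Ay y) \<le> f y * (measure M A * q y + measure M A * K)"
      using PAy[of y] f by (intro mult_left_mono) auto
    also have "\<dots> \<le> measure M A * (f y * q y) + F * (measure M A * K)"
      using mult_right_mono[OF f(2)[of y], of "measure M A * K"] Kn by (simp add: algebra_simps)
    finally show "f y * measure M (Ay y) \<le> measure M A * (f y * q y) + F * (measure M A * K)" .
  qed
  also have "\<dots> = measure M A * (f x + h * gen n \<theta> f x) + real (card Y) * (2 * F * (measure M A * K))"
    unfolding sum.distrib sum_distrib_left[symmetric] sumq by (simp add: algebra_simps)
  also have "\<dots> \<le> measure M A * (f x + h * gen n \<theta> f x) + real (n + 1) * (2 * F * (measure M A * K))"
    using cardY Fn Kn by (intro add_left_mono mult_right_mono mult_nonneg_nonneg) auto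
  also have "\<dots> = measure M A * (f x + h * gen n \<theta> f x + 2 * F * real (n + 1) * step_const * h\<^sup>2)"
    by (simp add: K_def algebra_simps)
  finally show ?thesis .
qed

text \<open>On the event X 0 = x0 the value a and the line are deterministic, so the test function
  of \<open>one_step\<close> depends on the current state only.\<close>

lemma conditional_second_moment_step:
  fixes x0 :: "nat \<Rightarrow> real"
  assumes z0: "Im z0 \<ge> 3 * T + 2" and T: "T \<ge> 0"
  defines "a \<equiv> stieltjes (emp n \<theta> x0) z0"
  defines "y \<equiv> \<lambda>t. (\<integral>\<omega>. indicator {\<omega>\<in>space M. X 0 \<omega> = x0} \<omega> *
      (norm (stieltjes (emp n \<theta> (X t \<omega>)) (z0 + of_real t * exp (- a)) - a))\<^sup>2 \<partial>M)"
    and "p \<equiv> measure M {\<omega>\<in>space M. X 0 \<omega> = x0}"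
  assumes t: "0 \<le> t" "0 \<le> h" "h \<le> 1" "t + h \<le> T"
  shows "y (t + h) \<le> (1 + 19 * h) * y t + p * (var_const \<theta> / (real n)\<^sup>2) * h
     + p * (936 + 8 * real (n + 1) * step_const) * h\<^sup>2"
proof -
  let ?c = "exp (- a)"
  let ?w = "\<lambda>t. z0 + of_real t * ?c"
  let ?E0 = "{\<omega>\<in>space M. X 0 \<omega> = x0}"
  define g where "g t x = (norm (stieltjes (emp n \<theta> x) (?w t) - a))\<^sup>2" for t x
  have a: "norm a \<le> 1" unfolding a_def by (rule emp.norm_stieltjes_le_1) (use z0 T in simp)
  have c: "norm ?c \<le> 3" by (rule norm_exp_uminus_le_3[OF a])
  have im: "Im (?w t) \<ge> 1" if "0 \<le> t" "t \<le> T" for t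
  proof -
    have "\<bar>t * Im ?c\<bar> \<le> T * 3"
      unfolding abs_mult using that abs_Im_le_cmod[of ?c] c by (intro mult_mono) auto
    then show ?thesis using z0 by simp
  qed
  have wh: "?w (t + h) = ?w t + of_real h * ?c" for t h by (simp add: algebra_simps)
  \<comment> \<open>Two values of norm at most 1 differ by at most 2; this is the bound F = 4 for
    \<open>one_step\<close> and gives the 8 = 2 * 4 in K.\<close>
  have g4: "0 \<le> g t x" "g t x \<le> 4" if "0 \<le> t" "t \<le> T" for t x
  proof -
    have "norm (stieltjes (emp n \<theta> x) (?w t) - a) \<le> 2"
      using norm_triangle_ineq4[of "stieltjes (emp n \<theta> x) (?w t)" a] emp.norm_stieltjes_le_1[OF im[OF that], of x] a by linarith
    then show "g t x \<le> 4" unfolding g_def using power_mono[of _ 2 2] by force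
  qed (simp add: g_def)
  have E0 [measurable]: "?E0 \<in> sets M" by (rule walk_set) simp
  define B where "B = var_const \<theta> / (real n)\<^sup>2"
  define K where "K = 936 + 8 * real (n + 1) * step_const"
  have vn: "B \<ge> 0" "K \<ge> 0" using \<theta> by (simp_all add: B_def K_def var_const_def[OF n \<theta>] step_const_def)
  define v where "v \<omega> = indicator ?E0 \<omega> * ((1 + 19 * h) * g t (X t \<omega>) + B * h + K * h\<^sup>2)" for \<omega>
  have int: "integrable M (\<lambda>\<omega>. indicator ?E0 \<omega> * g t (X t \<omega>))" if "0 \<le> t" "t \<le> T" for t
    by (rule integrable_const_bound[where B = 4])
       (use that g4[OF that] walk_compose_measurable[of t "g t"] in \<open>auto simp: indicator_def\<close>)
  have intE: "integrable M (indicator ?E0 :: 'a \<Rightarrow> real)"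
    by (intro integrable_real_indicator) (auto simp: emeasure_eq_measure)
  have vexp: "v = (\<lambda>\<omega>. (1 + 19 * h) * (indicator ?E0 \<omega> * g t (X t \<omega>)) + (B * h + K * h\<^sup>2) * indicator ?E0 \<omega>)"
    by (auto simp: v_def algebra_simps)
  have tT: "0 \<le> t" "t \<le> T" "0 \<le> t + h" "t + h \<le> T" using t by auto
  have intv: "integrable M v" unfolding vexp by (intro Bochner_Integration.integrable_add integrable_mult_right int intE tT)
  have "y (t + h) = (\<integral>\<omega>. indicator ?E0 \<omega> * g (t + h) (X (t + h) \<omega>) \<partial>M)" by (simp add: y_def g_def)
  also have "\<dots> \<le> integral\<^sup>L M v"
  proof (rule integral_le_by_countable_cases[OF countable_Wset walk_measurable_Wset[OF t(1)]])
    show "integrable M (\<lambda>\<omega>. indicator ?E0 \<omega> * g (t + h) (X (t + h) \<omega>))" by (rule int[OF tT(3,4)])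
    show "0 \<le> indicator ?E0 \<omega> * g (t + h) (X (t + h) \<omega>)" for \<omega> using g4[OF tT(3,4)] by simp
    show "0 \<le> v \<omega>" for \<omega> unfolding v_def using g4[OF tT(1,2)] vn t by (intro mult_nonneg_nonneg add_nonneg_nonneg) auto
    fix x assume x: "x \<in> Wset n \<theta>"
    let ?A = "{\<omega>\<in>space M. X 0 \<omega> = x0 \<and> X t \<omega> = x}"
    have A: "?A \<in> sets M" using walk_set2[of 0 t "\<lambda>z. z = x0" "\<lambda>z. z = x"] t by simp
    have "(\<integral>\<omega>. indicator {\<omega>\<in>space M. X t \<omega> = x} \<omega> * (indicator ?E0 \<omega> * g (t + h) (X (t + h) \<omega>)) \<partial>M)
       = (\<integral>\<omega>. indicator ?A \<omega> * g (t + h) (X (t + h) \<omega>) \<partial>M)"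
      by (intro Bochner_Integration.integral_cong) (auto simp: indicator_def)
    also have "\<dots> \<le> measure M ?A * (g (t + h) x + h * gen n \<theta> (g (t + h)) x + 2 * 4 * real (n + 1) * step_const * h\<^sup>2)"
      by (rule one_step[OF t(1,2,3) x g4[OF tT(3,4)]])
    also have "\<dots> \<le> measure M ?A * ((1 + 19 * h) * g t x + B * h + K * h\<^sup>2)"
    proof (intro mult_left_mono)
      have "g (t + h) x + h * gen n \<theta> (g (t + h)) x \<le> (1 + 19 * h) * g t x + B * h + 936 * h\<^sup>2"
        unfolding g_def[abs_def] wh B_def
        by (rule gen_square_step[OF n \<theta> x im[OF tT(1,2)] im[OF tT(3,4), unfolded wh] t(2,3) a refl])
      then show "g (t + h) x + h * gen n \<theta> (g (t + h)) x + 2 * 4 * real (n + 1) * step_const * h\<^sup>2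
          \<le> (1 + 19 * h) * g t x + B * h + K * h\<^sup>2"
        by (simp add: K_def algebra_simps)
    qed simp
    also have "\<dots> = (\<integral>\<omega>. indicator ?A \<omega> * ((1 + 19 * h) * g t x + B * h + K * h\<^sup>2) \<partial>M)"
      using A by simp
    also have "\<dots> = (\<integral>\<omega>. indicator {\<omega>\<in>space M. X t \<omega> = x} \<omega> * v \<omega> \<partial>M)"
      unfolding v_def by (intro Bochner_Integration.integral_cong) (auto simp: indicator_def)
    finally show "(\<integral>\<omega>. indicator {\<omega>\<in>space M. X t \<omega> = x} \<omega> * (indicator ?E0 \<omega> * g (t + h) (X (t + h) \<omega>)) \<partial>M)
       \<le> (\<integral>\<omega>. indicator {\<omega>\<in>space M. X t \<omega> = x} \<omega> * v \<omega> \<partial>M)" .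
  qed (fact intv)
  also have "integral\<^sup>L M v = (1 + 19 * h) * y t + (B * h + K * h\<^sup>2) * p"
    unfolding vexp Bochner_Integration.integral_add[OF integrable_mult_right[OF int[OF tT(1,2)]] integrable_mult_right[OF intE]]
      integral_mult_right_zero
    by (simp add: y_def g_def p_def)
  finally show ?thesis by (simp add: B_def K_def algebra_simps)
qed

text \<open>On each event X 0 = x0 the deviation is 0 at time 0, so Gronwall leaves only the
  fluctuation term. Summing over x0 gives a bound that does not depend on the initial law.\<close>

lemma second_moment_bound:
  assumes z0: "Im z0 \<ge> 3 * T + 2" and T: "T \<ge> 0"
  defines "a \<equiv> \<lambda>x. stieltjes (emp n \<theta> x) z0"
  shows "(\<integral>\<omega>. (norm (stieltjes (emp n \<theta> (X T \<omega>)) (z0 + of_real T * exp (- a (X 0 \<omega>))) - a (X 0 \<omega>)))\<^sup>2 \<partial>M)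
    \<le> exp (19 * T) * T * var_const \<theta> / (real n)\<^sup>2"
proof -
  let ?C = "exp (19 * T) * (var_const \<theta> / (real n)\<^sup>2 * T)"
  let ?G = "\<lambda>x0 x. (norm (stieltjes (emp n \<theta> x) (z0 + of_real T * exp (- a x0)) - a x0))\<^sup>2"
  have vn: "var_const \<theta> \<ge> 0" "step_const \<ge> 0" using \<theta> by (simp_all add: var_const_def[OF n \<theta>] step_const_def)
  have im: "Im (z0 + of_real T * exp (- a x0)) \<ge> 1" and an: "norm (a x0) \<le> 1" for x0
  proof -
    show an: "norm (a x0) \<le> 1" unfolding a_def by (rule emp.norm_stieltjes_le_1) (use z0 T in simp)
    have "\<bar>T * Im (exp (- a x0))\<bar> \<le> T * 3"
      unfolding abs_mult using T abs_Im_le_cmod[of "exp (- a x0)"] norm_exp_uminus_le_3[OF an] by (intro mult_mono) auto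
    then show "Im (z0 + of_real T * exp (- a x0)) \<ge> 1" using z0 by simp
  qed
  have G4: "?G x0 x \<le> 4" for x0 x
  proof -
    have "norm (stieltjes (emp n \<theta> x) (z0 + of_real T * exp (- a x0)) - a x0) \<le> 2"
      using norm_triangle_ineq4[of "stieltjes (emp n \<theta> x) (z0 + of_real T * exp (- a x0))" "a x0"]
        emp.norm_stieltjes_le_1[OF im[of x0], of x] an[of x0] by linarith
    then show ?thesis using power_mono[of _ 2 2] by force
  qed
  have "(\<integral>\<omega>. ?G (X 0 \<omega>) (X T \<omega>) \<partial>M) \<le> (\<integral>\<omega>. ?C \<partial>M)"
  proof (rule integral_le_by_countable_cases[OF countable_Wset walk_measurable_Wset[of 0]])
    show "integrable M (\<lambda>\<omega>. ?G (X 0 \<omega>) (X T \<omega>))"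
      by (rule integrable_const_bound[where B = 4])
         (use G4 walk_compose2_measurable[of 0 T ?G] T in auto)
    show "0 \<le> ?C" using vn T by simp
    fix x0
    let ?E0 = "{\<omega>\<in>space M. X 0 \<omega> = x0}"
    let ?p = "measure M ?E0"
    let ?y = "\<lambda>t. (\<integral>\<omega>. indicator ?E0 \<omega> * (norm (stieltjes (emp n \<theta> (X t \<omega>)) (z0 + of_real t * exp (- a x0)) - a x0))\<^sup>2 \<partial>M)"
    have "?y T \<le> exp (19 * T) * (?y 0 + ?p * (var_const \<theta> / (real n)\<^sup>2) * T)"
    proof (rule discrete_gronwall[where y = ?y and A = 19 and B = "?p * (var_const \<theta> / (real n)\<^sup>2)"
          and K = "?p * (936 + 8 * real (n + 1) * step_const)" and T = T])
      show "0 \<le> ?y t" for t by (intro integral_nonneg_AE) auto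
      show "?y (t + h) \<le> (1 + 19 * h) * ?y t + ?p * (var_const \<theta> / (real n)\<^sup>2) * h
          + ?p * (936 + 8 * real (n + 1) * step_const) * h\<^sup>2"
        if "0 \<le> t" "0 \<le> h" "h \<le> 1" "t + h \<le> T" for t h
        unfolding a_def by (rule conditional_second_moment_step[OF z0 T that])
    qed (use vn T in auto)
    also have "?y 0 = (\<integral>\<omega>. 0 \<partial>M)"
      by (intro Bochner_Integration.integral_cong) (auto simp: a_def indicator_def)
    finally have "?y T \<le> ?p * ?C" by (simp add: algebra_simps)
    also have "\<dots> = (\<integral>\<omega>. indicator ?E0 \<omega> * ?C \<partial>M)"
      using walk_set[of 0 "\<lambda>z. z = x0"] by simp
    finally show "(\<integral>\<omega>. indicator ?E0 \<omega> * ?G (X 0 \<omega>) (X T \<omega>) \<partial>M) \<le> (\<integral>\<omega>. indicator ?E0 \<omega> * ?C \<partial>M)"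
      by (rule order_trans[rotated]) (intro eq_refl Bochner_Integration.integral_cong, auto simp: indicator_def)
  qed auto
  then show ?thesis using prob_space by (simp add: a_def mult_ac)
qed

text \<open>By \<open>gen_vanishes\<close> the whole exponential series is 0 when the target is not
  above the present state; countably many states give a null set.\<close>

lemma walk_mono_AE:
  assumes "0 \<le> s" "s \<le> t"
  shows "AE \<omega> in M. X s \<omega> \<le> X t \<omega>"
proof -
  have null: "{\<omega>\<in>space M. X 0 \<omega> = x0 \<and> X s \<omega> = x} \<inter> {\<omega>\<in>space M. X t \<omega> = y} \<in> null_sets M" if "\<not> x \<le> y" for x0 x y
  proof -
    have "((gen n \<theta> ^^ k) (\<lambda>z. if z = y then 1 else 0)) x = 0" for k
      by (rule gen_vanishes[OF _ that]) auto
    then have "trans_sg n \<theta> (t - s) (\<lambda>z. if z = y then 1 else 0) x = 0" by (simp add: trans_sg_def)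
    then have "measure M ({\<omega>\<in>space M. X 0 \<omega> = x0 \<and> X s \<omega> = x} \<inter> {\<omega>\<in>space M. X t \<omega> = y}) = 0"
      using transition[of s "t - s" x0 x y] assms by simp
    moreover have "{\<omega>\<in>space M. X 0 \<omega> = x0 \<and> X s \<omega> = x} \<inter> {\<omega>\<in>space M. X t \<omega> = y} \<in> sets M"
      using walk_set2[of 0 s "\<lambda>z. z = x0" "\<lambda>z. z = x"] walk_set[of t "\<lambda>z. z = y"] assms by auto
    ultimately show ?thesis by (simp add: null_sets_def emeasure_eq_measure)
  qed
  let ?W = "Wset n \<theta>"
  let ?S = "{(x0, x, y). x0 \<in> ?W \<and> x \<in> ?W \<and> y \<in> ?W \<and> \<not> x \<le> y}"
  have "countable ?S"
    by (rule countable_subset[of _ "?W \<times> ?W \<times> ?W"]) (auto intro: countable_SIGMA countable_Wset)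
  then have "(\<Union>(x0, x, y)\<in>?S. {\<omega>\<in>space M. X 0 \<omega> = x0 \<and> X s \<omega> = x} \<inter> {\<omega>\<in>space M. X t \<omega> = y}) \<in> null_sets M"
    using null by (intro null_sets_UN') auto
  then show ?thesis
  proof (rule AE_I')
    show "{\<omega>\<in>space M. \<not> X s \<omega> \<le> X t \<omega>} \<subseteq> (\<Union>(x0, x, y)\<in>?S. {\<omega>\<in>space M. X 0 \<omega> = x0 \<and> X s \<omega> = x} \<inter> {\<omega>\<in>space M. X t \<omega> = y})"
      using walk_in_Wset assms by fastforce
  qed
qed

text \<open>Rational times give one null set for all pairs, and paths are constant for a while to
  the right of every time.\<close>

lemma walk_mono_all_AE: "AE \<omega> in M. \<forall>s t. 0 \<le> s \<longrightarrow> s \<le> t \<longrightarrow> X s \<omega> \<le> X t \<omega>"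
proof -
  have "AE \<omega> in M. \<forall>p\<in>{p. fst p \<in> \<rat> \<and> snd p \<in> \<rat> \<and> 0 \<le> fst p \<and> fst p \<le> snd p}. X (fst p) \<omega> \<le> X (snd p) \<omega>"
  proof (subst AE_ball_countable)
    show "countable {p. fst p \<in> \<rat> \<and> snd p \<in> \<rat> \<and> 0 \<le> fst p \<and> fst p \<le> snd p}"
      by (rule countable_subset[of _ "\<rat> \<times> \<rat>"]) (auto intro: countable_SIGMA countable_rat)
  qed (auto intro: walk_mono_AE)
  then show ?thesis
    using AE_space
  proof eventually_elim
    case (elim \<omega>)
    then have rat: "X p \<omega> \<le> X q \<omega>" if "p \<in> \<rat>" "q \<in> \<rat>" "0 \<le> p" "p \<le> q" for p q using that by auto
    have right: "\<exists>\<delta>>0. \<forall>s. t \<le> s \<and> s \<le> t + \<delta> \<longrightarrow> X s \<omega> = X t \<omega>" if "t \<ge> 0" for t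
      using walk elim that unfolding is_NIPRW_def by blast
    show ?case
    proof (intro allI impI)
      fix s t :: real assume st: "0 \<le> s" "s \<le> t"
      show "X s \<omega> \<le> X t \<omega>"
      proof (cases "s = t")
        case False
        obtain d1 where d1: "d1 > 0" "\<And>r. s \<le> r \<Longrightarrow> r \<le> s + d1 \<Longrightarrow> X r \<omega> = X s \<omega>" using right[of s] st by blast
        have "t \<ge> 0" using st by linarith
        then obtain d2 where d2: "d2 > 0" "\<And>r. t \<le> r \<Longrightarrow> r \<le> t + d2 \<Longrightarrow> X r \<omega> = X t \<omega>" using right[of t] by blast
        obtain p where p: "p \<in> \<rat>" "s < p" "p < min t (s + d1)" using Rats_dense_in_real[of s "min t (s + d1)"] False st d1 by auto
        obtain q where q: "q \<in> \<rat>" "t < q" "q < t + d2" using Rats_dense_in_real[of t "t + d2"] d2 by auto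
        have "X p \<omega> \<le> X q \<omega>" using p q st by (intro rat) auto
        then show ?thesis using d1(2)[of p] d2(2)[of q] p q by simp
      qed simp
    qed
  qed
qed

end

section \<open>Characteristic lines\<close>

definition char_line :: "real measure \<Rightarrow> real \<Rightarrow> complex \<Rightarrow> complex" where
  "char_line \<mu> t z = z + of_real t * exp (- stieltjes \<mu> z)"

text \<open>On the half plane \<open>Im z > 3 * T + 2\<close> the speed \<open>exp (- m\<^sub>0 z)\<close> has norm at most \<open>3\<close>, so the
  lines stay above height \<open>1\<close> up to time \<open>T\<close>.\<close>
definition char_family :: "real \<Rightarrow> real measure \<Rightarrow> (real \<Rightarrow> real measure) \<Rightarrow> bool" where
  "char_family T \<mu>0 \<mu> \<longleftrightarrow> (\<forall>t\<in>{0..T}. real_distribution (\<mu> t) \<and>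
     (\<forall>z. Im z > 3 * T + 2 \<longrightarrow> stieltjes (\<mu> t) (char_line \<mu>0 t z) = stieltjes \<mu>0 z))"

text \<open>Test points: the even ones accumulate inside the half plane, which identifies a limit,
  and the odd ones tend to \<open>\<i>\<infinity>\<close>, which gives tightness.\<close>
definition test_pt :: "real \<Rightarrow> nat \<Rightarrow> complex" where
  "test_pt T j = (if even j then Complex (1 / real (Suc j)) (3 * T + 3) else \<i> * of_nat (j div 2 + nat \<lceil>3 * T + 3\<rceil>))"

lemma Im_test_pt: "Im (test_pt T j) > 3 * T + 2"
proof (cases "even j")
  case False
  have "3 * T + 3 \<le> real (nat \<lceil>3 * T + 3\<rceil>)" by linarith
  with False show ?thesis by (simp add: test_pt_def)
qed (simp add: test_pt_def)

context
  fixes \<mu>0 :: "real measure" and T t :: real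
  assumes rd0: "real_distribution \<mu>0" and t: "0 \<le> t" "t \<le> T"
begin

interpretation \<mu>0: real_distribution \<mu>0 by (rule rd0)

lemma norm_char_speed_le: "Im z > 3 * T + 2 \<Longrightarrow> norm (exp (- stieltjes \<mu>0 z)) \<le> 3"
  using t by (intro norm_exp_uminus_le_3 \<mu>0.norm_stieltjes_le_1) linarith

lemma norm_char_shift_le: "Im z > 3 * T + 2 \<Longrightarrow> norm (of_real t * exp (- stieltjes \<mu>0 z)) \<le> 3 * T"
  using mult_mono[OF t(2) norm_char_speed_le, of z] t by (simp add: norm_mult)

lemma Im_char_line: "Im z > 3 * T + 2 \<Longrightarrow> Im (char_line \<mu>0 t z) > Im z - 3 * T - 1"
  using norm_char_shift_le[of z] abs_Im_le_cmod[of "of_real t * exp (- stieltjes \<mu>0 z)"]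
  by (simp add: char_line_def)

lemma Im_char_line_ge_1: "Im z > 3 * T + 2 \<Longrightarrow> Im (char_line \<mu>0 t z) \<ge> 1"
  using Im_char_line[of z] by simp

text \<open>The speed has Lipschitz constant at most 3 / (3 T + 2)^2 in this half plane, and 3 T /
  (3 T + 2)^2 <= 1/2. Injectivity and surjectivity of the flow follow.\<close>

lemma char_speed_contraction:
  assumes "Im z > 3 * T + 2" "Im w > 3 * T + 2"
  shows "norm (of_real t * exp (- stieltjes \<mu>0 z) - of_real t * exp (- stieltjes \<mu>0 w)) \<le> norm (z - w) / 2"
proof -
  have T: "T \<ge> 0" using t by simp
  have n1: "norm (stieltjes \<mu>0 z) \<le> 1" "norm (stieltjes \<mu>0 w) \<le> 1"
    using assms T by (auto intro!: \<mu>0.norm_stieltjes_le_1)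
  have "norm (exp (- stieltjes \<mu>0 z) - exp (- stieltjes \<mu>0 w)) \<le> 3 * norm (stieltjes \<mu>0 z - stieltjes \<mu>0 w)"
    by (rule norm_exp_uminus_diff_le_3[OF n1])
  also have "\<dots> \<le> 3 * (norm (z - w) / (\<bar>Im z\<bar> * \<bar>Im w\<bar>))"
    using assms T by (intro mult_left_mono \<mu>0.stieltjes_lipschitz) auto
  also have "\<dots> \<le> 3 * (norm (z - w) / ((3 * T + 2) * (3 * T + 2)))"
    using assms T by (intro mult_left_mono divide_left_mono mult_mono mult_pos_pos) auto
  finally have "t * norm (exp (- stieltjes \<mu>0 z) - exp (- stieltjes \<mu>0 w)) \<le> T * (3 * (norm (z - w) / ((3 * T + 2) * (3 * T + 2))))"
    using t by (intro mult_mono) auto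
  also have "\<dots> = norm (z - w) * (3 * T / ((3 * T + 2) * (3 * T + 2)))" by simp
  also have "\<dots> \<le> norm (z - w) * (1 / 2)"
    using T by (intro mult_left_mono) (auto simp: divide_simps algebra_simps add_nonneg_eq_0_iff)
  finally show ?thesis using t by (simp add: right_diff_distrib[symmetric] norm_mult)
qed

lemma char_line_inj:
  assumes "Im z > 3 * T + 2" "Im w > 3 * T + 2" "char_line \<mu>0 t z = char_line \<mu>0 t w"
  shows "z = w"
proof -
  have "z - w = of_real t * exp (- stieltjes \<mu>0 w) - of_real t * exp (- stieltjes \<mu>0 z)"
    using assms(3) by (simp add: char_line_def algebra_simps)
  then have "norm (z - w) \<le> norm (w - z) / 2" using char_speed_contraction[OF assms(2,1)] by simp
  then show ?thesis by (simp add: norm_minus_commute)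
qed

text \<open>The starting point is the fixed point of w = z - t exp (- m(w)). A line descends by at
  most 3 T, so height 6 T + 4 of z leaves the iterates above 3 T + 3.\<close>

lemma char_line_surj:
  assumes "Im z > 6 * T + 4"
  shows "\<exists>z0. Im z0 > 3 * T + 2 \<and> z = char_line \<mu>0 t z0"
proof -
  have T: "T \<ge> 0" using t by simp
  \<comment> \<open>A closed half plane inside the open one, for completeness.\<close>
  let ?S = "{w. Im w \<ge> 3 * T + 3}"
  let ?f = "\<lambda>w. z - of_real t * exp (- stieltjes \<mu>0 w)"
  have "\<exists>!w\<in>?S. ?f w = w"
  proof (rule Banach_fix[OF complete_eq_closed[THEN iffD2], of _ "1 / 2"])
    show "closed ?S" by (simp add: closed_halfspace_Im_ge)
    have "Complex 0 (3 * T + 3) \<in> ?S" by simp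
    then show "?S \<noteq> {}" by blast
    show "?f ` ?S \<subseteq> ?S"
    proof clarify
      fix w assume w: "Im w \<ge> 3 * T + 3"
      then show "Im (?f w) \<ge> 3 * T + 3"
        using norm_char_shift_le[of w] abs_Im_le_cmod[of "of_real t * exp (- stieltjes \<mu>0 w)"] assms by simp
    qed
    show "\<And>x y. x \<in> ?S \<Longrightarrow> y \<in> ?S \<Longrightarrow> dist (?f x) (?f y) \<le> 1 / 2 * dist x y"
      using char_speed_contraction by (simp add: dist_norm norm_minus_commute)
  qed auto
  then obtain w where w: "Im w \<ge> 3 * T + 3" "?f w = w" by auto
  then show ?thesis by (intro exI[of _ w]) (auto simp: char_line_def algebra_simps)
qed

lemma isCont_char_line: "Im z > 3 * T + 2 \<Longrightarrow> isCont (char_line \<mu>0 t) z"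
  unfolding char_line_def using t
  by (intro continuous_intros DERIV_isCont[OF \<mu>0.DERIV_stieltjes]) auto

definition "char_pts = char_line \<mu>0 t ` test_pt T ` {j. even j}"

lemma char_pts_subset: "char_pts \<subseteq> {z. Im z > 0}"
  by (auto simp: char_pts_def intro!: less_le_trans[OF zero_less_one Im_char_line_ge_1[OF Im_test_pt]])

lemma even_test_pt_islimpt: "Complex 0 (3 * T + 3) islimpt test_pt T ` {j. even j}"
  unfolding islimpt_sequential
proof (intro exI[of _ "\<lambda>k. test_pt T (2 * k)"] conjI allI)
  show "test_pt T (2 * k) \<in> test_pt T ` {j. even j} - {Complex 0 (3 * T + 3)}" for k
  proof
    show "test_pt T (2 * k) \<in> test_pt T ` {j. even j}" by (rule imageI) simp
    show "test_pt T (2 * k) \<notin> {Complex 0 (3 * T + 3)}" by (simp add: test_pt_def)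
  qed
  have "(\<lambda>k. 1 / real (Suc (2 * k))) \<longlonglongrightarrow> 0" by real_asymp
  then show "(\<lambda>k. test_pt T (2 * k)) \<longlonglongrightarrow> Complex 0 (3 * T + 3)"
    unfolding test_pt_def by (simp add: tendsto_Complex)
qed

text \<open>Injectivity keeps the images different from the image of the limit point, so they still
  accumulate there.\<close>

lemma char_pts_islimpt: "char_line \<mu>0 t (Complex 0 (3 * T + 3)) islimpt char_pts"
proof -
  let ?z = "Complex 0 (3 * T + 3)"
  have z: "Im ?z > 3 * T + 2" by simp
  obtain f where f: "\<And>k. f k \<in> test_pt T ` {j. even j} - {?z}" "f \<longlonglongrightarrow> ?z"
    using even_test_pt_islimpt unfolding islimpt_sequential by blast
  show ?thesis unfolding islimpt_sequential
  proof (intro exI[of _ "\<lambda>k. char_line \<mu>0 t (f k)"] conjI allI)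
    fix k
    obtain j where j: "even j" "f k = test_pt T j" "f k \<noteq> ?z" using f(1)[of k] by auto
    then have "char_line \<mu>0 t (f k) \<noteq> char_line \<mu>0 t ?z" using char_line_inj[OF _ z] Im_test_pt by metis
    then show "char_line \<mu>0 t (f k) \<in> char_pts - {char_line \<mu>0 t ?z}" using j by (auto simp: char_pts_def)
    show "(\<lambda>k. char_line \<mu>0 t (f k)) \<longlonglongrightarrow> char_line \<mu>0 t ?z"
      by (rule isCont_tendsto_compose[OF isCont_char_line[OF z] f(2)])
  qed
qed

lemma tight_of_test_pts:
  assumes "\<And>n. real_distribution (P n)"
    and "\<And>j. (\<lambda>n. stieltjes (P n) (char_line \<mu>0 t (test_pt T j))) \<longlonglongrightarrow> stieltjes \<mu>0 (test_pt T j)"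
  shows "tight P"
proof (rule tight_of_stieltjes_along_lines[OF assms(1) rd0])
  let ?N = "nat \<lceil>3 * T + 3\<rceil>"
  fix k assume k: "k \<ge> ?N"
  \<comment> \<open>This odd index halves to k - N, and the offset N in \<open>test_pt\<close>
    restores k.\<close>
  have pt: "test_pt T (2 * (k - ?N) + 1) = \<i> * of_nat k" using k by (simp add: test_pt_def)
  show "norm (of_real t * exp (- stieltjes \<mu>0 (\<i> * of_nat k))) \<le> 3 * T"
    using norm_char_shift_le[OF Im_test_pt, of "2 * (k - ?N) + 1"] unfolding pt .
  show "(\<lambda>n. stieltjes (P n) (\<i> * of_nat k + of_real t * exp (- stieltjes \<mu>0 (\<i> * of_nat k))))
      \<longlonglongrightarrow> stieltjes \<mu>0 (\<i> * of_nat k)"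
    using assms(2)[of "2 * (k - ?N) + 1"] unfolding pt char_line_def .
qed

lemma weak_conv_of_test_pts:
  assumes "\<And>n. real_distribution (P n)" "real_distribution \<nu>"
    and "\<And>j. (\<lambda>n. stieltjes (P n) (char_line \<mu>0 t (test_pt T j))) \<longlonglongrightarrow> stieltjes \<mu>0 (test_pt T j)"
    and "\<And>j. even j \<Longrightarrow> stieltjes \<nu> (char_line \<mu>0 t (test_pt T j)) = stieltjes \<mu>0 (test_pt T j)"
  shows "weak_conv_m P \<nu>"
proof (rule weak_conv_of_stieltjes[OF assms(1,2) tight_of_test_pts char_pts_subset char_pts_islimpt])
  have "Im (Complex 0 (3 * T + 3)) > 3 * T + 2" by simp
  from Im_char_line_ge_1[OF this] show "Im (char_line \<mu>0 t (Complex 0 (3 * T + 3))) > 0" by simp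
  fix z assume "z \<in> char_pts"
  then show "(\<lambda>n. stieltjes (P n) z) \<longlonglongrightarrow> stieltjes \<nu> z" using assms(3,4) by (auto simp: char_pts_def)
qed (use assms in auto)

text \<open>The identity theorem is applied in the starting point z, where both sides are
  holomorphic.\<close>

lemma char_line_eq_of_test_pts:
  assumes "real_distribution \<nu>"
    and "\<And>j. even j \<Longrightarrow> stieltjes \<nu> (char_line \<mu>0 t (test_pt T j)) = stieltjes \<mu>0 (test_pt T j)"
    and z: "Im z > 3 * T + 2"
  shows "stieltjes \<nu> (char_line \<mu>0 t z) = stieltjes \<mu>0 z"
proof -
  interpret \<nu>: real_distribution \<nu> by fact
  let ?S = "{z. Im z > 3 * T + 2}"
  have sub: "?S \<subseteq> {z. Im z > 0}" using t by auto
  have "(stieltjes \<nu> \<circ> char_line \<mu>0 t) holomorphic_on ?S"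
  proof (rule holomorphic_on_compose_gen[OF _ \<nu>.holomorphic_stieltjes])
    show "char_line \<mu>0 t holomorphic_on ?S"
      unfolding char_line_def[abs_def]
      by (intro holomorphic_intros holomorphic_on_subset[OF \<mu>0.holomorphic_stieltjes sub])
    show "char_line \<mu>0 t ` ?S \<subseteq> {z. Im z > 0}" by (auto intro!: less_le_trans[OF zero_less_one Im_char_line_ge_1])
  qed
  then have hol: "(\<lambda>z. stieltjes \<nu> (char_line \<mu>0 t z) - stieltjes \<mu>0 z) holomorphic_on ?S"
    unfolding o_def by (intro holomorphic_intros holomorphic_on_subset[OF \<mu>0.holomorphic_stieltjes sub])
  have "stieltjes \<nu> (char_line \<mu>0 t z) - stieltjes \<mu>0 z = 0"
    by (rule analytic_continuation[OF hol _ _ _ _ even_test_pt_islimpt])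
       (use z assms(2) Im_test_pt in \<open>auto intro!: convex_connected convex_halfspace_Im_gt open_halfspace_Im_gt\<close>)
  then show ?thesis by simp
qed

end

section \<open>The limit process\<close>

lemma char_familyD:
  assumes "char_family T \<mu>0 \<mu>" "0 \<le> t" "t \<le> T"
  shows "real_distribution (\<mu> t)"
    and "Im z > 3 * T + 2 \<Longrightarrow> stieltjes (\<mu> t) (char_line \<mu>0 t z) = stieltjes \<mu>0 z"
  using assms unfolding char_family_def by auto

lemma char_family_unique:
  assumes "real_distribution \<mu>0" "char_family T \<mu>0 \<mu>" "char_family T \<mu>0 \<nu>" "0 \<le> t" "t \<le> T"
  shows "\<mu> t = \<nu> t"
proof (rule stieltjes_unique_accumulation[OF _ _ char_pts_subset[OF assms(1,4,5)] char_pts_islimpt[OF assms(1,4,5)]])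
  show "real_distribution (\<mu> t)" "real_distribution (\<nu> t)" using char_familyD assms by blast+
  have "Im (Complex 0 (3 * T + 3)) > 3 * T + 2" by simp
  from Im_char_line_ge_1[OF assms(1,4,5) this] show "Im (char_line \<mu>0 t (Complex 0 (3 * T + 3))) > 0" by simp
  fix z assume "z \<in> char_pts \<mu>0 T t"
  then obtain j where "z = char_line \<mu>0 t (test_pt T j)" by (auto simp: char_pts_def[OF assms(1,4,5)])
  then show "stieltjes (\<mu> t) z = stieltjes (\<nu> t) z"
    using char_familyD(2)[OF assms(2,4,5) Im_test_pt] char_familyD(2)[OF assms(3,4,5) Im_test_pt] by simp
qed

text \<open>The identity along lines is exact at every time. So for a test point only the end of the
  line moves, by at most 3 |t - s k|, and above height 1 transforms have Lipschitz constant
  1.\<close>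

lemma char_family_weak_cont:
  assumes rd0: "real_distribution \<mu>0" and cf: "char_family T \<mu>0 \<mu>"
    and s: "\<And>k::nat. 0 \<le> s k" "\<And>k. s k \<le> T" "s \<longlonglongrightarrow> t" and t: "0 \<le> t" "t \<le> T"
  shows "weak_conv_m (\<lambda>k. \<mu> (s k)) (\<mu> t)"
proof (rule weak_conv_of_test_pts[OF rd0 t])
  fix j
  let ?z = "test_pt T j"
  let ?c = "exp (- stieltjes \<mu>0 ?z)"
  have lim: "(\<lambda>k. \<bar>t - s k\<bar> * 3) \<longlonglongrightarrow> 0"
    using tendsto_mult_left_zero[OF tendsto_rabs_zero[OF LIM_zero[OF s(3)]], of 3] by (simp add: abs_minus_commute)
  have "norm (stieltjes (\<mu> (s k)) (char_line \<mu>0 t ?z) - stieltjes \<mu>0 ?z) \<le> \<bar>t - s k\<bar> * 3" for k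
  proof -
    interpret \<nu>: real_distribution "\<mu> (s k)" by (rule char_familyD(1)[OF cf s(1,2)])
    have im: "Im (char_line \<mu>0 t ?z) \<ge> 1" "Im (char_line \<mu>0 (s k) ?z) \<ge> 1"
      using Im_char_line_ge_1[OF rd0 t Im_test_pt] Im_char_line_ge_1[OF rd0 s(1,2) Im_test_pt] by auto
    have "norm (stieltjes (\<mu> (s k)) (char_line \<mu>0 t ?z) - stieltjes (\<mu> (s k)) (char_line \<mu>0 (s k) ?z))
       \<le> norm (char_line \<mu>0 t ?z - char_line \<mu>0 (s k) ?z) / (\<bar>Im (char_line \<mu>0 t ?z)\<bar> * \<bar>Im (char_line \<mu>0 (s k) ?z)\<bar>)"
      using im by (intro \<nu>.stieltjes_lipschitz) auto
    also have "\<dots> \<le> norm (char_line \<mu>0 t ?z - char_line \<mu>0 (s k) ?z) / 1"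
      using im mult_mono[of 1 "Im (char_line \<mu>0 t ?z)" 1 "Im (char_line \<mu>0 (s k) ?z)"] by (intro divide_left_mono) auto
    also have "char_line \<mu>0 t ?z - char_line \<mu>0 (s k) ?z = of_real (t - s k) * ?c"
      by (simp add: char_line_def algebra_simps)
    also have "norm (of_real (t - s k) * ?c) / 1 \<le> \<bar>t - s k\<bar> * 3"
      using norm_char_speed_le[OF rd0 t Im_test_pt, of j] by (simp add: norm_mult mult_left_mono del: of_real_diff)
    finally show ?thesis using char_familyD(2)[OF cf s(1,2) Im_test_pt] by simp
  qed
  then show "(\<lambda>k. stieltjes (\<mu> (s k)) (char_line \<mu>0 t ?z)) \<longlonglongrightarrow> stieltjes \<mu>0 ?z"
    by (intro LIM_zero_cancel[OF Lim_null_comparison[OF _ lim]]) simp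
next
  show "stieltjes (\<mu> t) (char_line \<mu>0 t (test_pt T j)) = stieltjes \<mu>0 (test_pt T j)" for j
    by (rule char_familyD(2)[OF cf t Im_test_pt])
qed (use char_familyD(1)[OF cf] s t in auto)

text \<open>Weak continuity becomes uniform by compactness: both time sequences of a counterexample
  have a common limit u.\<close>

lemma char_family_levy_uniform:
  assumes rd0: "real_distribution \<mu>0" and cf: "char_family T \<mu>0 \<mu>"
    and atomless: "\<And>t x. 0 \<le> t \<Longrightarrow> t \<le> T \<Longrightarrow> measure (\<mu> t) {x} = 0" and "\<epsilon> > 0"
  shows "\<exists>\<delta>>0. \<forall>s t. 0 \<le> s \<longrightarrow> s \<le> T \<longrightarrow> 0 \<le> t \<longrightarrow> t \<le> T \<longrightarrow> \<bar>s - t\<bar> < \<delta> \<longrightarrow> levy_le \<epsilon> (\<mu> s) (\<mu> t)"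
proof (rule ccontr)
  assume "\<not> ?thesis"
  then have "\<exists>s t. 0 \<le> s \<and> s \<le> T \<and> 0 \<le> t \<and> t \<le> T \<and> \<bar>s - t\<bar> < 1 / real (Suc k) \<and> \<not> levy_le \<epsilon> (\<mu> s) (\<mu> t)" for k
    by (auto dest!: spec[of _ "1 / real (Suc k)"])
  then obtain s t where st: "\<And>k. 0 \<le> s k" "\<And>k. s k \<le> T" "\<And>k. 0 \<le> t k" "\<And>k. t k \<le> T"
      "\<And>k. \<bar>s k - t k\<bar> < 1 / real (Suc k)" "\<And>k. \<not> levy_le \<epsilon> (\<mu> (s k)) (\<mu> (t k))"
    by metis
  have "\<forall>k. s k \<in> {0..T}" using st by auto
  then obtain u r where ur: "u \<in> {0..T}" "strict_mono (r :: nat \<Rightarrow> nat)" "(s \<circ> r) \<longlonglongrightarrow> u"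
    using compact_Icc[of 0 T] unfolding compact_def by blast
  have u: "0 \<le> u" "u \<le> T" using ur by auto
  have "(\<lambda>k. 1 / real (Suc (r k))) \<longlonglongrightarrow> 0"
    using LIMSEQ_subseq_LIMSEQ[OF LIMSEQ_inverse_real_of_nat ur(2)] by (simp add: o_def divide_inverse)
  then have "(\<lambda>k. s (r k) - t (r k)) \<longlonglongrightarrow> 0"
    by (rule Lim_null_comparison[rotated]) (use st(5) in \<open>auto intro!: always_eventually less_imp_le\<close>)
  from tendsto_diff[OF ur(3)[unfolded o_def] this] have tr: "(\<lambda>k. t (r k)) \<longlonglongrightarrow> u" by simp
  have rd: "real_distribution (\<mu> v)" if "0 \<le> v" "v \<le> T" for v using char_familyD(1)[OF cf that] .
  have "(\<lambda>k. levy (\<mu> (s (r k))) (\<mu> u)) \<longlonglongrightarrow> 0" "(\<lambda>k. levy (\<mu> (t (r k))) (\<mu> u)) \<longlonglongrightarrow> 0"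
    using st u tr ur(3) atomless
    by (auto intro!: weak_conv_imp_levy_tendsto char_family_weak_cont[OF rd0 cf] rd simp: o_def)
  then have "eventually (\<lambda>k. levy (\<mu> (s (r k))) (\<mu> u) < \<epsilon> / 2 \<and> levy (\<mu> (t (r k))) (\<mu> u) < \<epsilon> / 2) sequentially"
    using \<open>\<epsilon> > 0\<close> by (intro eventually_conj order_tendstoD) auto
  then obtain k where "levy (\<mu> (s (r k))) (\<mu> u) < \<epsilon> / 2" "levy (\<mu> (t (r k))) (\<mu> u) < \<epsilon> / 2"
    by (auto simp: eventually_sequentially)
  then have "levy_le (\<epsilon> / 2) (\<mu> (s (r k))) (\<mu> u)" "levy_le (\<epsilon> / 2) (\<mu> u) (\<mu> (t (r k)))"
    using levy_less_imp[OF rd rd] st u levy_le_sym by blast+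
  then have "levy_le (\<epsilon> / 2 + \<epsilon> / 2) (\<mu> (s (r k))) (\<mu> (t (r k)))" by (rule levy_le_trans)
  with st(6) show False by simp
qed

text \<open>The equation presupposes only integrability in time, so regularity is first extracted
  from it: boundedness of the integrand by 36 = 9 * 4 makes the transform Lipschitz in time, and a
  Cauchy estimate does the same for the integrand, with 648 = 2 * 9 * 36. Then the deviation along a
  line obeys the same step inequality as the walk, without noise.\<close>

lemma limit_process_imp_char_family:
  assumes T: "T \<ge> 0" and lp: "limit_process T \<mu>0 \<mu>"
  shows "char_family T \<mu>0 \<mu>"
  unfolding char_family_def
proof (intro ballI conjI allI impI)
  show rd: "real_distribution (\<mu> t)" if "t \<in> {0..T}" for t
    using lp that unfolding limit_process_def M1_iff by blast
  have mu0: "\<mu> 0 = \<mu>0" using lp by (simp add: limit_process_def)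
  define \<phi> where "\<phi> s z = exp (- stieltjes (\<mu> s) z) * stieltjes' (\<mu> s) z" for s z
  have eq: "(\<lambda>s. \<phi> s z) integrable_on {0..t}" "stieltjes (\<mu> t) z = stieltjes (\<mu> 0) z - integral {0..t} (\<lambda>s. \<phi> s z)"
    if "Im z \<noteq> 0" "t \<in> {0..T}" for z t
  proof -
    have cong: "exp (- stieltjes (\<mu> s) z) * deriv (stieltjes (\<mu> s)) z = \<phi> s z" if "s \<in> {0..t}" for s
      using real_distribution.deriv_stieltjes[OF rd \<open>Im z \<noteq> 0\<close>, of s] that \<open>t \<in> {0..T}\<close> by (simp add: \<phi>_def)
    have lp': "(\<lambda>s. exp (- stieltjes (\<mu> s) z) * deriv (stieltjes (\<mu> s)) z) integrable_on {0..t} \<and>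
        stieltjes (\<mu> t) z = stieltjes (\<mu> 0) z - integral {0..t} (\<lambda>s. exp (- stieltjes (\<mu> s) z) * deriv (stieltjes (\<mu> s)) z)"
      using lp that unfolding limit_process_def by blast
    show "(\<lambda>s. \<phi> s z) integrable_on {0..t}" using lp' cong by (auto elim: integrable_eq)
    show "stieltjes (\<mu> t) z = stieltjes (\<mu> 0) z - integral {0..t} (\<lambda>s. \<phi> s z)"
      using lp' integral_cong[of "{0..t}" "\<lambda>s. exp (- stieltjes (\<mu> s) z) * deriv (stieltjes (\<mu> s)) z" "\<lambda>s. \<phi> s z"] cong by simp
  qed
  have inc: "((\<lambda>u. \<phi> u z) has_integral (stieltjes (\<mu> s) z - stieltjes (\<mu> t) z)) {s..t}"
    if "Im z \<noteq> 0" "0 \<le> s" "s \<le> t" "t \<le> T" for s t z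
  proof -
    have int: "(\<lambda>u. \<phi> u z) integrable_on {0..t}" using that by (intro eq) auto
    have "(\<lambda>u. \<phi> u z) integrable_on {s..t}" by (rule integrable_on_subinterval[OF int]) (use that in auto)
    moreover have tot: "integral {0..s} (\<lambda>u. \<phi> u z) + integral {s..t} (\<lambda>u. \<phi> u z) = integral {0..t} (\<lambda>u. \<phi> u z)"
      using that int by (intro Henstock_Kurzweil_Integration.integral_combine) auto
    moreover have e: "stieltjes (\<mu> t) z = stieltjes (\<mu> 0) z - integral {0..t} (\<lambda>s. \<phi> s z)"
      "stieltjes (\<mu> s) z = stieltjes (\<mu> 0) z - integral {0..s} (\<lambda>s. \<phi> s z)"
      using that by (auto intro!: eq)
    moreover have "integral {s..t} (\<lambda>u. \<phi> u z) = stieltjes (\<mu> s) z - stieltjes (\<mu> t) z"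
      unfolding e tot[symmetric] by simp
    ultimately show ?thesis by (simp only: has_integral_iff)
  qed
  have \<phi>_bd: "norm (\<phi> s z) \<le> 36" if "Im z \<ge> 1 / 2" "0 \<le> s" "s \<le> T" for s z
  proof -
    interpret \<nu>: real_distribution "\<mu> s" using that by (intro rd) auto
    have "norm (stieltjes' (\<mu> s) z) \<le> 4" using \<nu>.norm_stieltjes'_le_of_Im[of "1/2" z] that by (simp add: power2_eq_square)
    then have "norm (\<phi> s z) \<le> 9 * 4"
      unfolding \<phi>_def norm_mult using that by (intro mult_mono norm_exp_uminus_le_9 \<nu>.norm_stieltjes_le_2) auto
    then show ?thesis by simp
  qed
  have lip: "norm (stieltjes (\<mu> t) z - stieltjes (\<mu> s) z) \<le> 36 * (t - s)"
    if "Im z \<ge> 1 / 2" "0 \<le> s" "s \<le> t" "t \<le> T" for s t z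
  proof -
    have im: "Im z \<noteq> 0" using that by auto
    have "norm (stieltjes (\<mu> s) z - stieltjes (\<mu> t) z) \<le> 36 * measure lborel {s..t}"
      by (rule has_integral_bound_real[OF _ _ inc[OF im that(2-4)], of 36 "{}"]) (use that \<phi>_bd in auto)
    then show ?thesis using that by (simp add: norm_minus_commute)
  qed
  have \<phi>_lip: "norm (\<phi> t z - \<phi> s z) \<le> 648 * (t - s)" if "Im z \<ge> 1" "0 \<le> s" "s \<le> t" "t \<le> T" for s t z
  proof -
    interpret s: real_distribution "\<mu> s" using that by (intro rd) auto
    interpret t: real_distribution "\<mu> t" using that by (intro rd) auto
    let ?f = "\<lambda>z. exp (- stieltjes (\<mu> s) z) - exp (- stieltjes (\<mu> t) z)"
    have bd: "norm (?f w) \<le> 9 * (36 * (t - s))" if "Im w \<ge> 1 / 2" for w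
    proof -
      have "norm (?f w) \<le> 9 * norm (stieltjes (\<mu> s) w - stieltjes (\<mu> t) w)"
        using that by (intro norm_exp_uminus_diff_le_9 s.norm_stieltjes_le_2 t.norm_stieltjes_le_2)
      also have "\<dots> \<le> 9 * (36 * (t - s))"
        using lip[OF that \<open>0 \<le> s\<close> \<open>s \<le> t\<close> \<open>t \<le> T\<close>] by (simp add: norm_minus_commute)
      finally show ?thesis .
    qed
    have "norm ((deriv ^^ 1) ?f z) \<le> fact 1 * (9 * (36 * (t - s))) * 2 ^ 1"
      by (rule norm_deriv_le_half_plane[OF _ bd \<open>Im z \<ge> 1\<close>])
         (intro holomorphic_on_diff s.holomorphic_exp_stieltjes t.holomorphic_exp_stieltjes)
    moreover have "deriv ?f z = - \<phi> s z - - \<phi> t z"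
      using DERIV_diff[OF s.DERIV_exp_stieltjes[of z] t.DERIV_exp_stieltjes[of z]] that
      by (intro DERIV_imp_deriv) (simp add: \<phi>_def)
    ultimately show ?thesis by simp
  qed
  fix t z assume t: "t \<in> {0..T}" and z: "Im z > 3 * T + 2"
  have rd0: "real_distribution \<mu>0" using rd[of 0] mu0 T by simp
  let ?a = "stieltjes \<mu>0 z"
  let ?w = "\<lambda>t. char_line \<mu>0 t z"
  let ?y = "\<lambda>t. norm (stieltjes (\<mu> t) (?w t) - ?a)"
  have "?y t \<le> exp (3 * t) * (?y 0 + 0 * t)"
  \<comment> \<open>B = 0 because there is no fluctuation; 666 = 18 + 648, from
    \<open>stieltjes_step\<close> and from freezing the integrand at time s.\<close>
  proof (rule discrete_gronwall[where y = ?y and A = 3 and B = 0 and K = 666 and T = t])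
    fix s h assume sh: "0 \<le> s" "0 \<le> h" "h \<le> 1" "s + h \<le> t"
    interpret s: real_distribution "\<mu> s" using sh t by (intro rd) auto
    have im: "Im (?w s) \<ge> 1" "Im (?w (s + h)) \<ge> 1"
      using sh t z by (auto intro!: Im_char_line_ge_1[OF rd0, where T = T])
    have w: "?w (s + h) = ?w s + of_real h * exp (- ?a)" by (simp add: char_line_def algebra_simps)
    have na: "norm ?a \<le> 1" using z T by (intro real_distribution.norm_stieltjes_le_1[OF rd0]) auto
    have 1: "norm (stieltjes (\<mu> s) (?w (s + h)) - ?a - of_real h * \<phi> s (?w (s + h))) \<le> (1 + 3 * h) * ?y s + 18 * h\<^sup>2"
      unfolding w \<phi>_def by (rule s.stieltjes_step[OF im(1) im(2)[unfolded w] sh(2) na refl])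
    let ?v = "?w (s + h)"
    have v: "Im ?v \<noteq> 0" using im by auto
    have sT: "s + h \<le> T" using sh t by auto
    have const: "((\<lambda>u. \<phi> s ?v) has_integral (s + h - s) *\<^sub>R \<phi> s ?v) {s..s + h}"
      using has_integral_const_real[of "\<phi> s ?v" s "s + h"] sh by simp
    have hi: "((\<lambda>u. \<phi> u ?v - \<phi> s ?v) has_integral (stieltjes (\<mu> s) ?v - stieltjes (\<mu> (s + h)) ?v) - (s + h - s) *\<^sub>R \<phi> s ?v) {s..s + h}"
      using sh by (intro has_integral_diff inc[OF v sh(1) _ sT] const) auto
    have "norm ((stieltjes (\<mu> s) ?v - stieltjes (\<mu> (s + h)) ?v) - (s + h - s) *\<^sub>R \<phi> s ?v) \<le> (648 * h) * measure lborel {s..s + h}"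
    proof (rule has_integral_bound_real[OF _ _ hi, of "648 * h" "{}"])
      fix u assume "u \<in> {s..s + h} - {}"
      then have u: "s \<le> u" "u \<le> T" "u - s \<le> h" using sT by auto
      have "norm (\<phi> u ?v - \<phi> s ?v) \<le> 648 * (u - s)" by (rule \<phi>_lip[OF im(2) sh(1) u(1,2)])
      then show "norm (\<phi> u ?v - \<phi> s ?v) \<le> 648 * h" using u by simp
    qed (use sh in auto)
    then have 2: "norm (stieltjes (\<mu> (s + h)) ?v - stieltjes (\<mu> s) ?v + of_real h * \<phi> s ?v) \<le> 648 * h\<^sup>2"
      using sh norm_minus_cancel[of "stieltjes (\<mu> (s + h)) ?v - stieltjes (\<mu> s) ?v + of_real h * \<phi> s ?v"]
      by (simp add: scaleR_conv_of_real power2_eq_square)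
    have "stieltjes (\<mu> (s + h)) ?v - ?a = (stieltjes (\<mu> s) ?v - ?a - of_real h * \<phi> s ?v)
        + (stieltjes (\<mu> (s + h)) ?v - stieltjes (\<mu> s) ?v + of_real h * \<phi> s ?v)" by simp
    then have "?y (s + h) \<le> ((1 + 3 * h) * ?y s + 18 * h\<^sup>2) + 648 * h\<^sup>2"
      using norm_triangle_le[OF add_mono[OF 1 2]] by simp
    then show "?y (s + h) \<le> (1 + 3 * h) * ?y s + 0 * h + 666 * h\<^sup>2" by simp
  qed (use t in auto)
  also have "?y 0 = 0" by (simp add: mu0 char_line_def)
  finally show "stieltjes (\<mu> t) (?w t) = ?a" by simp
qed

text \<open>The Lipschitz constants in z depend on heights only, not on the measure, so the moving
  argument w k may be replaced by z.\<close>

lemma char_family_joint_limit: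
  assumes rd0: "real_distribution \<mu>0" and cf: "char_family T \<mu>0 \<mu>"
    and s: "\<And>k::nat. 0 \<le> s k" "\<And>k. s k \<le> T" "s \<longlonglongrightarrow> t" and t: "0 \<le> t" "t \<le> T"
    and w: "\<And>k. Im (w k) \<noteq> 0" "w \<longlonglongrightarrow> z" "Im z \<noteq> 0"
  shows "(\<lambda>k. stieltjes (\<mu> (s k)) (w k)) \<longlonglongrightarrow> stieltjes (\<mu> t) z"
    and "(\<lambda>k. stieltjes' (\<mu> (s k)) (w k)) \<longlonglongrightarrow> stieltjes' (\<mu> t) z"
proof -
  have rd: "real_distribution (\<mu> (s k))" "real_distribution (\<mu> t)" for k
    using char_familyD(1)[OF cf] s t by auto
  note wc = char_family_weak_cont[OF rd0 cf s t]
  have 1: "(\<lambda>k. norm (w k - z) / (\<bar>Im (w k)\<bar> * \<bar>Im z\<bar>)) \<longlonglongrightarrow> norm (z - z) / (\<bar>Im z\<bar> * \<bar>Im z\<bar>)"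
    by (intro tendsto_intros w) (use w(3) in simp)
  then have "(\<lambda>k. norm (w k - z) / (\<bar>Im (w k)\<bar> * \<bar>Im z\<bar>)) \<longlonglongrightarrow> 0" by simp
  from Lim_null_comparison[OF _ this, of "\<lambda>k. stieltjes (\<mu> (s k)) (w k) - stieltjes (\<mu> (s k)) z"]
  have "(\<lambda>k. stieltjes (\<mu> (s k)) (w k) - stieltjes (\<mu> (s k)) z) \<longlonglongrightarrow> 0"
    using real_distribution.stieltjes_lipschitz[OF rd(1) w(3,1)] by simp
  from tendsto_add[OF this weak_conv_imp_stieltjes_tendsto[OF rd wc w(3)]]
  show "(\<lambda>k. stieltjes (\<mu> (s k)) (w k)) \<longlonglongrightarrow> stieltjes (\<mu> t) z" by simp
  have "(\<lambda>k. norm (w k - z) / (\<bar>Im (w k)\<bar> * \<bar>Im z\<bar>) * (1 / \<bar>Im (w k)\<bar> + 1 / \<bar>Im z\<bar>))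
      \<longlonglongrightarrow> norm (z - z) / (\<bar>Im z\<bar> * \<bar>Im z\<bar>) * (1 / \<bar>Im z\<bar> + 1 / \<bar>Im z\<bar>)"
    by (intro tendsto_intros w) (use w(3) in simp_all)
  then have "(\<lambda>k. norm (w k - z) / (\<bar>Im (w k)\<bar> * \<bar>Im z\<bar>) * (1 / \<bar>Im (w k)\<bar> + 1 / \<bar>Im z\<bar>)) \<longlonglongrightarrow> 0" by simp
  from Lim_null_comparison[OF _ this, of "\<lambda>k. stieltjes' (\<mu> (s k)) (w k) - stieltjes' (\<mu> (s k)) z"]
  have "(\<lambda>k. stieltjes' (\<mu> (s k)) (w k) - stieltjes' (\<mu> (s k)) z) \<longlonglongrightarrow> 0"
    using real_distribution.stieltjes'_lipschitz[OF rd(1) w(3,1)] by simp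
  from tendsto_add[OF this weak_conv_imp_stieltjes'_tendsto[OF rd wc w(3)]]
  show "(\<lambda>k. stieltjes' (\<mu> (s k)) (w k)) \<longlonglongrightarrow> stieltjes' (\<mu> t) z" by simp
qed

text \<open>The line through z at time t is followed to time u, where it is at z + d and carries the
  same value. Expanding the transform at time u around z gives the increment - d m' up to O(d^2),
  with m' taken at time u and continuous there.\<close>

lemma char_family_derivative:
  assumes rd0: "real_distribution \<mu>0" and cf: "char_family T \<mu>0 \<mu>"
    and t: "0 \<le> t" "t \<le> T" and z: "Im z > 6 * T + 4"
  shows "((\<lambda>s. stieltjes (\<mu> s) z) has_vector_derivative - (exp (- stieltjes (\<mu> t) z) * stieltjes' (\<mu> t) z))
     (at t within {0..T})"
  unfolding has_vector_derivative_def has_derivative_at_within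
proof (intro conjI bounded_linear_scaleR_left)
  have T: "T \<ge> 0" using t by simp
  have im0: "Im z \<noteq> 0" using z T by auto
  obtain z0 where z0: "Im z0 > 3 * T + 2" "z = char_line \<mu>0 t z0" using char_line_surj[OF rd0 t z] by blast
  define c where "c = exp (- stieltjes (\<mu> t) z)"
  have c: "c = exp (- stieltjes \<mu>0 z0)" "norm c \<le> 3"
    using char_familyD(2)[OF cf t z0(1)] norm_char_speed_le[OF rd0 t z0(1)] by (simp_all add: c_def z0(2))
  let ?Q = "\<lambda>u. (stieltjes (\<mu> u) z - stieltjes (\<mu> t) z - (u - t) *\<^sub>R - (c * stieltjes' (\<mu> t) z)) /\<^sub>R norm (u - t)"
  have bd: "norm (?Q u) \<le> 3 * norm (stieltjes' (\<mu> t) z - stieltjes' (\<mu> u) z) + 9 * \<bar>u - t\<bar>"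
    if "u \<in> {0..T}" "u \<noteq> t" for u
  proof -
    have u: "0 \<le> u" "u \<le> T" using that by auto
    interpret u: real_distribution "\<mu> u" by (rule char_familyD(1)[OF cf u])
    define d where "d = of_real (u - t) * c"
    have line: "char_line \<mu>0 u z0 = z + d" by (simp add: d_def c(1) z0(2) char_line_def algebra_simps)
    have e: "stieltjes (\<mu> u) (z + d) = stieltjes (\<mu> t) z"
      using char_familyD(2)[OF cf u z0(1)] char_familyD(2)[OF cf t z0(1)] by (simp add: line z0(2))
    have im: "Im (z + d) \<ge> 1" using Im_char_line_ge_1[OF rd0 u z0(1)] by (simp add: line)
    have nd: "norm d \<le> 3 * \<bar>u - t\<bar>" using c(2) mult_left_mono[OF c(2), of "\<bar>u - t\<bar>"] by (simp add: d_def norm_mult del: of_real_diff)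
    define r where "r = stieltjes (\<mu> u) (z + d) - stieltjes (\<mu> u) z - stieltjes' (\<mu> u) z * (z + d - z)"
    have "norm r \<le> norm (z + d - z)^2 / (\<bar>Im (z + d)\<bar> * \<bar>Im z\<bar>\<^sup>2)"
      unfolding r_def using im im0 by (intro u.stieltjes_taylor) auto
    also have "\<dots> \<le> norm (z + d - z)^2 / 1"
      using im z T mult_mono[of 1 "Im (z + d)" 1 "(Im z)\<^sup>2"] by (intro divide_left_mono) auto
    also have "\<dots> \<le> (3 * \<bar>u - t\<bar>)\<^sup>2" using power_mono[OF nd, of 2] by simp
    finally have r: "norm r \<le> 9 * \<bar>u - t\<bar>\<^sup>2" by (simp add: power_mult_distrib)
    have nv: "norm (v /\<^sub>R norm (u - t)) = norm v / \<bar>u - t\<bar>" for v :: complex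
      by (simp add: divide_inverse mult.commute)
    have "stieltjes (\<mu> u) z - stieltjes (\<mu> t) z - (u - t) *\<^sub>R - (c * stieltjes' (\<mu> t) z)
        = d * (stieltjes' (\<mu> t) z - stieltjes' (\<mu> u) z) - r"
    proof -
      have "stieltjes (\<mu> u) z = stieltjes (\<mu> t) z - stieltjes' (\<mu> u) z * d - r" by (simp add: r_def e)
      then show ?thesis by (simp add: d_def scaleR_conv_of_real algebra_simps)
    qed
    also have "norm \<dots> \<le> 3 * \<bar>u - t\<bar> * norm (stieltjes' (\<mu> t) z - stieltjes' (\<mu> u) z) + 9 * \<bar>u - t\<bar>\<^sup>2"
      using nd r by (intro order_trans[OF norm_triangle_ineq4] add_mono) (auto simp: norm_mult intro: mult_right_mono)
    finally have "norm (stieltjes (\<mu> u) z - stieltjes (\<mu> t) z - (u - t) *\<^sub>R - (c * stieltjes' (\<mu> t) z)) / \<bar>u - t\<bar>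
        \<le> (3 * \<bar>u - t\<bar> * norm (stieltjes' (\<mu> t) z - stieltjes' (\<mu> u) z) + 9 * \<bar>u - t\<bar>\<^sup>2) / \<bar>u - t\<bar>"
      by (intro divide_right_mono) auto
    also have "\<dots> = 3 * norm (stieltjes' (\<mu> t) z - stieltjes' (\<mu> u) z) + 9 * \<bar>u - t\<bar>"
    proof -
      have gen: "(3 * a * b + 9 * a\<^sup>2) / a = 3 * b + 9 * a" if "a \<noteq> 0" for a b :: real
        using that by (simp add: add_divide_distrib power2_eq_square)
      show ?thesis by (rule gen) (use that(2) in simp)
    qed
    finally show ?thesis unfolding nv .
  qed
  have cont: "((\<lambda>u. stieltjes' (\<mu> u) z) \<longlongrightarrow> stieltjes' (\<mu> t) z) (at t within {0..T})"
    unfolding tendsto_at_iff_sequentially o_def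
    using char_family_joint_limit(2)[OF rd0 cf _ _ _ t, of _ "\<lambda>_. z" z] im0 by auto
  have "((\<lambda>u. 3 * norm (stieltjes' (\<mu> t) z - stieltjes' (\<mu> u) z) + 9 * \<bar>u - t\<bar>) \<longlongrightarrow>
      3 * norm (stieltjes' (\<mu> t) z - stieltjes' (\<mu> t) z) + 9 * \<bar>t - t\<bar>) (at t within {0..T})"
    by (intro tendsto_intros cont)
  then have lim: "((\<lambda>u. 3 * norm (stieltjes' (\<mu> t) z - stieltjes' (\<mu> u) z) + 9 * \<bar>u - t\<bar>) \<longlongrightarrow> 0) (at t within {0..T})"
    by simp
  have "(?Q \<longlongrightarrow> 0) (at t within {0..T})"
    by (rule Lim_null_comparison[OF _ lim]) (use bd in \<open>auto simp: eventually_at_filter intro!: always_eventually\<close>)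
  then show "((\<lambda>y. (stieltjes (\<mu> y) z - stieltjes (\<mu> t) z - (y - t) *\<^sub>R - (exp (- stieltjes (\<mu> t) z) * stieltjes' (\<mu> t) z)) /\<^sub>R norm (y - t)) \<longlongrightarrow> 0)
     (at t within {0..T})" by (simp add: c_def)
qed

text \<open>The time derivative is available only in the high half plane covered by the lines. The
  integrand is minus the z-derivative of exp (- m), so its time integral is minus the derivative of
  a function holomorphic in the whole upper half plane, and the integrated equation continues
  analytically.\<close>

lemma char_family_imp_limit_process:
  assumes rd0: "real_distribution \<mu>0" and cf: "char_family T \<mu>0 \<mu>" and T: "T \<ge> 0"
    and init: "\<mu> 0 = \<mu>0" and dens: "\<And>t. 0 \<le> t \<Longrightarrow> t \<le> T \<Longrightarrow> density_le_one (\<mu> t)"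
  shows "limit_process T \<mu>0 \<mu>"
proof -
  let ?H = "{z. Im z > 0}"
  define \<phi> where "\<phi> s z = exp (- stieltjes (\<mu> s) z) * stieltjes' (\<mu> s) z" for s z
  have rd: "real_distribution (\<mu> t)" if "0 \<le> t" "t \<le> T" for t using char_familyD(1)[OF cf that] .
  have upper: "((\<lambda>s. \<phi> s z) has_integral (stieltjes \<mu>0 z - stieltjes (\<mu> t) z)) {0..t}"
    if t: "0 \<le> t" "t \<le> T" and z: "Im z > 0" for t z
  proof -
    have joint: "continuous_on (?H \<times> cbox 0 t) (\<lambda>(z, s). - \<phi> s z)"
      unfolding continuous_on_sequentially
    proof (intro allI ballI impI, elim conjE)
      fix x :: "nat \<Rightarrow> complex \<times> real" and a
      assume x: "\<forall>n. x n \<in> ?H \<times> cbox 0 t" "x \<longlonglongrightarrow> a" and a: "a \<in> ?H \<times> cbox 0 t"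
      have x': "Im (fst (x k)) \<noteq> 0" "0 \<le> snd (x k)" "snd (x k) \<le> T" for k
        using x(1)[rule_format, of k] t by auto
      have a': "Im (fst a) \<noteq> 0" "0 \<le> snd a" "snd a \<le> T" using a t by auto
      note lims = char_family_joint_limit[OF rd0 cf x'(2,3) tendsto_snd[OF x(2)] a'(2,3) x'(1) tendsto_fst[OF x(2)] a'(1)]
      show "((\<lambda>(z, s). - \<phi> s z) \<circ> x) \<longlonglongrightarrow> (case a of (z, s) \<Rightarrow> - \<phi> s z)"
        unfolding o_def case_prod_beta \<phi>_def by (intro tendsto_intros lims)
    qed
    have contE: "continuous_on {0..t} (\<lambda>s. exp (- stieltjes (\<mu> s) w))" if "Im w > 0" for w
      unfolding continuous_on_sequentially
    proof (intro allI ballI impI, elim conjE)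
      fix x :: "nat \<Rightarrow> real" and a
      assume x: "\<forall>n. x n \<in> {0..t}" "x \<longlonglongrightarrow> a" and a: "a \<in> {0..t}"
      have x': "0 \<le> x k" "x k \<le> T" for k using x(1)[rule_format, of k] t by auto
      have "(\<lambda>k. stieltjes (\<mu> (x k)) w) \<longlonglongrightarrow> stieltjes (\<mu> a) w"
        by (rule char_family_joint_limit(1)[OF rd0 cf x' x(2)]) (use a t that in auto)
      then show "((\<lambda>s. exp (- stieltjes (\<mu> s) w)) \<circ> x) \<longlonglongrightarrow> exp (- stieltjes (\<mu> a) w)"
        unfolding o_def by (intro tendsto_intros)
    qed
    \<comment> \<open>The time integral of exp (- m), whose derivative by the Leibniz rule is minus
      the integral in the equation.\<close>
    define J where "J w = integral (cbox 0 t) (\<lambda>s. exp (- stieltjes (\<mu> s) w))" for w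
    have DJ: "(J has_field_derivative integral (cbox 0 t) (\<lambda>s. - \<phi> s w)) (at w)" if w: "Im w > 0" for w
    proof -
      have "((\<lambda>w. integral (cbox 0 t) (\<lambda>s. exp (- stieltjes (\<mu> s) w))) has_field_derivative
         integral (cbox 0 t) ((\<lambda>w s. - \<phi> s w) w)) (at w within ?H)"
      proof (rule leibniz_rule_field_derivative[OF _ _ joint])
        fix v s assume v: "v \<in> ?H" and s: "s \<in> cbox 0 t"
        have "real_distribution (\<mu> s)" using s t by (intro rd) auto
        from real_distribution.DERIV_exp_stieltjes[OF this, of v] v
        show "((\<lambda>w. exp (- stieltjes (\<mu> s) w)) has_field_derivative - \<phi> s v) (at v within ?H)"
          by (simp add: \<phi>_def has_field_derivative_at_within)
      next
        show "(\<lambda>s. exp (- stieltjes (\<mu> s) v)) integrable_on cbox 0 t" if "v \<in> ?H" for v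
          using integrable_continuous_interval[OF contE, of v] that by simp
      qed (use w convex_upper_half_plane in auto)
      then show ?thesis using w open_upper_half_plane at_within_open[of w ?H] by (simp add: J_def[abs_def])
    qed
    then have holJ: "J holomorphic_on ?H" using open_upper_half_plane by (auto simp: holomorphic_on_open)
    have int: "(\<lambda>s. \<phi> s w) integrable_on {0..t}" if "Im w > 0" for w
    proof -
      have "continuous_on {0..t} (\<lambda>s. (w, s))" by (intro continuous_intros)
      moreover have "(\<lambda>s. (w, s)) ` {0..t} \<subseteq> ?H \<times> cbox 0 t" using that by auto
      ultimately have "continuous_on {0..t} (\<lambda>s. - \<phi> s w)" using continuous_on_compose2[OF joint] by fastforce
      from integrable_continuous_interval[OF continuous_on_minus[OF this]] show ?thesis by simp
    qed
    have dJ: "deriv J w = - integral {0..t} (\<lambda>s. \<phi> s w)" if "Im w > 0" for w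
      using DERIV_imp_deriv[OF DJ[OF that]] by simp
    have "stieltjes (\<mu> t) z = stieltjes \<mu>0 z + deriv J z"
    proof (rule analytic_continuation_open[of "{z. Im z > 6 * T + 4}" ?H "stieltjes (\<mu> t)" "\<lambda>z. stieltjes \<mu>0 z + deriv J z"])
      have "Complex 0 (6 * T + 5) \<in> {z. Im z > 6 * T + 4}" by simp
      then show "{z. Im z > 6 * T + 4} \<noteq> {}" by blast
      show "connected ?H" using convex_upper_half_plane convex_connected by blast
      show "stieltjes (\<mu> t) holomorphic_on ?H" by (rule real_distribution.holomorphic_stieltjes[OF rd[OF t]])
      show "(\<lambda>z. stieltjes \<mu>0 z + deriv J z) holomorphic_on ?H"
        by (intro holomorphic_intros real_distribution.holomorphic_stieltjes[OF rd0] holJ holomorphic_deriv open_upper_half_plane)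
      fix w assume w: "w \<in> {z. Im z > 6 * T + 4}"
      then have "Im w > 0" using T by auto
      have "((\<lambda>s. - \<phi> s w) has_integral (stieltjes (\<mu> t) w - stieltjes (\<mu> 0) w)) {0..t}"
      proof (rule fundamental_theorem_of_calculus[OF t(1)])
        fix s assume s: "s \<in> {0..t}"
        have "((\<lambda>s. stieltjes (\<mu> s) w) has_vector_derivative - (exp (- stieltjes (\<mu> s) w) * stieltjes' (\<mu> s) w)) (at s within {0..T})"
          using s t w by (intro char_family_derivative[OF rd0 cf]) auto
        then show "((\<lambda>s. stieltjes (\<mu> s) w) has_vector_derivative - \<phi> s w) (at s within {0..t})"
          unfolding \<phi>_def by (rule has_vector_derivative_within_subset) (use t in auto)
      qed
      then have "integral {0..t} (\<lambda>s. - \<phi> s w) = stieltjes (\<mu> t) w - stieltjes \<mu>0 w"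
        unfolding init by (rule integral_unique)
      then show "stieltjes (\<mu> t) w = stieltjes \<mu>0 w + deriv J w" using dJ[OF \<open>Im w > 0\<close>] by simp
    qed (use z T open_upper_half_plane in \<open>auto simp: open_halfspace_Im_gt\<close>)
    then show ?thesis using int[OF z] dJ[OF z] by (simp add: has_integral_iff)
  qed
  \<comment> \<open>In the lower half plane every term is the conjugate of its value at the
    conjugate point.\<close>
  have all: "((\<lambda>s. \<phi> s z) has_integral (stieltjes \<mu>0 z - stieltjes (\<mu> t) z)) {0..t}"
    if t: "0 \<le> t" "t \<le> T" and z: "Im z \<noteq> 0" for t z
  proof (cases "Im z > 0")
    case False
    then have "Im (cnj z) > 0" using z by simp
    from upper[OF t this] have "(cnj \<circ> (\<lambda>s. \<phi> s (cnj z)) has_integral cnj (stieltjes \<mu>0 (cnj z) - stieltjes (\<mu> t) (cnj z))) {0..t}"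
      by (simp only: has_integral_cnj)
    moreover have "cnj (stieltjes \<mu>0 (cnj z) - stieltjes (\<mu> t) (cnj z)) = stieltjes \<mu>0 z - stieltjes (\<mu> t) z"
      using real_distribution.stieltjes_cnj[OF rd0] real_distribution.stieltjes_cnj[OF rd[OF t]] by simp
    moreover have "(cnj \<circ> (\<lambda>s. \<phi> s (cnj z))) s = \<phi> s z" if "s \<in> {0..t}" for s
    proof -
      have "real_distribution (\<mu> s)" using that t by (intro rd) auto
      then show ?thesis
        by (simp add: \<phi>_def exp_cnj real_distribution.stieltjes_cnj real_distribution.stieltjes'_cnj)
    qed
    ultimately show ?thesis using has_integral_cong[of "{0..t}"] by metis
  qed (rule upper[OF t])
  show ?thesis unfolding limit_process_def
  proof (intro conjI ballI allI impI init)
    show "\<mu> t \<in> M1" "density_le_one (\<mu> t)" if "t \<in> {0..T}" for t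
      using that rd dens by (auto simp: M1_iff)
    fix z t assume z: "Im z \<noteq> 0" and t: "t \<in> {0..T}"
    have cong: "exp (- stieltjes (\<mu> s) z) * deriv (stieltjes (\<mu> s)) z = \<phi> s z" if "s \<in> {0..t}" for s
      using real_distribution.deriv_stieltjes[OF rd z, of s] that t by (simp add: \<phi>_def)
    have "((\<lambda>s. exp (- stieltjes (\<mu> s) z) * deriv (stieltjes (\<mu> s)) z) has_integral (stieltjes \<mu>0 z - stieltjes (\<mu> t) z)) {0..t}"
      by (rule has_integral_eq[OF cong[symmetric] all[OF _ _ z]]) (use t in auto)
    then show "(\<lambda>s. exp (- stieltjes (\<mu> s) z) * deriv (stieltjes (\<mu> s)) z) integrable_on {0..t}"
      "stieltjes (\<mu> t) z = stieltjes (\<mu> 0) z - integral {0..t} (\<lambda>s. exp (- stieltjes (\<mu> s) z) * deriv (stieltjes (\<mu> s)) z)"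
      by (auto simp: has_integral_iff init)
  qed
qed

section \<open>Convergence\<close>

text \<open>The line is that of \<open>P0\<close> itself, not of the limit; this is the quantity
  estimated by \<open>second_moment_bound\<close>.\<close>

definition test_err :: "real \<Rightarrow> real \<Rightarrow> real measure \<Rightarrow> real measure \<Rightarrow> nat \<Rightarrow> real" where
  "test_err T t P0 P j = norm (stieltjes P (char_line P0 t (test_pt T j)) - stieltjes P0 (test_pt T j))"

lemma test_err_nonneg: "test_err T t P0 P j \<ge> 0"
  by (simp add: test_err_def)

text \<open>Here the convergence of the initial measures enters: it moves the line of
  \<open>P0 k\<close> to that of \<open>\<mu>0\<close>, and the transforms are Lipschitz uniformly
  in the measure.\<close>

lemma test_pts_tendsto:
  assumes rd0: "real_distribution \<mu>0" and t: "0 \<le> t" "t \<le> T"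
    and rd: "\<And>k. real_distribution (P0 k)" "\<And>k. real_distribution (P k)"
    and lev: "(\<lambda>k. levy (P0 k) \<mu>0) \<longlonglongrightarrow> 0" and err: "(\<lambda>k. test_err T t (P0 k) (P k) j) \<longlonglongrightarrow> 0"
  shows "(\<lambda>k. stieltjes (P k) (char_line \<mu>0 t (test_pt T j))) \<longlonglongrightarrow> stieltjes \<mu>0 (test_pt T j)"
proof -
  let ?z = "test_pt T j"
  have z: "Im ?z > 3 * T + 2" by (rule Im_test_pt)
  have z0: "Im ?z \<noteq> 0" using z t by auto
  have m0: "(\<lambda>k. stieltjes (P0 k) ?z) \<longlonglongrightarrow> stieltjes \<mu>0 ?z"
    by (rule weak_conv_imp_stieltjes_tendsto[OF rd(1) rd0 levy_tendsto_imp_weak_conv[OF rd(1) rd0 lev] z0])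
  have "(\<lambda>k. char_line \<mu>0 t ?z - char_line (P0 k) t ?z) \<longlonglongrightarrow> char_line \<mu>0 t ?z - char_line \<mu>0 t ?z"
    unfolding char_line_def by (intro tendsto_intros m0)
  then have cl: "(\<lambda>k. norm (char_line \<mu>0 t ?z - char_line (P0 k) t ?z)) \<longlonglongrightarrow> 0"
    by (simp add: tendsto_norm_zero_iff)
  have "norm (stieltjes (P k) (char_line \<mu>0 t ?z) - stieltjes (P k) (char_line (P0 k) t ?z)) \<le> norm (char_line \<mu>0 t ?z - char_line (P0 k) t ?z)" for k
  proof -
    have im: "Im (char_line \<mu>0 t ?z) \<ge> 1" "Im (char_line (P0 k) t ?z) \<ge> 1"
      using Im_char_line_ge_1[OF _ t z] rd0 rd(1) by auto
    have "norm (stieltjes (P k) (char_line \<mu>0 t ?z) - stieltjes (P k) (char_line (P0 k) t ?z))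
       \<le> norm (char_line \<mu>0 t ?z - char_line (P0 k) t ?z) / (\<bar>Im (char_line \<mu>0 t ?z)\<bar> * \<bar>Im (char_line (P0 k) t ?z)\<bar>)"
      using im by (intro real_distribution.stieltjes_lipschitz[OF rd(2)]) auto
    also have "\<dots> \<le> norm (char_line \<mu>0 t ?z - char_line (P0 k) t ?z) / 1"
      using im mult_mono[of 1 "Im (char_line \<mu>0 t ?z)" 1 "Im (char_line (P0 k) t ?z)"] by (intro divide_left_mono) auto
    finally show ?thesis by simp
  qed
  then have "(\<lambda>k. stieltjes (P k) (char_line \<mu>0 t ?z) - stieltjes (P k) (char_line (P0 k) t ?z)) \<longlonglongrightarrow> 0"
    by (intro Lim_null_comparison[OF _ cl]) simp
  moreover have "(\<lambda>k. stieltjes (P k) (char_line (P0 k) t ?z) - stieltjes (P0 k) ?z) \<longlonglongrightarrow> 0"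
    using err unfolding test_err_def tendsto_norm_zero_iff .
  ultimately have "(\<lambda>k. (stieltjes (P k) (char_line \<mu>0 t ?z) - stieltjes (P k) (char_line (P0 k) t ?z))
      + (stieltjes (P k) (char_line (P0 k) t ?z) - stieltjes (P0 k) ?z) + stieltjes (P0 k) ?z) \<longlonglongrightarrow> 0 + 0 + stieltjes \<mu>0 ?z"
    by (intro tendsto_add m0)
  then show ?thesis by simp
qed

lemma tendsto_0_by_inverse_Suc:
  fixes f :: "nat \<Rightarrow> real"
  assumes "\<And>k. k \<ge> j \<Longrightarrow> \<bar>f k\<bar> \<le> 1 / real (Suc k)"
  shows "f \<longlonglongrightarrow> 0"
proof (rule Lim_null_comparison)
  show "(\<lambda>k. 1 / real (Suc k)) \<longlonglongrightarrow> 0" using LIMSEQ_inverse_real_of_nat by (simp add: divide_inverse)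
  show "eventually (\<lambda>k. norm (f k) \<le> 1 / real (Suc k)) sequentially"
    using assms by (intro eventually_sequentiallyI[of j]) (simp only: real_norm_def)
qed

text \<open>A compactness argument, with \<delta> = 1 / (k + 1) and K = k along a supposed
  counterexample. It reduces Levy closeness to finitely many conditions on one pair of measures, so
  it applies to each realization separately.\<close>

lemma levy_stability:
  assumes rd0: "real_distribution \<mu>0" and t: "0 \<le> t" "t \<le> T" and rd: "real_distribution \<nu>"
    and atomless: "\<And>x. measure \<nu> {x} = 0"
    and eq: "\<And>z. Im z > 3 * T + 2 \<Longrightarrow> stieltjes \<nu> (char_line \<mu>0 t z) = stieltjes \<mu>0 z" and "\<epsilon> > 0"
  shows "\<exists>\<delta>>0. \<exists>K. \<forall>P0 P. real_distribution P0 \<longrightarrow> real_distribution P \<longrightarrow> levy P0 \<mu>0 < \<delta> \<longrightarrow>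
     (\<forall>j\<le>K. test_err T t P0 P j < \<delta>) \<longrightarrow> levy_le \<epsilon> P \<nu>"
proof (rule ccontr)
  assume neg: "\<not> ?thesis"
  have "\<exists>P0 P. real_distribution P0 \<and> real_distribution P \<and> levy P0 \<mu>0 < 1 / real (Suc k) \<and>
     (\<forall>j\<le>k. test_err T t P0 P j < 1 / real (Suc k)) \<and> \<not> levy_le \<epsilon> P \<nu>" for k
  proof -
    have "\<not> (\<exists>K. \<forall>P0 P. real_distribution P0 \<longrightarrow> real_distribution P \<longrightarrow> levy P0 \<mu>0 < 1 / real (Suc k) \<longrightarrow>
     (\<forall>j\<le>K. test_err T t P0 P j < 1 / real (Suc k)) \<longrightarrow> levy_le \<epsilon> P \<nu>)"
      using neg by (metis of_nat_0_less_iff zero_less_Suc zero_less_divide_1_iff)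
    then show ?thesis by blast
  qed
  then obtain P0 P where P: "\<And>k. real_distribution (P0 k)" "\<And>k. real_distribution (P k)"
      "\<And>k. levy (P0 k) \<mu>0 < 1 / real (Suc k)" "\<And>k j. j \<le> k \<Longrightarrow> test_err T t (P0 k) (P k) j < 1 / real (Suc k)"
      "\<And>k. \<not> levy_le \<epsilon> (P k) \<nu>"
    by metis
  have lev: "(\<lambda>k. levy (P0 k) \<mu>0) \<longlonglongrightarrow> 0"
  proof (rule tendsto_0_by_inverse_Suc)
    show "\<bar>levy (P0 k) \<mu>0\<bar> \<le> 1 / real (Suc k)" for k
      using P(3)[of k] levy_nonneg[OF P(1) rd0, of k] by linarith
  qed
  have err: "(\<lambda>k. test_err T t (P0 k) (P k) j) \<longlonglongrightarrow> 0" for j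
  proof (rule tendsto_0_by_inverse_Suc[of j])
    show "\<bar>test_err T t (P0 k) (P k) j\<bar> \<le> 1 / real (Suc k)" if "j \<le> k" for k
      using P(4)[OF that] test_err_nonneg[of T t "P0 k" "P k" j] by linarith
  qed
  have "weak_conv_m P \<nu>"
    by (rule weak_conv_of_test_pts[OF rd0 t P(2) rd test_pts_tendsto[OF rd0 t P(1,2) lev err] eq[OF Im_test_pt]])
  then have "(\<lambda>k. levy (P k) \<nu>) \<longlonglongrightarrow> 0"
    by (intro weak_conv_imp_levy_tendsto P rd atomless)
  then have "eventually (\<lambda>k. levy (P k) \<nu> < \<epsilon>) sequentially" using \<open>\<epsilon> > 0\<close> by (rule order_tendstoD)
  then show False using levy_less_imp[OF P(2) rd] P(5) by (auto simp: eventually_sequentially)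
qed

text \<open>A subsequential limit inherits the density bound from the spacing and the values at the
  test points from the characteristics, and these values extend to the half plane.\<close>

lemma char_limit_exists:
  assumes rd0: "real_distribution \<mu>0" and t: "0 \<le> t" "t \<le> T"
    and rd: "\<And>k. real_distribution (P0 k)" "\<And>k. real_distribution (P k)"
    and lev: "(\<lambda>k. levy (P0 k) \<mu>0) \<longlonglongrightarrow> 0" and err: "\<And>j. (\<lambda>k. test_err T t (P0 k) (P k) j) \<longlonglongrightarrow> 0"
    and gap: "\<And>k a b. a \<le> b \<Longrightarrow> measure (P k) {a<..b} \<le> b - a + e k" "e \<longlonglongrightarrow> 0"
  shows "\<exists>\<nu>. real_distribution \<nu> \<and> density_le_one \<nu> \<and>
     (\<forall>z. Im z > 3 * T + 2 \<longrightarrow> stieltjes \<nu> (char_line \<mu>0 t z) = stieltjes \<mu>0 z)"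
proof -
  note conv = test_pts_tendsto[OF rd0 t rd lev err]
  have "tight P" by (rule tight_of_test_pts[OF rd0 t rd(2) conv])
  then obtain r \<nu> where r: "strict_mono (r :: nat \<Rightarrow> nat)" "real_distribution \<nu>" "weak_conv_m (P \<circ> r) \<nu>"
    using tight_imp_convergent_subsubsequence[of P id] by (auto simp: strict_mono_id o_def)
  have rdr: "real_distribution ((P \<circ> r) k)" for k using rd(2) by simp
  have "density_le_one \<nu>"
    by (rule density_le_one_of_weak_conv[OF rdr r(2,3), of "e \<circ> r"])
       (use gap LIMSEQ_subseq_LIMSEQ[OF gap(2) r(1)] in \<open>auto simp: o_def\<close>)
  moreover have "stieltjes \<nu> (char_line \<mu>0 t (test_pt T j)) = stieltjes \<mu>0 (test_pt T j)" for j
  proof (rule LIMSEQ_unique)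
    show "(\<lambda>k. stieltjes ((P \<circ> r) k) (char_line \<mu>0 t (test_pt T j))) \<longlonglongrightarrow> stieltjes \<nu> (char_line \<mu>0 t (test_pt T j))"
      using Im_char_line_ge_1[OF rd0 t Im_test_pt, of j] by (intro weak_conv_imp_stieltjes_tendsto[OF rdr r(2,3)]) auto
    show "(\<lambda>k. stieltjes ((P \<circ> r) k) (char_line \<mu>0 t (test_pt T j))) \<longlonglongrightarrow> stieltjes \<mu>0 (test_pt T j)"
      using LIMSEQ_subseq_LIMSEQ[OF conv r(1)] by (simp add: o_def)
  qed
  ultimately show ?thesis using char_line_eq_of_test_pts[OF rd0 t r(2)] r(2) by blast
qed

section \<open>Skorokhod distance, time grids and monotone paths\<close>

lemma time_change_id: "time_change T (\<lambda>t. t)"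
  by (auto simp: time_change_def strict_mono_on_def)

lemma skorokhod_le:
  assumes "\<epsilon> > 0" "\<And>t. t \<in> {0..T} \<Longrightarrow> d (f t) (g t) \<le> \<epsilon>"
  shows "skorokhod T d f g \<le> \<epsilon>"
  unfolding skorokhod_def
  by (rule cInf_lower) (use assms time_change_id in \<open>auto intro!: exI[of _ "\<lambda>t. t"] bdd_belowI[of _ 0]\<close>)

text \<open>The identity time change puts 1 into the set, so the infimum is over a nonempty set of
  positive numbers.\<close>

lemma skorokhod_nonneg:
  assumes "\<And>t. t \<in> {0..T} \<Longrightarrow> d (f t) (g t) \<le> 1"
  shows "skorokhod T d f g \<ge> 0"
proof -
  have "1 \<in> {\<epsilon>. \<epsilon> > 0 \<and> (\<exists>r. time_change T r \<and> (\<forall>t\<in>{0..T}. \<bar>r t - t\<bar> \<le> \<epsilon> \<and> d (f t) (g (r t)) \<le> \<epsilon>))}"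
    using assms time_change_id by (auto intro!: exI[of _ "\<lambda>t. t"])
  then have ne: "{\<epsilon>. \<epsilon> > 0 \<and> (\<exists>r. time_change T r \<and> (\<forall>t\<in>{0..T}. \<bar>r t - t\<bar> \<le> \<epsilon> \<and> d (f t) (g (r t)) \<le> \<epsilon>))} \<noteq> {}"
    by blast
  show ?thesis unfolding skorokhod_def by (rule cInf_greatest[OF ne]) auto
qed

lemma finite_grid:
  assumes "T \<ge> 0" "\<delta> > (0::real)"
  shows "\<exists>S. finite S \<and> S \<subseteq> {0..T} \<and>
     (\<forall>t\<in>{0..T}. \<exists>a\<in>S. \<exists>b\<in>S. a \<le> t \<and> t \<le> b \<and> \<bar>a - t\<bar> < \<delta> \<and> \<bar>b - t\<bar> < \<delta>)"
proof -
  define d where "d = \<delta> / 2"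
  have d: "d > 0" "d < \<delta>" using assms by (auto simp: d_def)
  let ?p = "\<lambda>i::nat. min T (real i * d)"
  \<comment> \<open>The extra 1 leaves room for the right neighbour \<open>Suc i\<close>.\<close>
  let ?N = "nat \<lceil>T / d\<rceil> + 1"
  show ?thesis
  proof (intro exI[of _ "?p ` {..?N}"] conjI ballI)
    show "?p ` {..?N} \<subseteq> {0..T}" using assms d by auto
    fix t assume t: "t \<in> {0..T}"
    define i where "i = nat \<lfloor>t / d\<rfloor>"
    have "t / d \<ge> 0" using t d by simp
    then have i: "real i \<le> t / d" "t / d < real i + 1" unfolding i_def by linarith+
    have "real i \<le> T / d" using i(1) t d by (meson atLeastAtMost_iff divide_right_mono less_imp_le order_trans)
    then have iN: "i \<le> ?N" "Suc i \<le> ?N" by linarith+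
    have a: "real i * d \<le> t" "t < real i * d + d" using i d by (auto simp: field_simps)
    show "\<exists>a\<in>?p ` {..?N}. \<exists>b\<in>?p ` {..?N}. a \<le> t \<and> t \<le> b \<and> \<bar>a - t\<bar> < \<delta> \<and> \<bar>b - t\<bar> < \<delta>"
    proof (intro bexI conjI)
      show "?p i \<le> t" "\<bar>?p i - t\<bar> < \<delta>" using a d t by auto
      have "real (Suc i) * d = real i * d + d" by (simp add: algebra_simps)
      then show "t \<le> ?p (Suc i)" "\<bar>?p (Suc i) - t\<bar> < \<delta>" using a d t by auto
    qed (rule imageI, use iN in simp)+
  qed auto
qed

text \<open>Particles only move up, so the distribution function at an intermediate time lies
  between those at the later and at the earlier grid time, both close to that of \<nu>.\<close>

lemma levy_le_sandwich:
  assumes "n \<ge> 1" "\<theta> > 0" and mono: "xa \<le> x" "x \<le> xb"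
    and a: "levy_le \<epsilon> (emp n \<theta> xa) \<mu>a" "levy_le \<epsilon> \<mu>a \<nu>"
    and b: "levy_le \<epsilon> (emp n \<theta> xb) \<mu>b" "levy_le \<epsilon> \<mu>b \<nu>"
  shows "levy_le (2 * \<epsilon>) (emp n \<theta> x) \<nu>"
proof (rule levy_leI)
  fix y
  have La: "levy_le (2 * \<epsilon>) (emp n \<theta> xa) \<nu>" and Lb: "levy_le (2 * \<epsilon>) (emp n \<theta> xb) \<nu>"
    using levy_le_trans[OF a] levy_le_trans[OF b] by simp_all
  have "measure \<nu> {..<y} \<le> measure (emp n \<theta> xb) {..<y + 2 * \<epsilon>} + 2 * \<epsilon>" by (rule levy_le_upper[OF Lb])
  also have "measure (emp n \<theta> xb) {..<y + 2 * \<epsilon>} \<le> measure (emp n \<theta> x) {..<y + 2 * \<epsilon>}"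
    using mono by (intro measure_emp_antimono assms) (auto simp: le_fun_def)
  finally show "measure \<nu> {..<y} \<le> measure (emp n \<theta> x) {..<y + 2 * \<epsilon>} + 2 * \<epsilon>" by simp
  have "measure (emp n \<theta> x) {..<y} \<le> measure (emp n \<theta> xa) {..<y}"
    using mono by (intro measure_emp_antimono assms) (auto simp: le_fun_def)
  also have "\<dots> \<le> measure \<nu> {..<y + 2 * \<epsilon>} + 2 * \<epsilon>" by (rule levy_le_lower[OF La])
  finally show "measure (emp n \<theta> x) {..<y} \<le> measure \<nu> {..<y + 2 * \<epsilon>} + 2 * \<epsilon>" .
qed

text \<open>Monotonicity of the paths turns closeness on a finite time grid into uniform closeness.\<close>
lemma skorokhod_stability:
  assumes rd0: "real_distribution \<mu>0" and cf: "char_family T \<mu>0 \<mu>" and T: "T \<ge> 0" and \<theta>: "\<theta> > 0"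
    and atomless: "\<And>t x. 0 \<le> t \<Longrightarrow> t \<le> T \<Longrightarrow> measure (\<mu> t) {x} = 0" and "\<epsilon> > 0"
  shows "\<exists>S K. \<exists>\<delta>>0. finite S \<and> S \<subseteq> {0..T} \<and> (\<forall>n x. n \<ge> 1 \<longrightarrow> (\<forall>s t. 0 \<le> s \<longrightarrow> s \<le> t \<longrightarrow> x s \<le> x t) \<longrightarrow>
     levy (emp n \<theta> (x 0)) \<mu>0 < \<delta> \<longrightarrow> (\<forall>s\<in>S. \<forall>j\<le>K. test_err T s (emp n \<theta> (x 0)) (emp n \<theta> (x s)) j < \<delta>) \<longrightarrow>
     skorokhod T levy (\<lambda>t. emp n \<theta> (x t)) \<mu> \<le> \<epsilon>)"
proof -
  obtain d1 where d1: "d1 > 0" "\<And>s t. 0 \<le> s \<Longrightarrow> s \<le> T \<Longrightarrow> 0 \<le> t \<Longrightarrow> t \<le> T \<Longrightarrow> \<bar>s - t\<bar> < d1 \<Longrightarrow> levy_le (\<epsilon> / 2) (\<mu> s) (\<mu> t)"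
    using char_family_levy_uniform[OF rd0 cf atomless, of "\<epsilon> / 2"] \<open>\<epsilon> > 0\<close> by auto
  obtain S where S: "finite S" "S \<subseteq> {0..T}"
      "\<And>t. t \<in> {0..T} \<Longrightarrow> \<exists>a\<in>S. \<exists>b\<in>S. a \<le> t \<and> t \<le> b \<and> \<bar>a - t\<bar> < d1 \<and> \<bar>b - t\<bar> < d1"
    using finite_grid[OF T d1(1)] by blast
  have "\<exists>\<delta>>0. \<exists>K. \<forall>P0 P. real_distribution P0 \<longrightarrow> real_distribution P \<longrightarrow> levy P0 \<mu>0 < \<delta> \<longrightarrow>
     (\<forall>j\<le>K. test_err T s P0 P j < \<delta>) \<longrightarrow> levy_le (\<epsilon> / 2) P (\<mu> s)" if "s \<in> S" for s
    using that S(2) \<open>\<epsilon> > 0\<close> by (intro levy_stability[OF rd0] char_familyD[OF cf] atomless) auto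
  then obtain d k where dk: "\<And>s. s \<in> S \<Longrightarrow> d s > (0::real)"
    "\<And>s P0 P. s \<in> S \<Longrightarrow> real_distribution P0 \<Longrightarrow> real_distribution P \<Longrightarrow> levy P0 \<mu>0 < d s \<Longrightarrow>
     (\<forall>j\<le>k s. test_err T s P0 P j < d s) \<Longrightarrow> levy_le (\<epsilon> / 2) P (\<mu> s)"
    by metis
  define \<delta> where "\<delta> = Min (insert 1 (d ` S))"
  define K where "K = Max (insert 0 (k ` S))"
  have \<delta>: "\<delta> > 0" "\<And>s. s \<in> S \<Longrightarrow> \<delta> \<le> d s" using S(1) dk(1) by (auto simp: \<delta>_def)
  have K: "\<And>s. s \<in> S \<Longrightarrow> k s \<le> K" using S(1) by (auto simp: K_def)
  have "skorokhod T levy (\<lambda>t. emp n \<theta> (x t)) \<mu> \<le> \<epsilon>"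
    if n: "n \<ge> 1" and mono: "\<And>s t. 0 \<le> s \<Longrightarrow> s \<le> t \<Longrightarrow> x s \<le> x t"
      and init: "levy (emp n \<theta> (x 0)) \<mu>0 < \<delta>"
      and err: "\<And>s j. s \<in> S \<Longrightarrow> j \<le> K \<Longrightarrow> test_err T s (emp n \<theta> (x 0)) (emp n \<theta> (x s)) j < \<delta>"
    for n and x :: "real \<Rightarrow> nat \<Rightarrow> real"
  proof (rule skorokhod_le[OF \<open>\<epsilon> > 0\<close>])
    fix t assume t: "t \<in> {0..T}"
    have grid: "levy_le (\<epsilon> / 2) (emp n \<theta> (x s)) (\<mu> s)" if "s \<in> S" for s
    proof (rule dk(2)[OF that real_distribution_emp[OF n] real_distribution_emp[OF n]])
      show "levy (emp n \<theta> (x 0)) \<mu>0 < d s" using init \<delta>(2)[OF that] by simp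
      show "\<forall>j\<le>k s. test_err T s (emp n \<theta> (x 0)) (emp n \<theta> (x s)) j < d s"
        using err[OF that] K[OF that] \<delta>(2)[OF that] by (meson less_le_trans order_trans)
    qed
    obtain a b where ab: "a \<in> S" "b \<in> S" "a \<le> t" "t \<le> b" "\<bar>a - t\<bar> < d1" "\<bar>b - t\<bar> < d1" using S(3)[OF t] by blast
    have rng: "0 \<le> a" "a \<le> T" "0 \<le> b" "b \<le> T" "0 \<le> t" "t \<le> T" using ab S(2) t by auto
    have "levy_le (2 * (\<epsilon> / 2)) (emp n \<theta> (x t)) (\<mu> t)"
      using rng ab by (intro levy_le_sandwich[OF n \<theta> mono mono grid[OF ab(1)] _ grid[OF ab(2)]] d1(2)) auto
    then show "levy (emp n \<theta> (x t)) (\<mu> t) \<le> \<epsilon>" using \<open>\<epsilon> > 0\<close> by (intro levy_le_imp) auto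
  qed
  note main = this
  show ?thesis
  proof (intro exI conjI allI impI)
    show "\<delta> > 0" "finite S" "S \<subseteq> {0..T}" by fact+
    fix n :: nat and x :: "real \<Rightarrow> nat \<Rightarrow> real"
    assume "n \<ge> 1" "\<forall>s t. 0 \<le> s \<longrightarrow> s \<le> t \<longrightarrow> x s \<le> x t" "levy (emp n \<theta> (x 0)) \<mu>0 < \<delta>"
      "\<forall>s\<in>S. \<forall>j\<le>K. test_err T s (emp n \<theta> (x 0)) (emp n \<theta> (x s)) j < \<delta>"
    then show "skorokhod T levy (\<lambda>t. emp n \<theta> (x t)) \<mu> \<le> \<epsilon>" by (intro main) auto
  qed
qed

section \<open>Probability estimates and the two modes of convergence\<close>

lemma outer_prob_le: "B \<in> sets M \<Longrightarrow> A \<subseteq> B \<Longrightarrow> outer_prob M A \<le> measure M B"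
  unfolding outer_prob_def by (intro cInf_lower bdd_belowI[of _ 0]) auto

lemma outer_prob_nonneg: "A \<subseteq> space M \<Longrightarrow> outer_prob M A \<ge> 0"
  unfolding outer_prob_def by (intro cInf_greatest) (auto intro!: exI[of _ "space M"])

lemma (in prob_space) outer_prob_eq: "A \<in> sets M \<Longrightarrow> outer_prob M A = measure M A"
  using outer_prob_le[of A M A] unfolding outer_prob_def
  by (intro antisym cInf_greatest) (auto intro: finite_measure_mono)

text \<open>Chebyshev's inequality for the second moment; the order n^-2 is what Borel-Cantelli will
  use.\<close>

lemma test_err_prob_le:
  fixes j :: nat
  assumes "prob_space M" "n \<ge> 1" "\<theta> > 0" "is_NIPRW M n \<theta> X" and t: "0 \<le> t" "t \<le> T" and "\<delta> > 0"
  defines "E \<equiv> {\<omega>\<in>space M. test_err T t (emp n \<theta> (X 0 \<omega>)) (emp n \<theta> (X t \<omega>)) j \<ge> \<delta>}"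
  shows "E \<in> sets M" "measure M E \<le> exp (19 * T) * T * var_const \<theta> / \<delta>\<^sup>2 / (real n)\<^sup>2"
proof -
  interpret prob_space M by fact
  note w = assms(1-4)
  define u where "u \<omega> = test_err T t (emp n \<theta> (X 0 \<omega>)) (emp n \<theta> (X t \<omega>)) j" for \<omega>
  have um [measurable]: "u \<in> borel_measurable M"
    using walk_compose2_measurable[OF w, of 0 t "\<lambda>x y. test_err T t (emp n \<theta> x) (emp n \<theta> y) j"] t
    by (simp add: u_def[abs_def])
  show E: "E \<in> sets M" unfolding E_def u_def[symmetric] by measurable
  have ub: "0 \<le> u \<omega>" "u \<omega> \<le> 2" for \<omega>
  proof -
    have "Im (test_pt T j) \<ge> 1" using Im_test_pt[of T j] t by linarith
    then have "norm (stieltjes (emp n \<theta> (X 0 \<omega>)) (test_pt T j)) \<le> 1"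
      by (intro real_distribution.norm_stieltjes_le_1 real_distribution_emp assms)
    moreover have "norm (stieltjes (emp n \<theta> (X t \<omega>)) (char_line (emp n \<theta> (X 0 \<omega>)) t (test_pt T j))) \<le> 1"
      by (intro real_distribution.norm_stieltjes_le_1 real_distribution_emp assms Im_char_line_ge_1[OF _ t Im_test_pt])
    ultimately show "u \<omega> \<le> 2" unfolding u_def test_err_def by (intro order_trans[OF norm_triangle_ineq4]) linarith
  qed (simp add: u_def test_err_def)
  have int: "integrable M (\<lambda>\<omega>. (u \<omega>)\<^sup>2)"
    by (rule integrable_const_bound[where B = 4]) (use ub power_mono[OF ub(2,1), of _ 2] in auto)
  have "\<delta>\<^sup>2 * measure M E = (\<integral>\<omega>. \<delta>\<^sup>2 * indicator E \<omega> \<partial>M)" using E by simp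
  also have "\<dots> \<le> (\<integral>\<omega>. (u \<omega>)\<^sup>2 \<partial>M)"
  proof (rule integral_mono[OF _ int])
    show "integrable M (\<lambda>\<omega>. \<delta>\<^sup>2 * indicator E \<omega>)"
      using E by (intro integrable_mult_right integrable_real_indicator) (auto simp: emeasure_eq_measure)
    show "\<delta>\<^sup>2 * indicator E \<omega> \<le> (u \<omega>)\<^sup>2" for \<omega>
      using \<open>\<delta> > 0\<close> by (auto simp: indicator_def E_def u_def intro!: power_mono)
  qed
  also have "(\<integral>\<omega>. (u \<omega>)\<^sup>2 \<partial>M) \<le> exp (19 * t) * t * var_const \<theta> / (real n)\<^sup>2"
    unfolding u_def test_err_def char_line_def
    by (rule second_moment_bound[OF w]) (use Im_test_pt[of T j] t in auto)
  also have "\<dots> \<le> exp (19 * T) * T * var_const \<theta> / (real n)\<^sup>2"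
    using t assms(3) by (intro divide_right_mono mult_right_mono mult_mono) (auto simp: var_const_def[OF assms(2,3)])
  finally have "measure M E \<le> exp (19 * T) * T * var_const \<theta> / (real n)\<^sup>2 / \<delta>\<^sup>2"
    using \<open>\<delta> > 0\<close> by (subst pos_le_divide_eq) (simp_all add: mult.commute)
  then show "measure M E \<le> exp (19 * T) * T * var_const \<theta> / \<delta>\<^sup>2 / (real n)\<^sup>2"
    by (simp add: divide_divide_eq_left mult.commute)
qed

context
  fixes M :: "'a measure" and \<theta> T :: real and X :: "nat \<Rightarrow> real \<Rightarrow> 'a \<Rightarrow> nat \<Rightarrow> real" and \<mu>0 :: "real measure"
  assumes M: "prob_space M" and \<theta>: "\<theta> > 0" and T: "T \<ge> 0"
    and walk: "\<And>n. n \<ge> 1 \<Longrightarrow> is_NIPRW M n \<theta> (X n)" and rd0: "real_distribution \<mu>0"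
begin

interpretation prob_space M by (rule M)

definition "initial_dist n \<omega> = levy (emp n \<theta> (X n 0 \<omega>)) \<mu>0"

definition "bad S K \<delta> n = {\<omega>\<in>space M. \<exists>s\<in>S. \<exists>j\<in>{..K::nat}. test_err T s (emp n \<theta> (X n 0 \<omega>)) (emp n \<theta> (X n s \<omega>)) j \<ge> \<delta>}"

lemma initial_dist_set: "n \<ge> 1 \<Longrightarrow> {\<omega>\<in>space M. initial_dist n \<omega> > \<epsilon>} \<in> sets M"
  unfolding initial_dist_def using walk_set[OF M _ \<theta> walk, of n 0 "\<lambda>x. levy (emp n \<theta> x) \<mu>0 > \<epsilon>"] by simp

lemma initial_dist_nonneg: "n \<ge> 1 \<Longrightarrow> initial_dist n \<omega> \<ge> 0"
  unfolding initial_dist_def by (intro levy_nonneg real_distribution_emp rd0)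

lemma bad_prob_le:
  assumes "finite S" "S \<subseteq> {0..T}" "\<delta> > 0"
  shows "n \<ge> 1 \<Longrightarrow> bad S K \<delta> n \<in> sets M"
    and "\<exists>C\<ge>0. \<forall>n\<ge>1. measure M (bad S K \<delta> n) \<le> C / (real n)\<^sup>2"
proof -
  let ?E = "\<lambda>n s j. {\<omega>\<in>space M. test_err T s (emp n \<theta> (X n 0 \<omega>)) (emp n \<theta> (X n s \<omega>)) j \<ge> \<delta>}"
  let ?C = "exp (19 * T) * T * var_const \<theta> / \<delta>\<^sup>2"
  have bad: "bad S K \<delta> n = (\<Union>(s, j)\<in>S \<times> {..K}. ?E n s j)" for n
    unfolding bad_def by auto
  have E: "?E n s j \<in> sets M" "measure M (?E n s j) \<le> ?C / (real n)\<^sup>2" if "n \<ge> 1" "s \<in> S" for n s j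
    using test_err_prob_le[OF M that(1) \<theta> walk[OF that(1)] _ _ assms(3), of s T j] that assms(2) by auto
  show B: "bad S K \<delta> n \<in> sets M" if "n \<ge> 1" for n
    unfolding bad using E(1)[OF that] assms(1) by (intro sets.finite_UN) auto
  show "\<exists>C\<ge>0. \<forall>n\<ge>1. measure M (bad S K \<delta> n) \<le> C / (real n)\<^sup>2"
  proof (intro exI[of _ "real (card (S \<times> {..K})) * ?C"] conjI allI impI)
    show "0 \<le> real (card (S \<times> {..K})) * ?C" using T \<theta> by (auto simp: var_const_def[OF order_refl \<theta>])
    fix n :: nat assume n: "n \<ge> 1"
    have "measure M (bad S K \<delta> n) \<le> (\<Sum>p\<in>S \<times> {..K}. measure M (case p of (s, j) \<Rightarrow> ?E n s j))"
      unfolding bad using E(1)[OF n] assms(1) by (intro finite_measure_subadditive_finite) auto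
    also have "\<dots> \<le> (\<Sum>p\<in>S \<times> {..K}. ?C / (real n)\<^sup>2)"
      using E(2)[OF n] by (intro sum_mono) auto
    finally show "measure M (bad S K \<delta> n) \<le> real (card (S \<times> {..K})) * ?C / (real n)\<^sup>2" by simp
  qed
qed

lemma conv_as_imp_conv_in_prob:
  assumes "conv_as M initial_dist"
  shows "conv_in_prob M initial_dist"
  unfolding conv_in_prob_def
proof (intro allI impI)
  fix \<epsilon> :: real assume "\<epsilon> > 0"
  let ?A = "\<lambda>n. {\<omega>\<in>space M. initial_dist n \<omega> > \<epsilon>}"
  \<comment> \<open>The index is shifted by one because the hypothesis on the walk, and with it
    measurability, starts at n = 1.\<close>
  have "(\<lambda>n. \<integral>\<omega>. indicator (?A (Suc n)) \<omega> \<partial>M :: real) \<longlonglongrightarrow> (\<integral>\<omega>. 0 \<partial>M)"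
  proof (rule integral_dominated_convergence[where w = "\<lambda>_. 1"])
    show "AE \<omega> in M. (\<lambda>n. indicator (?A (Suc n)) \<omega> :: real) \<longlonglongrightarrow> 0"
      using assms unfolding conv_as_def
    proof eventually_elim
      case (elim \<omega>)
      from order_tendstoD(2)[OF LIMSEQ_Suc[OF elim] \<open>\<epsilon> > 0\<close>]
      have "eventually (\<lambda>n. indicator (?A (Suc n)) \<omega> = (0::real)) sequentially"
        by eventually_elim (auto simp: indicator_def)
      then show ?case by (rule tendsto_eventually)
    qed
    show "(\<lambda>\<omega>. indicator (?A (Suc n)) \<omega> :: real) \<in> borel_measurable M" for n
      using initial_dist_set[of "Suc n" \<epsilon>] by simp
  qed auto
  then have "(\<lambda>n. measure M (?A (Suc n))) \<longlonglongrightarrow> 0" using initial_dist_set by simp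
  then have "(\<lambda>n. outer_prob M (?A (Suc n))) \<longlonglongrightarrow> 0" using outer_prob_eq[OF initial_dist_set] by simp
  then show "(\<lambda>n. outer_prob M (?A n)) \<longlonglongrightarrow> 0" by (simp add: filterlim_sequentially_Suc[of "\<lambda>n. outer_prob M (?A n)"])
qed

lemma inverse_square_tendsto: "(\<lambda>n. C / (real n)\<^sup>2) \<longlonglongrightarrow> 0"
  by real_asymp

text \<open>Realizations are chosen instead of random limits: for given t and k, some n makes the
  probability of a bad initial distance or a bad test error less than 1, so a good \<omega> exists.
  The resulting deterministic sequence may depend on t, since each time is treated alone.\<close>

lemma limit_process_exists:
  assumes initial_dist: "conv_in_prob M initial_dist"
  shows "\<exists>\<mu>. limit_process T \<mu>0 \<mu>"
proof -
  have ex: "\<exists>\<nu>. real_distribution \<nu> \<and> density_le_one \<nu> \<and>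
     (\<forall>z. Im z > 3 * T + 2 \<longrightarrow> stieltjes \<nu> (char_line \<mu>0 t z) = stieltjes \<mu>0 z)" if t: "t \<in> {0..T}" for t
  proof -
    have "\<exists>n\<ge>Suc k. \<exists>\<omega>\<in>space M. initial_dist n \<omega> \<le> 1 / real (Suc k) \<and>
       (\<forall>j\<le>k. test_err T t (emp n \<theta> (X n 0 \<omega>)) (emp n \<theta> (X n t \<omega>)) j < 1 / real (Suc k))" for k
    proof -
      let ?\<delta> = "1 / real (Suc k)"
      let ?A = "\<lambda>n. {\<omega>\<in>space M. initial_dist n \<omega> > ?\<delta>}"
      obtain C where C: "\<And>n. n \<ge> 1 \<Longrightarrow> measure M (bad {t} k ?\<delta> n) \<le> C / (real n)\<^sup>2"
        using bad_prob_le(2)[of "{t}" ?\<delta> k] t by auto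
      have "(\<lambda>n. outer_prob M (?A n) + C / (real n)\<^sup>2) \<longlonglongrightarrow> 0 + 0"
        using initial_dist by (intro tendsto_add inverse_square_tendsto) (auto simp: conv_in_prob_def)
      then have "eventually (\<lambda>n. outer_prob M (?A n) + C / (real n)\<^sup>2 < 1) sequentially"
        by (rule order_tendstoD) simp
      then obtain n where n: "n \<ge> Suc k" "outer_prob M (?A n) + C / (real n)\<^sup>2 < 1"
        using eventually_happens'[OF sequentially_bot eventually_conj[OF _ eventually_ge_at_top[of "Suc k"]]] by blast
      then have n1: "n \<ge> 1" by simp
      have sets: "?A n \<in> sets M" "bad {t} k ?\<delta> n \<in> sets M" using initial_dist_set[OF n1] bad_prob_le(1)[OF _ _ _ n1, of "{t}"] t by auto
      have "measure M (?A n \<union> bad {t} k ?\<delta> n) \<le> measure M (?A n) + measure M (bad {t} k ?\<delta> n)"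
        by (rule measure_Un_le[OF sets])
      also have "\<dots> < 1" using n(2) C[OF n1] outer_prob_eq[OF sets(1)] by linarith
      finally have "?A n \<union> bad {t} k ?\<delta> n \<noteq> space M" using prob_space by auto
      moreover have "?A n \<union> bad {t} k ?\<delta> n \<subseteq> space M" by (auto simp: bad_def)
      ultimately obtain \<omega> where "\<omega> \<in> space M" "\<omega> \<notin> ?A n" "\<omega> \<notin> bad {t} k ?\<delta> n" by blast
      then show ?thesis using n(1)
        by (intro exI[of _ n] conjI bexI[of _ \<omega>]) (auto simp: bad_def not_less not_le)
    qed
    then obtain n \<omega> where n: "\<And>k. n k \<ge> Suc k" and \<omega>: "\<And>k. \<omega> k \<in> space M" "\<And>k. initial_dist (n k) (\<omega> k) \<le> 1 / real (Suc k)"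
      "\<And>k j. j \<le> k \<Longrightarrow> test_err T t (emp (n k) \<theta> (X (n k) 0 (\<omega> k))) (emp (n k) \<theta> (X (n k) t (\<omega> k))) j < 1 / real (Suc k)"
      by metis
    have n1: "n k \<ge> 1" for k using n[of k] by simp
    show ?thesis
    proof (rule char_limit_exists[OF rd0])
      show "real_distribution (emp (n k) \<theta> (X (n k) 0 (\<omega> k)))" "real_distribution (emp (n k) \<theta> (X (n k) t (\<omega> k)))" for k
        by (intro real_distribution_emp n1)+
      show "(\<lambda>k. levy (emp (n k) \<theta> (X (n k) 0 (\<omega> k))) \<mu>0) \<longlonglongrightarrow> 0"
      proof (rule tendsto_0_by_inverse_Suc)
        show "\<bar>levy (emp (n k) \<theta> (X (n k) 0 (\<omega> k))) \<mu>0\<bar> \<le> 1 / real (Suc k)" for k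
          using \<omega>(2)[of k] initial_dist_nonneg[OF n1, of k "\<omega> k"] unfolding initial_dist_def by linarith
      qed
      show "(\<lambda>k. test_err T t (emp (n k) \<theta> (X (n k) 0 (\<omega> k))) (emp (n k) \<theta> (X (n k) t (\<omega> k))) j) \<longlonglongrightarrow> 0" for j
      proof (rule tendsto_0_by_inverse_Suc[of j])
        show "\<bar>test_err T t (emp (n k) \<theta> (X (n k) 0 (\<omega> k))) (emp (n k) \<theta> (X (n k) t (\<omega> k))) j\<bar> \<le> 1 / real (Suc k)"
          if "j \<le> k" for k
          using \<omega>(3)[OF that] less_imp_le unfolding abs_of_nonneg[OF test_err_nonneg] by blast
      qed
      show "measure (emp (n k) \<theta> (X (n k) t (\<omega> k))) {a<..b} \<le> b - a + 1 / real (n k)" if "a \<le> b" for k a b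
        using t walk_in_Wset[OF M n1 \<theta> walk[OF n1] _ \<omega>(1)] by (intro measure_emp_Ioc_le n1 \<theta> that) auto
      show "(\<lambda>k. 1 / real (n k)) \<longlonglongrightarrow> 0"
      proof (rule tendsto_0_by_inverse_Suc)
        fix k
        have "1 / real (n k) \<le> 1 / real (Suc k)" using n[of k] by (intro divide_left_mono) (auto simp del: of_nat_Suc)
        then show "\<bar>1 / real (n k)\<bar> \<le> 1 / real (Suc k)" by (simp only: abs_of_nonneg zero_le_divide_1_iff of_nat_0_le_iff)
      qed
    qed (use t in auto)
  qed
  then obtain \<mu> where \<mu>: "\<And>t. t \<in> {0..T} \<Longrightarrow> real_distribution (\<mu> t)" "\<And>t. t \<in> {0..T} \<Longrightarrow> density_le_one (\<mu> t)"
     "\<And>t z. t \<in> {0..T} \<Longrightarrow> Im z > 3 * T + 2 \<Longrightarrow> stieltjes (\<mu> t) (char_line \<mu>0 t z) = stieltjes \<mu>0 z"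
    by metis
  then have cf: "char_family T \<mu>0 \<mu>" by (auto simp: char_family_def)
  \<comment> \<open>At time 0 the lines have not moved, so the transforms of both measures agree at
    the test points.\<close>
  have "\<mu> 0 = \<mu>0"
  proof (rule stieltjes_unique_accumulation[OF \<mu>(1) rd0 _ even_test_pt_islimpt[OF rd0 order_refl T]])
    show "test_pt T ` {j. even j} \<subseteq> {z. Im z > 0}"
    proof clarify
      show "Im (test_pt T j) > 0" for j using Im_test_pt[of T j] T by linarith
    qed
    show "stieltjes (\<mu> 0) z = stieltjes \<mu>0 z" if "z \<in> test_pt T ` {j. even j}" for z
      using \<mu>(3)[of 0 z] that T Im_test_pt[of T] by (auto simp: char_line_def)
  qed (use T in auto)
  then show ?thesis
    using char_family_imp_limit_process[OF rd0 cf T] \<mu>(2) by auto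
qed

lemma limit_process_unique:
  assumes "limit_process T \<mu>0 \<mu>" "limit_process T \<mu>0 \<nu>" "t \<in> {0..T}"
  shows "\<mu> t = \<nu> t"
  using char_family_unique[OF rd0 limit_process_imp_char_family[OF T assms(1)] limit_process_imp_char_family[OF T assms(2)]] assms(3)
  by auto

definition "path_dist \<mu> n \<omega> = skorokhod T levy (\<lambda>t. emp n \<theta> (X n t \<omega>)) \<mu>"

context
  fixes \<mu> :: "real \<Rightarrow> real measure"
  assumes lp: "limit_process T \<mu>0 \<mu>"
begin

lemma limit_rd: "t \<in> {0..T} \<Longrightarrow> real_distribution (\<mu> t)"
  using lp by (auto simp: limit_process_def M1_iff)

lemma path_dist_nonneg: "n \<ge> 1 \<Longrightarrow> path_dist \<mu> n \<omega> \<ge> 0"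
  unfolding path_dist_def by (intro skorokhod_nonneg levy_le_one real_distribution_emp limit_rd)

text \<open>Separates the dynamics from the initial data: the exceptional sets have probability of
  order n^-2, and the initial data enter only through
  \<open>initial_dist n \<omega> < \<delta>\<close>. The same sets thus serve both modes of
  convergence.\<close>

lemma exceptional_set:
  assumes "\<epsilon> > 0"
  shows "\<exists>\<delta>>0. \<exists>C. \<exists>B. \<forall>n\<ge>1. B n \<in> sets M \<and> measure M (B n) \<le> C / (real n)\<^sup>2 \<and>
     (\<forall>\<omega>\<in>space M - B n. initial_dist n \<omega> < \<delta> \<longrightarrow> path_dist \<mu> n \<omega> \<le> \<epsilon>)"
proof -
  have atomless: "measure (\<mu> t) {x} = 0" if "0 \<le> t" "t \<le> T" for t x
    using lp that by (intro density_le_one_atomless) (auto simp: limit_process_def)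
  obtain S K \<delta> where S: "\<delta> > 0" "finite S" "S \<subseteq> {0..T}"
    and good: "\<And>n x. n \<ge> 1 \<Longrightarrow> (\<forall>s t. 0 \<le> s \<longrightarrow> s \<le> t \<longrightarrow> x s \<le> x t) \<Longrightarrow>
     levy (emp n \<theta> (x 0)) \<mu>0 < \<delta> \<Longrightarrow> (\<forall>s\<in>S. \<forall>j\<le>K. test_err T s (emp n \<theta> (x 0)) (emp n \<theta> (x s)) j < \<delta>) \<Longrightarrow>
     skorokhod T levy (\<lambda>t. emp n \<theta> (x t)) \<mu> \<le> \<epsilon>"
    using skorokhod_stability[OF rd0 limit_process_imp_char_family[OF T lp] T \<theta> atomless assms] by blast
  obtain C where C: "\<And>n. n \<ge> 1 \<Longrightarrow> measure M (bad S K \<delta> n) \<le> C / (real n)\<^sup>2"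
    using bad_prob_le(2)[OF S(2,3,1)] by blast
  \<comment> \<open>The set of non-monotone paths need not be measurable; a null set containing it
    is chosen for every n.\<close>
  define Q where "Q n N \<longleftrightarrow> N \<in> null_sets M \<and>
     {\<omega>\<in>space M. \<not> (\<forall>s t. 0 \<le> s \<longrightarrow> s \<le> t \<longrightarrow> X n s \<omega> \<le> X n t \<omega>)} \<subseteq> N" for n N
  have "\<exists>N. Q n N" if "n \<ge> 1" for n
    using walk_mono_all_AE[OF M that \<theta> walk[OF that]] unfolding Q_def by (auto elim!: AE_E intro: null_setsI)
  then obtain N where "\<And>n. n \<ge> 1 \<Longrightarrow> Q n (N n)" by metis
  then have N: "N n \<in> null_sets M"
     "{\<omega>\<in>space M. \<not> (\<forall>s t. 0 \<le> s \<longrightarrow> s \<le> t \<longrightarrow> X n s \<omega> \<le> X n t \<omega>)} \<subseteq> N n" if "n \<ge> 1" for n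
    using that unfolding Q_def by blast+
  have "bad S K \<delta> n \<union> N n \<in> sets M \<and> measure M (bad S K \<delta> n \<union> N n) \<le> C / (real n)\<^sup>2 \<and>
     (\<forall>\<omega>\<in>space M - (bad S K \<delta> n \<union> N n). initial_dist n \<omega> < \<delta> \<longrightarrow> path_dist \<mu> n \<omega> \<le> \<epsilon>)" if n: "n \<ge> 1" for n
  proof (intro conjI ballI impI)
    have sets: "bad S K \<delta> n \<in> sets M" "N n \<in> sets M" using bad_prob_le(1)[OF S(2,3,1) n] N(1)[OF n] by auto
    then show "bad S K \<delta> n \<union> N n \<in> sets M" by simp
    show "measure M (bad S K \<delta> n \<union> N n) \<le> C / (real n)\<^sup>2"
      using C[OF n] measure_Un_null_set[OF sets(1) N(1)[OF n]] by simp
    fix \<omega> assume \<omega>: "\<omega> \<in> space M - (bad S K \<delta> n \<union> N n)" and "initial_dist n \<omega> < \<delta>"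
    have "\<forall>s t. 0 \<le> s \<longrightarrow> s \<le> t \<longrightarrow> X n s \<omega> \<le> X n t \<omega>" using \<omega> N(2)[OF n] by blast
    moreover have "\<forall>s\<in>S. \<forall>j\<le>K. test_err T s (emp n \<theta> (X n 0 \<omega>)) (emp n \<theta> (X n s \<omega>)) j < \<delta>"
      using \<omega> by (auto simp: bad_def not_le)
    ultimately show "path_dist \<mu> n \<omega> \<le> \<epsilon>"
      using good[OF n, of "\<lambda>t. X n t \<omega>"] \<open>initial_dist n \<omega> < \<delta>\<close> by (simp add: initial_dist_def path_dist_def)
  qed
  note main = this
  show ?thesis
    by (rule exI[of _ \<delta>], rule conjI[OF S(1)], rule exI[of _ C], rule exI[of _ "\<lambda>n. bad S K \<delta> n \<union> N n"])
       (intro allI impI main)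
qed

text \<open>Borel-Cantelli for each tolerance 1 / (m + 1), then countably many tolerances at
  once.\<close>

lemma path_dist_conv_as:
  assumes "conv_as M initial_dist"
  shows "conv_as M (path_dist \<mu>)"
proof -
  have "AE \<omega> in M. eventually (\<lambda>n. path_dist \<mu> (Suc n) \<omega> \<le> 1 / real (Suc m)) sequentially" for m
  proof -
    have pos: "1 / real (Suc m) > 0" by simp
    obtain \<delta> C B where \<delta>: "\<delta> > 0" and B: "\<And>n. n \<ge> 1 \<Longrightarrow> B n \<in> sets M" "\<And>n. n \<ge> 1 \<Longrightarrow> measure M (B n) \<le> C / (real n)\<^sup>2"
      "\<And>n \<omega>. n \<ge> 1 \<Longrightarrow> \<omega> \<in> space M - B n \<Longrightarrow> initial_dist n \<omega> < \<delta> \<Longrightarrow> path_dist \<mu> n \<omega> \<le> 1 / real (Suc m)"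
      using exceptional_set[OF pos] by metis
    have "summable (\<lambda>n. C * inverse ((real (Suc n))\<^sup>2))"
      using inverse_power_summable[of 2, where 'a = real] by (intro summable_mult, subst summable_Suc_iff[of "\<lambda>n. inverse ((real n)\<^sup>2)"]) simp
    then have "summable (\<lambda>n. measure M (B (Suc n)))"
      by (rule summable_comparison_test'[where N = 0]) (use B(2)[of "Suc n" for n] in \<open>simp add: divide_inverse\<close>)
    then have "AE \<omega> in M. eventually (\<lambda>n. \<omega> \<in> space M - B (Suc n)) sequentially"
      using B(1) by (intro borel_cantelli_AE1) (auto simp: emeasure_eq_measure)
    then show ?thesis using assms unfolding conv_as_def
    proof eventually_elim
      case (elim \<omega>)
      from elim(1) order_tendstoD(2)[OF LIMSEQ_Suc[OF elim(2)] \<delta>] show ?case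
        by eventually_elim (use B(3) in auto)
    qed
  qed
  then have "AE \<omega> in M. \<forall>m. eventually (\<lambda>n. path_dist \<mu> (Suc n) \<omega> \<le> 1 / real (Suc m)) sequentially"
    by (simp add: AE_all_countable)
  then show ?thesis unfolding conv_as_def
  proof eventually_elim
    case (elim \<omega>)
    have "(\<lambda>n. path_dist \<mu> (Suc n) \<omega>) \<longlonglongrightarrow> 0"
    proof (rule LIMSEQ_I)
      fix r :: real assume "r > 0"
      then obtain m where m: "1 / real (Suc m) < r" using nat_approx_posE by blast
      then obtain N where "\<And>n. n \<ge> N \<Longrightarrow> path_dist \<mu> (Suc n) \<omega> \<le> 1 / real (Suc m)"
        using elim by (auto simp: eventually_sequentially)
      then show "\<exists>N. \<forall>n\<ge>N. norm (path_dist \<mu> (Suc n) \<omega> - 0) < r"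
        using m path_dist_nonneg[of "Suc n" \<omega> for n] by (intro exI[of _ N]) (auto intro: le_less_trans)
    qed
    then show ?case by (simp add: filterlim_sequentially_Suc[of "\<lambda>n. path_dist \<mu> n \<omega>"])
  qed
qed

text \<open>\<open>path_dist\<close> need not be measurable, so its outer probability is estimated
  through a measurable cover: the event of a large initial distance together with the exceptional
  set.\<close>

lemma path_dist_conv_in_prob:
  assumes "conv_in_prob M initial_dist"
  shows "conv_in_prob M (path_dist \<mu>)"
  unfolding conv_in_prob_def
proof (intro allI impI)
  fix \<epsilon> :: real assume "\<epsilon> > 0"
  obtain \<delta> C B where \<delta>: "\<delta> > 0" and B: "\<And>n. n \<ge> 1 \<Longrightarrow> B n \<in> sets M" "\<And>n. n \<ge> 1 \<Longrightarrow> measure M (B n) \<le> C / (real n)\<^sup>2"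
    "\<And>n \<omega>. n \<ge> 1 \<Longrightarrow> \<omega> \<in> space M - B n \<Longrightarrow> initial_dist n \<omega> < \<delta> \<Longrightarrow> path_dist \<mu> n \<omega> \<le> \<epsilon>"
    using exceptional_set[OF \<open>\<epsilon> > 0\<close>] by metis
  \<comment> \<open>With \<delta> / 2 the complement, given by a weak inequality, still lies in
    \<open>initial_dist n \<omega> < \<delta>\<close>.\<close>
  let ?A = "\<lambda>n. {\<omega>\<in>space M. initial_dist n \<omega> > \<delta> / 2}"
  have up: "outer_prob M {\<omega>\<in>space M. path_dist \<mu> n \<omega> > \<epsilon>} \<le> outer_prob M (?A n) + C / (real n)\<^sup>2" if n: "n \<ge> 1" for n
  proof -
    have "outer_prob M {\<omega>\<in>space M. path_dist \<mu> n \<omega> > \<epsilon>} \<le> measure M (?A n \<union> B n)"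
    proof (rule outer_prob_le)
      show "?A n \<union> B n \<in> sets M" by (rule sets.Un[OF initial_dist_set[OF n] B(1)[OF n]])
      show "{\<omega>\<in>space M. path_dist \<mu> n \<omega> > \<epsilon>} \<subseteq> ?A n \<union> B n"
      proof
        fix \<omega> assume \<omega>: "\<omega> \<in> {\<omega>\<in>space M. path_dist \<mu> n \<omega> > \<epsilon>}"
        show "\<omega> \<in> ?A n \<union> B n"
        proof (rule ccontr)
          assume "\<omega> \<notin> ?A n \<union> B n"
          then have "\<omega> \<in> space M - B n" "initial_dist n \<omega> < \<delta>" using \<omega> \<delta> by auto
          from B(3)[OF n this] \<omega> show False by simp
        qed
      qed
    qed
    also have "\<dots> \<le> measure M (?A n) + measure M (B n)" by (rule measure_Un_le[OF initial_dist_set[OF n] B(1)[OF n]])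
    finally show ?thesis using B(2)[OF n] outer_prob_eq[OF initial_dist_set[OF n], of "\<delta> / 2"] by linarith
  qed
  have "(\<lambda>n. outer_prob M (?A n) + C / (real n)\<^sup>2) \<longlonglongrightarrow> 0 + 0"
    using assms[unfolded conv_in_prob_def, rule_format, of "\<delta> / 2"] \<delta> by (intro tendsto_add inverse_square_tendsto) simp
  then have lim: "(\<lambda>n. outer_prob M (?A n) + C / (real n)\<^sup>2) \<longlonglongrightarrow> 0" by simp
  show "(\<lambda>n. outer_prob M {\<omega>\<in>space M. path_dist \<mu> n \<omega> > \<epsilon>}) \<longlonglongrightarrow> 0"
    by (rule Lim_null_comparison[OF _ lim])
       (use up outer_prob_nonneg[of "{\<omega>\<in>space M. path_dist \<mu> n \<omega> > \<epsilon>}" M for n] in \<open>auto intro!: eventually_sequentiallyI[of 1]\<close>)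
qed

end

end

theorem theorem1p3:
  fixes M :: "'a measure" and \<theta> T :: real and \<mu>0 :: "real measure"
    and X :: "nat \<Rightarrow> real \<Rightarrow> 'a \<Rightarrow> (nat \<Rightarrow> real)"
  assumes "prob_space M" and "\<theta> > 0" and "T > 0"
    and "\<And>n. n \<ge> 1 \<Longrightarrow> is_NIPRW M n \<theta> (X n)"
    and "\<mu>0 \<in> M1"
  defines "D0 \<equiv> (\<lambda>n \<omega>. levy (emp n \<theta> (X n 0 \<omega>)) \<mu>0)"
    and "DT \<equiv> (\<lambda>\<mu> n \<omega>. skorokhod T levy (\<lambda>t. emp n \<theta> (X n t \<omega>)) \<mu>)"
  shows "(conv_as M D0 \<longrightarrow>
            (\<exists>\<mu>. limit_process T \<mu>0 \<mu>) \<and>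
            (\<forall>\<mu> \<nu>. limit_process T \<mu>0 \<mu> \<and> limit_process T \<mu>0 \<nu> \<longrightarrow> (\<forall>t\<in>{0..T}. \<mu> t = \<nu> t)) \<and>
            (\<forall>\<mu>. limit_process T \<mu>0 \<mu> \<longrightarrow> conv_as M (DT \<mu>)))
       \<and> (conv_in_prob M D0 \<longrightarrow>
            (\<exists>\<mu>. limit_process T \<mu>0 \<mu>) \<and>
            (\<forall>\<mu> \<nu>. limit_process T \<mu>0 \<mu> \<and> limit_process T \<mu>0 \<nu> \<longrightarrow> (\<forall>t\<in>{0..T}. \<mu> t = \<nu> t)) \<and>
            (\<forall>\<mu>. limit_process T \<mu>0 \<mu> \<longrightarrow> conv_in_prob M (DT \<mu>)))"
proof -
  have T: "T \<ge> 0" and rd0: "real_distribution \<mu>0" using assms(3,5) by (auto simp: M1_iff)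
  note A = assms(1,2) T assms(4) rd0
  have eq0: "D0 = initial_dist \<theta> X \<mu>0" by (simp add: fun_eq_iff D0_def initial_dist_def[OF A])
  have eqT: "DT = path_dist \<theta> T X" by (simp add: fun_eq_iff DT_def path_dist_def[OF A])
  show ?thesis
    unfolding eq0 eqT
    using limit_process_exists[OF A] conv_as_imp_conv_in_prob[OF A] limit_process_unique[OF A]
      path_dist_conv_as[OF A] path_dist_conv_in_prob[OF A] by blast
qed

end
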